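(* Let $\Delta=(\Sigma,C,w^\pm)$ be a complete simplicial multi-fan in a lattice $L$ of rank $n$, $\mathcal V=\{v_i\}_{i\in\Sigma^{(1)}}$ a set of edge vectors for $\Delta$, and $\xi=\sum_id_ix_i$ a $\mathbb Q$-divisor. Then $$\hat\varphi_{st}(\Delta,\mathcal V,\xi)=\sum_{u\in L^*}t^{-u}\left(\sum_{k=0}^n\ \sum_{J\in\Sigma^{(k)},\,h\in H_J}(-1)^{n-k}\deg(\Delta_J)\,\zeta^{f_{J,h}(\xi)}\,q^{\langle u,v_{J,h}\rangle}\prod_{i\in J}\frac1{1-\zeta^{d_i}q^{\langle u,v_i\rangle}}\right),$$ where $f_{J,h}(\xi)=\sum_{i\in J}d_if_{h,i}$ and $v_{J,h}=\sum_{i\in J}f_{h,i}v_i$.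
   Context: **Multi-fans.** Let $L$ be a lattice of rank $n$, $L_{\mathbb R}=L\otimes\mathbb R$, $L_{\mathbb C}=L\otimes\mathbb C$, $T=L_{\mathbb R}/L$, $L^*$ the dual lattice. A simplicial multi-fan in $L$ is a triple $\Delta=(\Sigma,C,w^\pm)$: $\Sigma$ is a finite abstract simplicial complex including the empty simplex; $\Sigma^{(k)}$ is the set of simplices with $k$ vertices ($\Sigma^{(1)}$ is identified with the vertex set); $\Sigma=\coprod_{k=0}^n\Sigma^{(k)}$, $\Sigma^{(n)}\ne\emptyset$, and every simplex lies in some $I\in\Sigma^{(n)}$. $C$ assigns to $J\in\Sigma^{(k)}$ a $k$-dimensional strongly convex rational polyhedral cone $C(J)\subset L_{\mathbb R}$, with $C(\emptyset)=\{0\}$, such that for each $I\in\Sigma$ the map $J\mapsto C(J)$ is an isomorphism of ordered sets from the faces of $I$ onto the faces of $C(I)$. $w^\pm:\Sigma^{(n)}\to\mathbb Z_{\ge0}$ are maps and $w=w^+-w^-$. **Completeness and degree.** For $K\in\Sigma$ put $L_K=L\cap\operatorname{span}_{\mathbb R}C(K)$, $L^K=L/L_K$. The projected multi-fan $\Delta_K$ in $L^K$ has as simplices the $J\in\Sigma$ with $J\supset K$ (with $K$ as minimum), cones $C_K(J)$ = image of $C(J)$ in $L^K\otimes\mathbb R$, and $w^\pm$ restricted to the $I\in\Sigma^{(n)}$ with $I\supset K$. A vector is generic if it lies in no linear subspace spanned by a cone of dimension less than the rank of the lattice. A multi-fan is pre-complete if $d_v=\sum_{v\in C(I)}w(I)$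 (sum over top-dimensional $I$) is independent of the generic vector $v$; the common value is its degree $\deg$. $\Delta$ is complete if $\Delta_K$ is pre-complete for every $K\in\Sigma$. **Edge vectors.** $\mathcal V=\{v_i\}_{i\in\Sigma^{(1)}}$ with $0\ne v_i\in L\cap C(i)$ (not necessarily primitive). For $J\in\Sigma$, $L_{J,\mathcal V}\subset L_J$ is the sublattice generated by $\{v_i\}_{i\in J}$, $\{u_i^J\}_{i\in J}$ is the basis of $L_{J,\mathcal V}^*$ dual to $\{v_i\}_{i\in J}$, $H_J=L_J/L_{J,\mathcal V}$. For $h\in H_J$ and $i\in J$, $f_{h,i}=\langle u_i^J,v(h)\rangle$ where $v(h)\in L_J$ is the unique representative of $h$ with $0\le\langle u_i^J,v(h)\rangle<1$ for all $i\in J$ (so $v_{J,h}=v(h)\in L_J$). $H_T^*(\Delta,\mathcal V)=\mathbb Z[x_i:i\in\Sigma^{(1)}]/(\prod_{i\in J}x_i:J\notin\Sigma)$, $\deg x_i=2$; a $\mathbb Q$-divisor is $\xi=\sum_id_ix_i\in H_T^2(\Delta,\mathcal V)\otimes\mathbb Q$. **Orbifold elliptic genus.** Put $q=e^{2\pi\sqrt{-1}\tau}$ ($\Im\tau>0$), $\zeta=e^{2\pi\sqrt{-1}\sigma}$, $\zeta^a:=e^{2\pi\sqrt{-1}a\sigma}$, and with $t=e^{2\pi\sqrt{-1}z}$, $$\phi_{st}(z,\tau,\sigma)=\frac{1-\zeta t}{(1-\zeta)(1-t)}\prod_{k\ge1}\frac{(1-q^k)^2(1-\zeta tq^k)(1-\zeta^{-1}t^{-1}q^k)}{(1-\zeta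 q^k)(1-\zeta^{-1}q^k)(1-tq^k)(1-t^{-1}q^k)}.$$ For $w\in L_{\mathbb C}$, $$\hat\varphi_{st}(\Delta,\mathcal V,\xi)(w)=\sum_{I\in\Sigma^{(n)}}\frac{w(I)}{|H_I|}\sum_{(h_1,h_2)\in H_I\times H_I}\prod_{i\in I}\zeta^{d_i\langle u_i^I,v(h_1)\rangle}\phi_{st}\bigl(\langle u_i^I,-w+\tau v(h_1)-v(h_2)\rangle,\tau,d_i\sigma\bigr),$$ with $v(h)\in L$ any representative of $h\in H_I$. $t^u$ ($u\in L^*$) is the character of $T$ regarded as the function $w\mapsto e^{2\pi\sqrt{-1}\langle u,w\rangle}$ on $L_{\mathbb C}$, and $R(T)$ is the character ring. For complete $\Delta$, $\hat\varphi_{st}(\Delta,\mathcal V,\xi)$, expanded in $q$, is an element of $(R(T)\otimes\mathbb C)[[q]]$, and the asserted equality is an equality there: in the coefficient of each $t^{-u}$ on the right-hand side, the factors $1/(1-\zeta^{d_i}q^m)$ are expanded as power series in $q$ (valid for small $|q|$). It is understood that $\zeta^{d_i}\ne1$ for all $i$. *)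

theory Defs
  imports
    "HOL-Analysis.Analysis"
    "HOL-Computational_Algebra.Formal_Laurent_Series"
    "HOL-Library.Poly_Mapping"
begin

section \<open>Lattices\<close>

definition int_span :: "'v::real_vector set \<Rightarrow> 'v set" where
  "int_span B = {\<Sum>b\<in>B. of_int (m b) *\<^sub>R b | m. True}"

text \<open>
  A lattice of rank \<open>n\<close> sits inside \<open>L \<otimes> \<real>\<close>, which is the whole type \<open>'v\<close>. The class
  \<^class>\<open>real_vector\<close> (unlike \<^class>\<open>euclidean_space\<close>) has models of dimension 0, so rank 0 is covered.
\<close>

definition lattice_of_rank :: "'v::real_vector set \<Rightarrow> nat \<Rightarrow> bool" where
  "lattice_of_rank L n \<longleftrightarrow>
     (\<exists>B. finite B \<and> card B = n \<and> independent B \<and> span B = UNIV \<and> L = int_span B)"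

text \<open>
  An element of the dual lattice is given by its unique real-linear extension to \<open>L \<otimes> \<real>\<close>.
\<close>

definition dual_lattice :: "'v::real_vector set \<Rightarrow> ('v \<Rightarrow> real) set" where
  "dual_lattice L = {u. linear u \<and> u ` L \<subseteq> \<int>}"

text \<open>The pairing of \<open>u \<in> L\<^sup>*\<close> with \<open>v \<in> L\<close> as an integer; the floor is exact there.\<close>

definition int_pairing :: "('v \<Rightarrow> real) \<Rightarrow> 'v \<Rightarrow> int" where
  "int_pairing u v = \<lfloor>u v\<rfloor>"

text \<open>
  \<open>L \<otimes> \<complex>\<close> is the type \<open>'v \<times> 'v\<close>, where \<open>(x, y)\<close> stands for \<open>x + \<i> y\<close>. The function \<open>cscale c\<close>
  maps \<open>x \<in> L \<otimes> \<real>\<close> to \<open>c x\<close>, and \<open>cpairing u\<close> is the complex-linear extension of \<open>u\<close>.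
\<close>

definition cscale :: "complex \<Rightarrow> 'v::real_vector \<Rightarrow> 'v \<times> 'v" where
  "cscale c x = (Re c *\<^sub>R x, Im c *\<^sub>R x)"

definition cpairing :: "('v \<Rightarrow> real) \<Rightarrow> 'v \<times> 'v \<Rightarrow> complex" where
  "cpairing u w = Complex (u (fst w)) (u (snd w))"


section \<open>Simplicial multi-fans\<close>

record ('i, 'v) multi_fan =
  simplices :: "'i set set"
  cone_of :: "'i set \<Rightarrow> 'v set"
  wplus :: "'i set \<Rightarrow> nat"
  wminus :: "'i set \<Rightarrow> nat"

definition weight :: "('i, 'v) multi_fan \<Rightarrow> 'i set \<Rightarrow> int" where
  "weight \<Delta> I = int (wplus \<Delta> I) - int (wminus \<Delta> I)"

definition k_simplices :: "('i, 'v) multi_fan \<Rightarrow> nat \<Rightarrow> 'i set set" where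
  "k_simplices \<Delta> k = {J \<in> simplices \<Delta>. card J = k}"

definition vertices :: "('i, 'v) multi_fan \<Rightarrow> 'i set" where
  "vertices \<Delta> = {i. {i} \<in> simplices \<Delta>}"

definition finite_simplicial_complex :: "'i set set \<Rightarrow> bool" where
  "finite_simplicial_complex S \<longleftrightarrow>
     finite S \<and> {} \<in> S \<and> (\<forall>I\<in>S. finite I \<and> (\<forall>J. J \<subseteq> I \<longrightarrow> J \<in> S))"

definition strongly_convex_rational_cone :: "'v::real_vector set \<Rightarrow> 'v set \<Rightarrow> bool" where
  "strongly_convex_rational_cone L C \<longleftrightarrow>
     (\<exists>A. finite A \<and> A \<subseteq> L \<and> C = convex_cone hull A) \<and> C \<inter> uminus ` C = {0}"

text \<open>
  The library's \<open>face_of\<close> also admits the empty face, which is not a face of a cone.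
\<close>

definition simplicial_multi_fan :: "'v::real_vector set \<Rightarrow> nat \<Rightarrow> ('i, 'v) multi_fan \<Rightarrow> bool" where
  "simplicial_multi_fan L n \<Delta> \<longleftrightarrow>
     finite_simplicial_complex (simplices \<Delta>) \<and>
     (\<forall>J\<in>simplices \<Delta>. card J \<le> n) \<and>
     k_simplices \<Delta> n \<noteq> {} \<and>
     (\<forall>J\<in>simplices \<Delta>. \<exists>I\<in>k_simplices \<Delta> n. J \<subseteq> I) \<and>
     (\<forall>J\<in>simplices \<Delta>. strongly_convex_rational_cone L (cone_of \<Delta> J) \<and>
                      dim (cone_of \<Delta> J) = card J) \<and>
     cone_of \<Delta> {} = {0} \<and>
     (\<forall>I\<in>simplices \<Delta>.
        bij_betw (cone_of \<Delta>) (Pow I) {F. F face_of cone_of \<Delta> I \<and> F \<noteq> {}} \<and>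
        (\<forall>J1 J2. J1 \<subseteq> I \<and> J2 \<subseteq> I \<longrightarrow> (J1 \<subseteq> J2 \<longleftrightarrow> cone_of \<Delta> J1 \<subseteq> cone_of \<Delta> J2)))"


section \<open>Projected multi-fans, completeness and degree\<close>

text \<open>
  Let \<open>L\<^sub>K\<close> be \<open>L \<inter> span (C K)\<close> and \<open>L\<^sup>K\<close> be \<open>L / L\<^sub>K\<close>. Since \<open>C K\<close> is rational, \<open>L\<^sup>K \<otimes> \<real>\<close> is the quotient
  of \<open>L \<otimes> \<real>\<close> by \<open>span (C K)\<close>; its points are cosets, and \<open>proj_class \<Delta> K\<close> is the quotient map.
  The simplices of \<open>\<Delta>\<^sub>K\<close> keep all their vertices, so the \<open>n\<close>-element ones are those of top dimension
  (for every \<open>K\<close>).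
\<close>

definition proj_class :: "('i, 'v::real_vector) multi_fan \<Rightarrow> 'i set \<Rightarrow> 'v \<Rightarrow> 'v set" where
  "proj_class \<Delta> K x = {x + y | y. y \<in> span (cone_of \<Delta> K)}"

definition projected :: "('i, 'v::real_vector) multi_fan \<Rightarrow> 'i set \<Rightarrow> ('i, 'v set) multi_fan" where
  "projected \<Delta> K =
     \<lparr>simplices = {J \<in> simplices \<Delta>. K \<subseteq> J},
      cone_of = (\<lambda>J. proj_class \<Delta> K ` cone_of \<Delta> J),
      wplus = wplus \<Delta>, wminus = wminus \<Delta>\<rparr>"

text \<open>
  The linear subspace spanned by the image of \<open>C J\<close> is the image of \<open>span (C J)\<close>. As \<open>C K \<subseteq> C J\<close>, its
  dimension is \<open>dim (C J) - dim (C K)\<close>; the rank of \<open>L\<^sup>K\<close> is \<open>n - dim (C K)\<close>.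
\<close>

definition proj_generic :: "nat \<Rightarrow> ('i, 'v::real_vector) multi_fan \<Rightarrow> 'i set \<Rightarrow> 'v set \<Rightarrow> bool" where
  "proj_generic n \<Delta> K v \<longleftrightarrow>
     v \<in> range (proj_class \<Delta> K) \<and>
     (\<forall>J\<in>simplices (projected \<Delta> K).
        dim (cone_of \<Delta> J) - dim (cone_of \<Delta> K) < n - dim (cone_of \<Delta> K) \<longrightarrow>
        v \<notin> proj_class \<Delta> K ` span (cone_of \<Delta> J))"

definition local_degree :: "nat \<Rightarrow> ('i, 'p) multi_fan \<Rightarrow> 'p \<Rightarrow> int" where
  "local_degree n \<Delta> v = (\<Sum>I \<in> {I \<in> k_simplices \<Delta> n. v \<in> cone_of \<Delta> I}. weight \<Delta> I)"

definition proj_pre_complete :: "nat \<Rightarrow> ('i, 'v::real_vector) multi_fan \<Rightarrow> 'i set \<Rightarrow> bool" where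
  "proj_pre_complete n \<Delta> K \<longleftrightarrow>
     (\<exists>m. \<forall>v. proj_generic n \<Delta> K v \<longrightarrow> local_degree n (projected \<Delta> K) v = m)"

definition proj_degree :: "nat \<Rightarrow> ('i, 'v::real_vector) multi_fan \<Rightarrow> 'i set \<Rightarrow> int" where
  "proj_degree n \<Delta> K =
     (THE m. \<forall>v. proj_generic n \<Delta> K v \<longrightarrow> local_degree n (projected \<Delta> K) v = m)"

definition complete_multi_fan :: "nat \<Rightarrow> ('i, 'v::real_vector) multi_fan \<Rightarrow> bool" where
  "complete_multi_fan n \<Delta> \<longleftrightarrow> (\<forall>K\<in>simplices \<Delta>. proj_pre_complete n \<Delta> K)"


section \<open>Edge vectors\<close>

definition edge_vectors ::
  "'v::real_vector set \<Rightarrow> ('i, 'v) multi_fan \<Rightarrow> ('i \<Rightarrow> 'v) \<Rightarrow> bool" where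
  "edge_vectors L \<Delta> V \<longleftrightarrow> (\<forall>i\<in>vertices \<Delta>. V i \<noteq> 0 \<and> V i \<in> L \<inter> cone_of \<Delta> {i})"

definition sub_lattice ::
  "'v::real_vector set \<Rightarrow> ('i, 'v) multi_fan \<Rightarrow> 'i set \<Rightarrow> 'v set" where
  "sub_lattice L \<Delta> J = L \<inter> span (cone_of \<Delta> J)"

text \<open>
  For a simplex \<open>J\<close> the vectors \<open>V i\<close>, \<open>i \<in> J\<close>, lie on distinct extreme rays of a simplicial cone, so
  \<open>V\<close> is injective on \<open>J\<close> and \<open>V ` J\<close> is linearly independent. The dual basis is thus given by
  \<^const>\<open>representation\<close>, and it is defined on the real span of \<open>V ` J\<close>.
\<close>

definition edge_lattice :: "('i \<Rightarrow> 'v::real_vector) \<Rightarrow> 'i set \<Rightarrow> 'v set" where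
  "edge_lattice V J = int_span (V ` J)"

definition dual_basis :: "('i \<Rightarrow> 'v::real_vector) \<Rightarrow> 'i set \<Rightarrow> 'i \<Rightarrow> 'v \<Rightarrow> real" where
  "dual_basis V J i = (\<lambda>x. representation (V ` J) x (V i))"

definition H_group ::
  "'v::real_vector set \<Rightarrow> ('i, 'v) multi_fan \<Rightarrow> ('i \<Rightarrow> 'v) \<Rightarrow> 'i set \<Rightarrow> 'v set set" where
  "H_group L \<Delta> V J = sub_lattice L \<Delta> J //
     {(x, y). x \<in> sub_lattice L \<Delta> J \<and> y \<in> sub_lattice L \<Delta> J \<and> x - y \<in> edge_lattice V J}"

definition normal_rep :: "('i \<Rightarrow> 'v::real_vector) \<Rightarrow> 'i set \<Rightarrow> 'v set \<Rightarrow> 'v" where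
  "normal_rep V J h = (THE x. x \<in> h \<and> (\<forall>i\<in>J. 0 \<le> dual_basis V J i x \<and> dual_basis V J i x < 1))"

definition f_coord :: "('i \<Rightarrow> 'v::real_vector) \<Rightarrow> 'i set \<Rightarrow> 'v set \<Rightarrow> 'i \<Rightarrow> real" where
  "f_coord V J h i = dual_basis V J i (normal_rep V J h)"

definition f_xi ::
  "('i \<Rightarrow> 'v::real_vector) \<Rightarrow> ('i \<Rightarrow> rat) \<Rightarrow> 'i set \<Rightarrow> 'v set \<Rightarrow> real" where
  "f_xi V d J h = (\<Sum>i\<in>J. of_rat (d i) * f_coord V J h i)"

definition v_vec :: "('i \<Rightarrow> 'v::real_vector) \<Rightarrow> 'i set \<Rightarrow> 'v set \<Rightarrow> 'v" where
  "v_vec V J h = (\<Sum>i\<in>J. f_coord V J h i *\<^sub>R V i)"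


section \<open>The orbifold elliptic genus\<close>

definition e2pi :: "complex \<Rightarrow> complex" where
  "e2pi z = exp (2 * of_real pi * \<i> * z)"

definition zeta_pow :: "complex \<Rightarrow> real \<Rightarrow> complex" where
  "zeta_pow \<sigma> a = e2pi (of_real a * \<sigma>)"

definition phi_st :: "complex \<Rightarrow> complex \<Rightarrow> complex \<Rightarrow> complex" where
  "phi_st z \<tau> \<sigma> =
     (let t = e2pi z; q = e2pi \<tau>; \<zeta> = e2pi \<sigma> in
      (1 - \<zeta> * t) / ((1 - \<zeta>) * (1 - t)) *
      prodinf (\<lambda>j. let k = Suc j in
        ((1 - q ^ k)\<^sup>2 * (1 - \<zeta> * t * q ^ k) * (1 - inverse \<zeta> * inverse t * q ^ k)) /
        ((1 - \<zeta> * q ^ k) * (1 - inverse \<zeta> * q ^ k) * (1 - t * q ^ k) * (1 - inverse t * q ^ k))))"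

text \<open>
  The \<open>\<rat>\<close>-divisor is given by its coefficients \<open>d\<close>. The argument \<open>r\<close> is a choice of
  representatives: \<open>r I h\<close> represents \<open>h \<in> H\<^sub>I\<close>.
\<close>

definition elliptic_genus ::
  "'v::real_vector set \<Rightarrow> nat \<Rightarrow> ('i, 'v) multi_fan \<Rightarrow> ('i \<Rightarrow> 'v) \<Rightarrow> ('i \<Rightarrow> rat) \<Rightarrow>
   ('i set \<Rightarrow> 'v set \<Rightarrow> 'v) \<Rightarrow> complex \<Rightarrow> complex \<Rightarrow> 'v \<times> 'v \<Rightarrow> complex" where
  "elliptic_genus L n \<Delta> V d r \<sigma> \<tau> w =
     (\<Sum>I\<in>k_simplices \<Delta> n. of_int (weight \<Delta> I) / of_nat (card (H_group L \<Delta> V I)) *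
        (\<Sum>(h1, h2)\<in>H_group L \<Delta> V I \<times> H_group L \<Delta> V I. \<Prod>i\<in>I.
           zeta_pow \<sigma> (of_rat (d i) * dual_basis V I i (r I h1)) *
           phi_st (cpairing (dual_basis V I i) (- w + cscale \<tau> (r I h1) - cscale 1 (r I h2)))
                  \<tau> (of_rat (d i) * \<sigma>)))"


section \<open>Expansion in \<open>q\<close>\<close>

definition character :: "('v \<Rightarrow> real) \<Rightarrow> 'v \<times> 'v \<Rightarrow> complex" where
  "character u w = e2pi (cpairing u w)"

text \<open>
  An element of \<open>R(T) \<otimes> \<complex>\<close> is a finitely supported map from \<open>L\<^sup>*\<close> to \<open>\<complex>\<close>, and
  \<open>character_eval\<close> is the function on \<open>L \<otimes> \<complex>\<close> that it defines.
\<close>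

definition character_eval :: "(('v \<Rightarrow> real) \<Rightarrow>\<^sub>0 complex) \<Rightarrow> 'v \<times> 'v \<Rightarrow> complex" where
  "character_eval p w = (\<Sum>u\<in>Poly_Mapping.keys p. Poly_Mapping.lookup p u * character u w)"

text \<open>
  The points \<open>w\<close> at which no argument of \<open>phi_st\<close> in the sum defining the genus is a pole
  \<open>t q\<^sup>k = 1\<close> for any small \<open>q\<close>: as \<open>q\<close> tends to 0, \<open>t q\<^sup>k\<close> can stay at 1 only if the power of
  \<open>q\<close> in it is trivial, and then it is the exponential of minus the pairing of \<open>u\<^sub>i\<^sup>I\<close> with \<open>w + x\<close> for
  some \<open>x \<in> L\<close>.
\<close>

definition regular_points ::
  "'v::real_vector set \<Rightarrow> nat \<Rightarrow> ('i, 'v) multi_fan \<Rightarrow> ('i \<Rightarrow> 'v) \<Rightarrow> ('v \<times> 'v) set" where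
  "regular_points L n \<Delta> V =
     {w. \<forall>I\<in>k_simplices \<Delta> n. \<forall>i\<in>I. \<forall>x\<in>L. cpairing (dual_basis V I i) (w + cscale 1 x) \<notin> \<int>}"

text \<open>
  \<open>E \<in> (R(T) \<otimes> \<complex>)[[q]]\<close> is the expansion in \<open>q\<close> of a function \<open>F\<close> of \<open>\<tau>\<close> and \<open>w\<close>. The
  coefficients of \<open>E\<close> are determined by their values on the complement of finitely many
  families of parallel hyperplanes, hence by \<open>F\<close>.
\<close>

definition q_expansion ::
  "'v::real_vector set \<Rightarrow> ('v \<times> 'v) set \<Rightarrow> (complex \<Rightarrow> 'v \<times> 'v \<Rightarrow> complex) \<Rightarrow>
   (('v \<Rightarrow> real) \<Rightarrow>\<^sub>0 complex) fps \<Rightarrow> bool" where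
  "q_expansion L S F E \<longleftrightarrow>
     (\<forall>N. Poly_Mapping.keys (fps_nth E N) \<subseteq> dual_lattice L) \<and>
     (\<forall>w\<in>S. \<exists>\<epsilon>>0. \<forall>\<tau>. Im \<tau> > 0 \<and> norm (e2pi \<tau>) < \<epsilon> \<longrightarrow>
        (\<lambda>N. character_eval (fps_nth E N) w * e2pi \<tau> ^ N) sums F \<tau> w)"

text \<open>The coefficient of \<open>t\<^sup>u\<close> in an element of \<open>(R(T) \<otimes> \<complex>)[[q]]\<close>, as a series in \<open>q\<close>.\<close>

definition character_coeff ::
  "(('v \<Rightarrow> real) \<Rightarrow>\<^sub>0 complex) fps \<Rightarrow> ('v \<Rightarrow> real) \<Rightarrow> complex fps" where
  "character_coeff E u = Abs_fps (\<lambda>N. Poly_Mapping.lookup (fps_nth E N) u)"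

text \<open>
  The bracket that multiplies \<open>t\<^sup>-\<^sup>u\<close> on the right-hand side. It is computed in the field of formal
  Laurent series in \<open>q\<close>, where \<open>1 / (1 - \<zeta>\<^sup>d q\<^sup>m)\<close> is the expansion for small \<open>q\<close> whatever
  the sign of \<open>m\<close>.
\<close>

definition rhs_coeff ::
  "'v::real_vector set \<Rightarrow> nat \<Rightarrow> ('i, 'v) multi_fan \<Rightarrow> ('i \<Rightarrow> 'v) \<Rightarrow> ('i \<Rightarrow> rat) \<Rightarrow> complex \<Rightarrow>
   ('v \<Rightarrow> real) \<Rightarrow> complex fls" where
  "rhs_coeff L n \<Delta> V d \<sigma> u =
     (\<Sum>k = 0..n. \<Sum>J\<in>k_simplices \<Delta> k. \<Sum>h\<in>H_group L \<Delta> V J.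
        fls_const ((-1) ^ (n - k) * of_int (proj_degree n \<Delta> J) * zeta_pow \<sigma> (f_xi V d J h)) *
        fls_X_intpow (int_pairing u (v_vec V J h)) *
        (\<Prod>i\<in>J. 1 / (1 - fls_const (zeta_pow \<sigma> (of_rat (d i))) * fls_X_intpow (int_pairing u (V i)))))"

end

theory Submission
  imports Defs
begin

text \<open>
  For \<open>|q| < |t| < 1\<close> one has Kronecker's formula \<open>\<phi>\<^sub>s\<^sub>t = \<Sum>\<^sub>m t\<^sup>m / (1 - \<zeta> q\<^sup>m)\<close>, and for \<open>1 < |t| < |q|\<^bsup>-1\<^esup>\<close> the same
  formula with \<open>1 / (1 - \<zeta> q\<^sup>m) - 1\<close> in place of \<open>1 / (1 - \<zeta> q\<^sup>m)\<close>. If the imaginary part \<open>v\<close> of \<open>w\<close> is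
  generic, every factor of the genus can be expanded in this way; which of the two formulas applies to a
  factor without a twist by \<open>h\<^sub>1\<close> is decided by the sign of \<open>\<langle>u\<^sub>i\<^sup>I, v\<rangle>\<close>. Summation over \<open>h\<^sub>2\<close> selects the
  characters in \<open>L\<^sup>*\<close>, and expanding the products of differences groups the terms by the faces \<open>J\<close> of \<open>I\<close>:
  the sum of the \<open>w(I)\<close> with \<open>v\<close> in the image of \<open>C(I)\<close> modulo \<open>C(J)\<close> is the degree of \<open>\<Delta>\<^sub>J\<close>. So the
  coefficient of \<open>t\<^sup>-\<^sup>u\<close> is the asserted bracket, whatever \<open>v\<close> is. The expansion with respect to \<open>v\<close> bounds
  \<open>\<langle>u, v\<rangle>\<close> from above for the characters that occur with a given power of \<open>q\<close>; the freedom to vary \<open>v\<close> makes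
  them finite in number. The remaining regular points follow by continuity.
\<close>

section \<open>Kronecker's formula for \<open>\<phi>\<^sub>s\<^sub>t\<close>\<close>

text \<open>Two expansions of a factor are kept apart. In q alone, or rather in Q =
  q^(1/\<open>denom\<close>), it is the convergent power series \<open>factor_fps\<close>, whose
  coefficients depend continuously on t and know nothing of a generic direction. Only when a single
  coefficient is resummed over the powers of t does v enter. So the sum over the dual lattice is
  never interchanged with the series in q: each power of Q is treated on its own, and nongeneric w
  are reached by a limit of coefficients. Roots of q are forced by the twists by h1; with one common
  denominator all factors become power series in one variable. Replacing q by Q^\<open>denom\<close>
  in the bracket then shows that only integral powers of q remain. Kronecker's formula itself is a
  limit of finite partial fractions in zeta with poles at the powers of q between q^(-N) and q^N.
  The obstacle is the part free of zeta, which need not converge; subtracting the identity at zeta =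
  1/t, where the product vanishes, removes it.\<close>

definition qpoch :: "complex \<Rightarrow> complex \<Rightarrow> nat \<Rightarrow> complex" where
  "qpoch q x n = (\<Prod>k<n. 1 - x * q ^ Suc k)"

text \<open>In the usual notation (x q; q) with infinite index: the product starts at q^1, so that
  the factors 1 - t, 1 - zeta and 1 - zeta t in front of the product in \<open>phi_st\<close> stay
  separate.\<close>

definition qpoch_inf :: "complex \<Rightarrow> complex \<Rightarrow> complex" where
  "qpoch_inf q x = prodinf (\<lambda>k. 1 - x * q ^ Suc k)"

lemma convergent_prod_qpoch:
  fixes q x :: complex
  assumes "norm q < 1"
  shows "convergent_prod (\<lambda>k. 1 - x * q ^ Suc k)"
proof -
  have "summable (\<lambda>k. norm (x * q) * norm q ^ k)"
    using assms by (intro summable_mult summable_geometric) auto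
  also have "(\<lambda>k. norm (x * q) * norm q ^ k) = (\<lambda>k. norm ((1 - x * q ^ Suc k) - 1))"
    by (simp add: norm_mult norm_power fun_eq_iff)
  finally show ?thesis
    by (intro abs_convergent_prod_imp_convergent_prod summable_imp_abs_convergent_prod)
qed

lemma qpoch_LIMSEQ:
  assumes "norm q < 1"
  shows "qpoch q x \<longlonglongrightarrow> qpoch_inf q x"
proof -
  have "(\<lambda>n. \<Prod>k\<le>n. 1 - x * q ^ Suc k) \<longlonglongrightarrow> qpoch_inf q x"
    unfolding qpoch_inf_def by (intro convergent_prod_LIMSEQ convergent_prod_qpoch assms)
  hence "(\<lambda>n. qpoch q x (Suc n)) \<longlonglongrightarrow> qpoch_inf q x"
    by (simp only: qpoch_def lessThan_Suc_atMost)
  thus ?thesis by (rule LIMSEQ_imp_Suc)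
qed

lemma qpoch_inf_nonzero:
  assumes "norm q < 1" "\<And>k. x * q ^ Suc k \<noteq> 1"
  shows "qpoch_inf q x \<noteq> 0"
  unfolding qpoch_inf_def
  by (intro prodinf_nonzero convergent_prod_qpoch assms(1)) (metis assms(2) right_minus_eq)

lemma qpoch_inf_shift:
  assumes "norm q < 1"
  shows "qpoch_inf q x = (1 - x * q) * qpoch_inf q (x * q)"
proof -
  have "qpoch q x (Suc n) = (1 - x * q) * qpoch q (x * q) n" for n
    unfolding qpoch_def by (subst prod.lessThan_Suc_shift) (simp add: mult.assoc)
  moreover have "(\<lambda>n. qpoch q x (Suc n)) \<longlonglongrightarrow> qpoch_inf q x"
    using qpoch_LIMSEQ[OF assms] by (rule LIMSEQ_Suc)
  moreover have "(\<lambda>n. (1 - x * q) * qpoch q (x * q) n) \<longlonglongrightarrow> (1 - x * q) * qpoch_inf q (x * q)"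
    by (intro tendsto_mult tendsto_const qpoch_LIMSEQ assms)
  ultimately show ?thesis by (simp add: LIMSEQ_unique)
qed

text \<open>Up to a constant factor this is Kronecker's quotient theta'(0) theta(zeta t) /
  (theta(zeta) theta(t)) of Jacobi theta functions in multiplicative variables. The product is split
  so that each infinite product can be shifted and taken to the limit on its own.\<close>

definition theta_quotient :: "complex \<Rightarrow> complex \<Rightarrow> complex \<Rightarrow> complex" where
  "theta_quotient q \<zeta> t = (1 - \<zeta> * t) / ((1 - \<zeta>) * (1 - t)) *
     ((qpoch_inf q 1)\<^sup>2 * qpoch_inf q (\<zeta> * t) * qpoch_inf q (inverse \<zeta> * inverse t) /
      (qpoch_inf q \<zeta> * qpoch_inf q (inverse \<zeta>) * qpoch_inf q t * qpoch_inf q (inverse t)))"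

lemma phi_st_eq_theta_quotient:
  assumes "norm (e2pi \<tau>) < 1"
  shows "phi_st z \<tau> \<sigma> = theta_quotient (e2pi \<tau>) (e2pi \<sigma>) (e2pi z)"
proof -
  define t q \<zeta> where "t = e2pi z" "q = e2pi \<tau>" "\<zeta> = e2pi \<sigma>"
  define f where "f = (\<lambda>x k. 1 - x * q ^ Suc k)"
  have cp: "convergent_prod (f x)" for x
    unfolding f_def using assms by (intro convergent_prod_qpoch) (simp add: t_q_\<zeta>_def)
  have "prodinf (\<lambda>j. (f 1 j)\<^sup>2 * f (\<zeta> * t) j * f (inverse \<zeta> * inverse t) j /
           (f \<zeta> j * f (inverse \<zeta>) j * f t j * f (inverse t) j)) =
        (prodinf (f 1))\<^sup>2 * prodinf (f (\<zeta> * t)) * prodinf (f (inverse \<zeta> * inverse t)) /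
           (prodinf (f \<zeta>) * prodinf (f (inverse \<zeta>)) * prodinf (f t) * prodinf (f (inverse t)))"
    by (simp add: prodinf_mult [symmetric] prodinf_divide [symmetric] prodinf_power
         convergent_prod_mult convergent_prod_power convergent_prod_divide cp)
  thus ?thesis
    unfolding phi_st_def theta_quotient_def Let_def t_q_\<zeta>_def [symmetric] qpoch_inf_def
    by (simp add: f_def)
qed

text \<open>Under t -> t q each infinite product gains or loses its first factor. What remains is
  the quotient (1 - 1/(zeta t)) / (1 - 1/t), which is (1 - zeta t) / (1 - t) divided by
  zeta.\<close>

lemma theta_quotient_shift:
  assumes "norm q < 1" "q \<noteq> 0" "t \<noteq> 0" "\<zeta> \<noteq> 0"
  shows "theta_quotient q \<zeta> (t * q) = theta_quotient q \<zeta> t / \<zeta>"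
proof -
  have 1: "qpoch_inf q (inverse \<zeta> * inverse (t * q)) = (1 - inverse \<zeta> * inverse t) * qpoch_inf q (inverse \<zeta> * inverse t)"
    using assms by (subst qpoch_inf_shift) (auto simp: mult.assoc)
  have 2: "qpoch_inf q (inverse (t * q)) = (1 - inverse t) * qpoch_inf q (inverse t)"
    using assms by (subst qpoch_inf_shift) (auto simp: mult.assoc)
  have 3: "qpoch_inf q (\<zeta> * t) = (1 - \<zeta> * (t * q)) * qpoch_inf q (\<zeta> * (t * q))"
    by (subst qpoch_inf_shift) (use assms in \<open>auto simp: mult_ac\<close>)
  have 4: "qpoch_inf q t = (1 - t * q) * qpoch_inf q (t * q)"
    by (subst qpoch_inf_shift) (use assms in \<open>auto simp: mult_ac\<close>)
  \<comment> \<open>At \<open>t = 1\<close> both sides are 0 because division by 0 yields 0, so this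
    pole needs no separate treatment.\<close>
  have 5: "(1 - inverse \<zeta> * inverse t) / (1 - inverse t) = inverse \<zeta> * ((1 - \<zeta> * t) / (1 - t))"
    using assms by (cases "t = 1") (auto simp: field_simps)
  have "theta_quotient q \<zeta> (t * q) =
     ((1 - inverse \<zeta> * inverse t) / (1 - inverse t)) * (((qpoch_inf q 1)\<^sup>2 *
       ((1 - \<zeta> * (t * q)) * qpoch_inf q (\<zeta> * (t * q))) * qpoch_inf q (inverse \<zeta> * inverse t)) /
      ((1 - \<zeta>) * qpoch_inf q \<zeta> * qpoch_inf q (inverse \<zeta>) * ((1 - t * q) * qpoch_inf q (t * q)) * qpoch_inf q (inverse t)))"
    unfolding theta_quotient_def 1 2 by (simp add: divide_simps mult_ac)
  also have "\<dots> = theta_quotient q \<zeta> t / \<zeta>"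
    unfolding 3 [symmetric] 4 [symmetric] 5 theta_quotient_def using assms by (simp add: divide_simps mult_ac)
  finally show ?thesis .
qed

section \<open>Exponentials and quasi-periodicity\<close>

lemma e2pi_add: "e2pi (x + y) = e2pi x * e2pi y"
  by (simp add: e2pi_def ring_distribs exp_add)

lemma e2pi_nonzero [simp]: "e2pi x \<noteq> 0"
  by (simp add: e2pi_def)

lemma e2pi_minus: "e2pi (- x) = inverse (e2pi x)"
  by (simp add: e2pi_def exp_minus)

lemma e2pi_0 [simp]: "e2pi 0 = 1"
  by (simp add: e2pi_def)

lemma e2pi_sum: "e2pi (sum f A) = (\<Prod>x\<in>A. e2pi (f x))"
  by (induction A rule: infinite_finite_induct) (simp_all add: e2pi_add)

lemma norm_e2pi: "norm (e2pi x) = exp (- 2 * pi * Im x)"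
  by (simp add: e2pi_def)

lemma e2pi_of_nat: "e2pi (of_nat n * x) = e2pi x ^ n"
  by (simp add: e2pi_def exp_of_nat_mult [symmetric] mult_ac)

lemma e2pi_of_int: "e2pi (of_int n * x) = e2pi x powi n"
  by (cases n rule: int_cases2) (simp_all add: e2pi_of_nat e2pi_minus power_int_minus)

lemma e2pi_eq_1_iff: "e2pi x = 1 \<longleftrightarrow> x \<in> \<int>"
proof -
  have "e2pi x = 1 \<longleftrightarrow> (\<exists>n. x = of_int n)"
    unfolding e2pi_def exp_eq_1 by (auto simp: complex_eq_iff mult_ac)
  thus ?thesis by (auto simp: Ints_def)
qed

text \<open>It makes a summand of the genus independent of the representative of h1: an integral
  change of a coordinate of v(h1) shifts z by a multiple of \<open>\<tau>\<close>, and the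
  multiplier cancels against the power of zeta in front.\<close>

lemma phi_st_shift:
  assumes "Im \<tau> > 0"
  shows "phi_st (z + of_int n * \<tau>) \<tau> \<sigma> = e2pi (- of_int n * \<sigma>) * phi_st z \<tau> \<sigma>"
proof -
  have q: "norm (e2pi \<tau>) < 1" using assms by (simp add: norm_e2pi)
  have 1: "phi_st (z + \<tau>) \<tau> \<sigma> = e2pi (- \<sigma>) * phi_st z \<tau> \<sigma>" for z
    using theta_quotient_shift[OF q, of "e2pi z" "e2pi \<sigma>"]
    by (simp add: phi_st_eq_theta_quotient[OF q] e2pi_add e2pi_minus field_simps)
  have 2: "phi_st (z + of_nat n * \<tau>) \<tau> \<sigma> = e2pi (- of_nat n * \<sigma>) * phi_st z \<tau> \<sigma>" for z n
  proof (induction n)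
    case (Suc n)
    have "z + of_nat (Suc n) * \<tau> = (z + of_nat n * \<tau>) + \<tau>" by (simp add: algebra_simps)
    hence "phi_st (z + of_nat (Suc n) * \<tau>) \<tau> \<sigma> = e2pi (- \<sigma>) * (e2pi (- of_nat n * \<sigma>) * phi_st z \<tau> \<sigma>)"
      by (simp only: 1 Suc)
    also have "\<dots> = e2pi (- \<sigma> + - of_nat n * \<sigma>) * phi_st z \<tau> \<sigma>" by (simp only: e2pi_add mult.assoc)
    also have "- \<sigma> + - of_nat n * \<sigma> = - of_nat (Suc n) * \<sigma>" by (simp add: algebra_simps)
    finally show ?case .
  qed auto
  show ?thesis
  proof (cases n rule: int_cases2)
    case (nonneg k)
    thus ?thesis using 2[of z k] by simp
  next
    case (nonpos k)
    \<comment> \<open>The negative shift is the positive one read from the shifted point.\<close>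
    have "phi_st z \<tau> \<sigma> = e2pi (- of_nat k * \<sigma>) * phi_st (z + of_int n * \<tau>) \<tau> \<sigma>"
      using 2[of "z + of_int n * \<tau>" k] nonpos by simp
    thus ?thesis using nonpos by (simp add: e2pi_minus)
  qed
qed

text \<open>Partial fractions in x: every factor tends to T at infinity, which gives the constant
  \<open>T ^ card S\<close>, and the poles \<open>1 / c k\<close> are simple. In the induction the
  new factor is T + (1 - T)/(1 - \<open>c i\<close> x); its product with an old fraction splits
  again, and the residue at the new pole is supplied by the induction hypothesis at
  \<open>x = 1 / c i\<close>.\<close>

lemma partial_fraction_prod:
  fixes c :: "'a \<Rightarrow> 'b::field"
  assumes "finite S" "inj_on c S" "\<And>k. k \<in> S \<Longrightarrow> c k \<noteq> 0" "\<And>k. k \<in> S \<Longrightarrow> c k * x \<noteq> 1"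
  shows "(\<Prod>k\<in>S. (1 - T * c k * x) / (1 - c k * x)) =
         T ^ card S + (\<Sum>k\<in>S. (1 - T) * (\<Prod>j\<in>S - {k}. (1 - T * c j / c k) / (1 - c j / c k)) / (1 - c k * x))"
  using assms
proof (induction S arbitrary: x rule: finite_induct)
  case (insert i S)
  define r where "r = (\<lambda>k. (1 - T) * (\<Prod>j\<in>S - {k}. (1 - T * c j / c k) / (1 - c j / c k)))"
  have ne: "c i \<noteq> c k" "c k \<noteq> 0" "c i \<noteq> 0" "c k * x \<noteq> 1" "c i * x \<noteq> 1" if "k \<in> S" for k
    using insert.prems insert.hyps that by (auto simp: inj_on_def)
  have ci: "c i \<noteq> 0" "1 - c i * x \<noteq> 0" using insert.prems by auto
  have IH: "(\<Prod>k\<in>S. (1 - T * c k * y) / (1 - c k * y)) = T ^ card S + (\<Sum>k\<in>S. r k / (1 - c k * y))"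
    if "\<And>k. k \<in> S \<Longrightarrow> c k * y \<noteq> 1" for y
    unfolding r_def by (rule insert.IH) (use insert.prems that in \<open>auto simp: inj_on_def\<close>)
  have "(\<Prod>k\<in>S. (1 - T * c k * (1 / c i)) / (1 - c k * (1 / c i))) =
        T ^ card S + (\<Sum>k\<in>S. r k / (1 - c k * (1 / c i)))"
    by (rule IH) (use ne in \<open>fastforce simp: divide_eq_eq\<close>)
  hence ri: "(\<Prod>j\<in>insert i S - {i}. (1 - T * c j / c i) / (1 - c j / c i)) =
             T ^ card S + (\<Sum>k\<in>S. r k / (1 - c k / c i))"
    using insert.hyps by simp
  have rk: "(1 - T) * (\<Prod>j\<in>insert i S - {k}. (1 - T * c j / c k) / (1 - c j / c k)) =
            r k * ((1 - T * c i / c k) / (1 - c i / c k))" if "k \<in> S" for k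
  proof -
    have "insert i S - {k} = insert i (S - {k})" "i \<notin> S - {k}"
      using insert.hyps that by auto
    thus ?thesis using insert.hyps by (simp add: r_def)
  qed
  have el: "(T + (1 - T) / (1 - c i * x)) * (r k / (1 - c k * x)) =
        (1 - T) * (r k / (1 - c k / c i)) / (1 - c i * x) +
        r k * ((1 - T * c i / c k) / (1 - c i / c k)) / (1 - c k * x)" if "k \<in> S" for k
  proof -
    have n: "1 - c i * x \<noteq> 0" "1 - c k * x \<noteq> 0" "c i - c k \<noteq> 0" "c k - c i \<noteq> 0" "c k \<noteq> 0" "c i \<noteq> 0" using ne[OF that] by auto
    have e: "1 / (1 - c k / c i) = c i / (c i - c k)" "(1 - T * c i / c k) / (1 - c i / c k) = - ((c k - T * c i) / (c i - c k))"
      using n by (auto simp: field_simps)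
    have e': "r k / (1 - c k / c i) = r k * (c i / (c i - c k))"
      using n by (auto simp: field_simps)
    have "(T + (1 - T) / (1 - c i * x)) / (1 - c k * x) =
        (1 - T) * (c i / (c i - c k)) / (1 - c i * x) - ((c k - T * c i) / (c i - c k)) / (1 - c k * x)"
      using n by (simp add: divide_simps) algebra
    from arg_cong[OF this, of "\<lambda>y. r k * y"] show ?thesis
      unfolding e e' by (simp add: ring_distribs divide_inverse mult_ac)
  qed
  have "(\<Prod>k\<in>insert i S. (1 - T * c k * x) / (1 - c k * x)) =
        (T + (1 - T) / (1 - c i * x)) * (T ^ card S + (\<Sum>k\<in>S. r k / (1 - c k * x)))"
    using insert.hyps ci by (simp add: IH ne) (simp add: divide_simps, algebra)
  also have "\<dots> = T ^ Suc (card S) + (1 - T) * T ^ card S / (1 - c i * x) +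
       (\<Sum>k\<in>S. (T + (1 - T) / (1 - c i * x)) * (r k / (1 - c k * x)))"
    by (simp add: algebra_simps sum_distrib_left sum.distrib)
  also have "\<dots> = T ^ Suc (card S) + ((1 - T) * (T ^ card S + (\<Sum>k\<in>S. r k / (1 - c k / c i)))) / (1 - c i * x) +
       (\<Sum>k\<in>S. r k * ((1 - T * c i / c k) / (1 - c i / c k)) / (1 - c k * x))"
  proof -
    have "(\<Sum>k\<in>S. (T + (1 - T) / (1 - c i * x)) * (r k / (1 - c k * x))) =
          (\<Sum>k\<in>S. (1 - T) * (r k / (1 - c k / c i)) / (1 - c i * x)) +
          (\<Sum>k\<in>S. r k * ((1 - T * c i / c k) / (1 - c i / c k)) / (1 - c k * x))"
      unfolding sum.distrib [symmetric] by (intro sum.cong refl el)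
    also have "(\<Sum>k\<in>S. (1 - T) * (r k / (1 - c k / c i)) / (1 - c i * x)) =
               (1 - T) * (\<Sum>k\<in>S. r k / (1 - c k / c i)) / (1 - c i * x)"
      by (simp only: sum_distrib_left sum_divide_distrib)
    finally show ?thesis by (simp only: distrib_left add_divide_distrib add.assoc)
  qed
  also have "\<dots> = T ^ card (insert i S) + (\<Sum>k\<in>insert i S. (1 - T) * (\<Prod>j\<in>insert i S - {k}. (1 - T * c j / c k) / (1 - c j / c k)) / (1 - c k * x))"
    unfolding sum.insert[OF insert.hyps] ri using insert.hyps by (simp add: rk)
  finally show ?case .
qed auto

lemma sum_symmetric_interval:
  fixes f :: "int \<Rightarrow> 'a::comm_monoid_add"
  shows "sum f {- int N..int N} = f 0 + (\<Sum>j<N. f (int (Suc j)) + f (- int (Suc j)))"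
proof (induction N)
  case (Suc N)
  have "{- int (Suc N)..int (Suc N)} = insert (int (Suc N)) (insert (- int (Suc N)) {- int N..int N})"
    by auto
  thus ?case using Suc by (simp add: add_ac)
qed auto

lemma prod_symmetric_interval:
  fixes f :: "int \<Rightarrow> 'a::comm_monoid_mult"
  shows "prod f {- int N..int N} = f 0 * (\<Prod>j<N. f (int (Suc j)) * f (- int (Suc j)))"
proof (induction N)
  case (Suc N)
  have "{- int (Suc N)..int (Suc N)} = insert (int (Suc N)) (insert (- int (Suc N)) {- int N..int N})"
    by auto
  thus ?case using Suc by (simp add: mult_ac)
qed auto

lemma prod_punctured_interval:
  fixes f :: "int \<Rightarrow> 'a::comm_monoid_mult"
  assumes "- int N \<le> k" "k \<le> int N"
  shows "(\<Prod>j\<in>{- int N..int N} - {k}. f (j - k)) =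
         (\<Prod>j<nat (int N - k). f (int (Suc j))) * (\<Prod>j<nat (int N + k). f (- int (Suc j)))"
proof -
  have "{- int N..int N} - {k} = {k+1..int N} \<union> {- int N..k - 1}" using assms by auto
  hence "(\<Prod>j\<in>{- int N..int N} - {k}. f (j - k)) =
         (\<Prod>j\<in>{k+1..int N}. f (j - k)) * (\<Prod>j\<in>{- int N..k - 1}. f (j - k))"
    by (simp add: prod.union_disjoint)
  also have "(\<Prod>j\<in>{k+1..int N}. f (j - k)) = (\<Prod>j<nat (int N - k). f (int (Suc j)))"
    by (rule prod.reindex_bij_witness[of _ "\<lambda>j. k + int (Suc j)" "\<lambda>j. nat (j - k - 1)"])
       (use assms in auto)
  also have "(\<Prod>j\<in>{- int N..k - 1}. f (j - k)) = (\<Prod>j<nat (int N + k). f (- int (Suc j)))"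
    by (rule prod.reindex_bij_witness[of _ "\<lambda>j. k - int (Suc j)" "\<lambda>j. nat (k - 1 - j)"])
       (use assms in auto)
  finally show ?thesis .
qed

text \<open>The modes k and -k of Kronecker's sum together, after t^k has been removed from the
  positive one. What is removed belongs to t/(1 - t), and the remaining terms carry a factor q^k, so
  the series over k >= 1 converges on the whole annulus |q| < |t| < 1/|q|.\<close>

definition lambert_term :: "complex \<Rightarrow> complex \<Rightarrow> complex \<Rightarrow> nat \<Rightarrow> complex" where
  "lambert_term q \<zeta> t k = t ^ k * (\<zeta> * q ^ k / (1 - \<zeta> * q ^ k)) -
     inverse t ^ k * (inverse \<zeta> * q ^ k / (1 - inverse \<zeta> * q ^ k))"

lemma has_sum_mult_Times:
  fixes f :: "'a \<Rightarrow> complex" and g :: "'b \<Rightarrow> complex"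
  assumes "(f has_sum a) A" "(g has_sum b) B"
  shows "((\<lambda>(x, y). f x * g y) has_sum a * b) (A \<times> B)"
proof (rule has_sum_SigmaI)
  show "((\<lambda>y. case (x, y) of (x, y) \<Rightarrow> f x * g y) has_sum f x * b) B" for x
    using has_sum_cmult_right[OF assms(2)] by simp
  show "((\<lambda>x. f x * b) has_sum a * b) A"
    by (rule has_sum_cmult_left[OF assms(1)])
  have fg: "(\<lambda>x. norm (f x)) summable_on A" "(\<lambda>x. norm (g x)) summable_on B"
    using assms has_sum_imp_summable summable_on_iff_abs_summable_on_complex by blast+
  have "(\<lambda>p. norm (case p of (x, y) \<Rightarrow> f x * g y)) summable_on A \<times> B"
    unfolding Infinite_Sum.abs_summable_on_Sigma_iff
  proof (intro conjI ballI)
    fix x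
    show "(\<lambda>y. norm (case (x, y) of (x, y) \<Rightarrow> f x * g y)) summable_on B"
      using summable_on_cmult_right[OF fg(2)] by (simp add: norm_mult)
    show "(\<lambda>x. norm (\<Sum>\<^sub>\<infinity>y\<in>B. norm (case (x, y) of (x, y) \<Rightarrow> f x * g y))) summable_on A"
      using summable_on_cmult_left[OF fg(1)] 
      by (simp add: norm_mult infsum_cmult_right' abs_mult)
  qed
  thus "(\<lambda>(x, y). f x * g y) summable_on A \<times> B" by (rule abs_summable_summable)
qed

lemma has_sum_minus:
  fixes f g :: "'a \<Rightarrow> 'b::real_normed_vector"
  assumes "(f has_sum a) A" "(g has_sum b) A"
  shows "((\<lambda>x. f x - g x) has_sum a - b) A"
  using has_sum_add[OF assms(1), of "\<lambda>x. - g x" "- b"] assms(2) by (simp add: has_sum_uminus)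

text \<open>The annulus |q| < |t| < 1/|q| without t = 1: the two annuli of Kronecker's formula and
  the rest of the circle between them are treated at once.\<close>

locale kronecker =
  fixes q t :: complex
  assumes q: "q \<noteq> 0" "norm q < 1" and t: "norm q < norm t" "norm (t * q) < 1" "t \<noteq> 1"
begin

lemma t0: "t \<noteq> 0" using t(1) by auto

definition qp :: "complex \<Rightarrow> nat \<Rightarrow> complex" where
  "qp x n = qpoch q x n / qpoch q 1 n"

definition qpi :: "complex \<Rightarrow> complex" where
  "qpi x = qpoch_inf q x / qpoch_inf q 1"

lemma q_power_neq_1: "q ^ Suc k \<noteq> 1"
proof
  assume "q ^ Suc k = 1"
  hence "norm q ^ Suc k = 1" by (metis norm_one norm_power)
  thus False using q(2) power_Suc_less_one[of "norm q" k] q(1) by simp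
qed

lemma qpoch_inf_1: "qpoch_inf q 1 \<noteq> 0"
  by (rule qpoch_inf_nonzero) (use q q_power_neq_1 in auto)

lemma qp_LIMSEQ: "qp x \<longlonglongrightarrow> qpi x"
  unfolding qp_def[abs_def] qpi_def
  by (intro tendsto_divide qpoch_LIMSEQ q qpoch_inf_1)

text \<open>The coefficient of 1/(1 - q^k x) in the partial fractions of the product over the
  exponents -N..N, divided by \<open>t ^ N\<close>. Seen from k the window has N - k neighbours
  above and N + k below, hence the two lengths.\<close>

definition residue_coeff :: "nat \<Rightarrow> int \<Rightarrow> complex" where
  "residue_coeff N k = (1 - t) * t powi k * qp t (nat (int N - k)) * qp (inverse t) (nat (int N + k))"

lemma power_int_inj: "inj (\<lambda>k. q powi k)"
proof (rule injI)
  fix a b :: int assume "q powi a = q powi b"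
  hence "norm q powi a = norm q powi b" by (metis norm_power_int)
  moreover have "norm q powi b < norm q powi a" if "a < b" for a b
    using power_int_strict_decreasing[OF that, of "norm q"] q by simp
  ultimately show "a = b" by (metis less_irrefl linorder_neqE)
qed

lemma residue_eq:
  assumes "- int N \<le> k" "k \<le> int N"
  shows "(1 - t) * (\<Prod>j\<in>{- int N..int N} - {k}. (1 - t * q powi j / q powi k) / (1 - q powi j / q powi k)) =
         t ^ N * residue_coeff N k"
proof -
  define g where "g = (\<lambda>l. (1 - t * q powi l) / (1 - q powi l))"
  have "(\<Prod>j\<in>{- int N..int N} - {k}. (1 - t * q powi j / q powi k) / (1 - q powi j / q powi k)) =
        (\<Prod>j\<in>{- int N..int N} - {k}. g (j - k))"
    by (simp add: g_def power_int_diff q)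
  also have "\<dots> = (\<Prod>j<nat (int N - k). g (int (Suc j))) * (\<Prod>j<nat (int N + k). g (- int (Suc j)))"
    by (rule prod_punctured_interval[OF assms])
  also have "(\<Prod>j<nat (int N - k). g (int (Suc j))) = qp t (nat (int N - k))"
    unfolding g_def qp_def qpoch_def prod_dividef [symmetric] power_int_of_nat by simp
  also have "g (- int (Suc j)) = t * ((1 - inverse t * q ^ Suc j) / (1 - q ^ Suc j))" for j
    unfolding g_def power_int_minus power_int_of_nat using q_power_neq_1[of j] q t0
    by (auto simp add: divide_simps algebra_simps)
  hence "(\<Prod>j<nat (int N + k). g (- int (Suc j))) =
         (\<Prod>j<nat (int N + k). t * ((1 - inverse t * q ^ Suc j) / (1 - q ^ Suc j)))"
    by (intro prod.cong refl)
  also have "\<dots> = t ^ nat (int N + k) * qp (inverse t) (nat (int N + k))"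
    unfolding qp_def qpoch_def prod_dividef [symmetric] prod.distrib by simp
  also have "t ^ nat (int N + k) = t ^ N * t powi k"
    using assms t0 by (simp add: power_int_def[symmetric] power_int_add flip: power_int_of_nat)
  finally show ?thesis by (simp add: residue_coeff_def mult_ac)
qed

text \<open>Nonzero and no integral power of \<open>q\<close>, with the exponents split by sign to
  match the factors of \<open>qpoch_inf\<close>. Besides zeta it is applied to 1/t, where |t q| and
  |q/t| are below 1.\<close>

definition adm :: "complex \<Rightarrow> bool" where
  "adm x \<longleftrightarrow> x \<noteq> 0 \<and> x \<noteq> 1 \<and> (\<forall>k. x * q ^ Suc k \<noteq> 1 \<and> inverse x * q ^ Suc k \<noteq> 1)"

lemma adm_powi: assumes "adm x" shows "q powi k * x \<noteq> 1"
proof (cases k rule: int_cases3)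
  case zero thus ?thesis using assms by (auto simp: adm_def)
next
  case (pos n)
  then obtain m where m: "n = Suc m" by (cases n) auto
  have "x * q ^ n \<noteq> 1" using assms m unfolding adm_def by auto
  thus ?thesis using pos by (simp add: mult.commute)
next
  case (neg n)
  then obtain m where m: "n = Suc m" by (cases n) auto
  have "inverse x * q ^ n \<noteq> 1" "x \<noteq> 0" using assms m unfolding adm_def by auto
  thus ?thesis using neg q by (auto simp: power_int_minus field_simps)
qed

lemma norm_tq: "norm (t * q) < 1" "norm (inverse t * q) < 1"
proof -
  have "norm (inverse t * q) = norm q / norm t" by (simp add: norm_mult norm_inverse divide_inverse mult.commute)
  thus "norm (inverse t * q) < 1" using t t0 by simp
qed (rule t(2))

lemma norm_mult_q_power:
  assumes "norm x < 1"
  shows "norm (x * q ^ k) < 1"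
proof -
  have "norm x * norm q ^ k \<le> norm x * 1"
    using q by (intro mult_left_mono) (auto simp: power_le_one)
  thus ?thesis using assms by (simp add: norm_mult norm_power)
qed

lemma adm_inverse_t: "adm (inverse t)"
proof -
  have "t * q ^ Suc k \<noteq> 1" "inverse t * q ^ Suc k \<noteq> 1" for k
    using norm_mult_q_power[OF norm_tq(1), of k] norm_mult_q_power[OF norm_tq(2), of k]
    by (auto simp: mult.assoc)
  thus ?thesis using t t0 by (simp add: adm_def)
qed

lemma qpoch_inf_adm_nonzero:
  assumes "adm x"
  shows "qpoch_inf q x \<noteq> 0" "qpoch_inf q (inverse x) \<noteq> 0"
  by (rule qpoch_inf_nonzero; use assms q in \<open>auto simp: adm_def simp del: power_Suc\<close>)+

text \<open>The part of the expansion that depends on \<open>x\<close>. At positive exponents the 1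
  in 1/(1 - y) = 1 + y/(1 - y) is split off, at negative ones the fraction is inverted. Either way a
  factor q^|k| appears, which permits the limit under the sum.\<close>

definition tail :: "complex \<Rightarrow> nat \<Rightarrow> complex" where
  "tail x N = residue_coeff N 0 / (1 - x) +
     (\<Sum>j<N. residue_coeff N (int (Suc j)) * (x * q ^ Suc j / (1 - x * q ^ Suc j)) -
            residue_coeff N (- int (Suc j)) * (inverse x * q ^ Suc j / (1 - inverse x * q ^ Suc j)))"

text \<open>\<open>partial_fraction_prod\<close> with T = t and \<open>c k = q powi k\<close> for
  |k| <= N. The N factors with negative exponent are inverted to reach \<open>qpoch\<close>, each
  giving a factor t; the resulting \<open>t ^ N\<close> also divides the other side and is
  cancelled.\<close>

lemma finite_partial_fractions:
  assumes "adm x"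
  shows "(1 - t * x) / (1 - x) * (qpoch q (t * x) N * qpoch q (inverse (t * x)) N / (qpoch q x N * qpoch q (inverse x) N)) =
    t ^ Suc N + (\<Sum>j<N. residue_coeff N (int (Suc j))) + tail x N"
proof -
  let ?S = "{- int N..int N}"
  have x: "x \<noteq> 0" "1 - x \<noteq> 0" "1 - x * q ^ Suc k \<noteq> 0" "1 - inverse x * q ^ Suc k \<noteq> 0" for k
    using assms by (auto simp: adm_def)
  have "(\<Prod>k\<in>?S. (1 - t * q powi k * x) / (1 - q powi k * x)) =
         t ^ card ?S + (\<Sum>k\<in>?S. (1 - t) * (\<Prod>j\<in>?S - {k}. (1 - t * q powi j / q powi k) / (1 - q powi j / q powi k)) / (1 - q powi k * x))"
    by (rule partial_fraction_prod)
       (use adm_powi[OF assms] q power_int_inj in \<open>auto simp: inj_on_def inj_def\<close>)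
  also have "\<dots> = t ^ N * t ^ Suc N + (\<Sum>k\<in>?S. t ^ N * residue_coeff N k / (1 - q powi k * x))"
  proof -
    have "card ?S = N + Suc N" by simp
    hence "t ^ card ?S = t ^ N * t ^ Suc N" by (simp only: power_add)
    thus ?thesis using residue_eq by (intro arg_cong2[where f="(+)"] sum.cong) auto
  qed
  also have "\<dots> = t ^ N * (t ^ Suc N + (\<Sum>k\<in>?S. residue_coeff N k / (1 - q powi k * x)))"
    by (simp add: ring_distribs sum_distrib_left)
  also have "(\<Sum>k\<in>?S. residue_coeff N k / (1 - q powi k * x)) = residue_coeff N 0 / (1 - x) +
     (\<Sum>j<N. residue_coeff N (int (Suc j)) / (1 - q ^ Suc j * x) + residue_coeff N (- int (Suc j)) / (1 - inverse (q ^ Suc j) * x))"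
    unfolding sum_symmetric_interval power_int_minus power_int_of_nat by simp
  also have "(\<Sum>j<N. residue_coeff N (int (Suc j)) / (1 - q ^ Suc j * x) + residue_coeff N (- int (Suc j)) / (1 - inverse (q ^ Suc j) * x)) =
     (\<Sum>j<N. residue_coeff N (int (Suc j))) + (\<Sum>j<N. residue_coeff N (int (Suc j)) * (x * q ^ Suc j / (1 - x * q ^ Suc j)) -
            residue_coeff N (- int (Suc j)) * (inverse x * q ^ Suc j / (1 - inverse x * q ^ Suc j)))"
    unfolding sum.distrib [symmetric]
  proof (intro sum.cong refl)
    fix j
    have 1: "1 / (1 - q ^ Suc j * x) = 1 + x * q ^ Suc j / (1 - x * q ^ Suc j)"
      using x(3)[of j] by (simp add: divide_simps mult_ac)
    have 2: "1 / (1 - inverse (q ^ Suc j) * x) = - (inverse x * q ^ Suc j / (1 - inverse x * q ^ Suc j))"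
    proof -
      define Q where "Q = q ^ Suc j"
      have "Q \<noteq> 0" "x \<noteq> 0" "x - Q \<noteq> 0" using x(1) x(4)[of j] q by (auto simp: Q_def field_simps)
      thus ?thesis unfolding Q_def [symmetric] by (auto simp: divide_simps algebra_simps)
    qed
    show "residue_coeff N (int (Suc j)) / (1 - q ^ Suc j * x) + residue_coeff N (- int (Suc j)) / (1 - inverse (q ^ Suc j) * x) =
      residue_coeff N (int (Suc j)) + (residue_coeff N (int (Suc j)) * (x * q ^ Suc j / (1 - x * q ^ Suc j)) -
            residue_coeff N (- int (Suc j)) * (inverse x * q ^ Suc j / (1 - inverse x * q ^ Suc j)))"
      unfolding divide_inverse_commute[of "residue_coeff _ _"] inverse_eq_divide[of "1 - _"] 1 2 
      by (simp add: algebra_simps)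
  qed
  finally have eq: "(\<Prod>k\<in>?S. (1 - t * q powi k * x) / (1 - q powi k * x)) = t ^ N * (t ^ Suc N + (\<Sum>j<N. residue_coeff N (int (Suc j))) + tail x N)"
    by (simp add: tail_def algebra_simps)
  have factor: "(1 - t * q ^ Suc j * x) / (1 - q ^ Suc j * x) * ((1 - t * inverse (q ^ Suc j) * x) / (1 - inverse (q ^ Suc j) * x)) =
      t * ((1 - t * x * q ^ Suc j) * (1 - inverse (t * x) * q ^ Suc j) / ((1 - x * q ^ Suc j) * (1 - inverse x * q ^ Suc j)))" for j
  proof -
    define Q where "Q = q ^ Suc j"
    have "(1 - t * inverse Q * x) / (1 - inverse Q * x) = t * (1 - inverse (t * x) * Q) / (1 - inverse x * Q)"
    proof -
      have "Q \<noteq> 0" "x \<noteq> 0" "x - Q \<noteq> 0" using x(1) x(4)[of j] q by (auto simp: Q_def field_simps)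
      thus ?thesis using t0 by (auto simp: divide_simps algebra_simps)
    qed
    hence "(1 - t * Q * x) / (1 - Q * x) * ((1 - t * inverse Q * x) / (1 - inverse Q * x)) =
      t * ((1 - t * x * Q) * (1 - inverse (t * x) * Q) / ((1 - x * Q) * (1 - inverse x * Q)))"
      by (simp add: mult_ac)
    thus ?thesis unfolding Q_def .
  qed
  have "(\<Prod>k\<in>?S. (1 - t * q powi k * x) / (1 - q powi k * x)) = (1 - t * x) / (1 - x) *
      (\<Prod>j<N. t * ((1 - t * x * q ^ Suc j) * (1 - inverse (t * x) * q ^ Suc j) / ((1 - x * q ^ Suc j) * (1 - inverse x * q ^ Suc j))))"
    unfolding prod_symmetric_interval power_int_minus power_int_of_nat factor by simp
  also have "\<dots> = t ^ N * ((1 - t * x) / (1 - x) * (qpoch q (t * x) N * qpoch q (inverse (t * x)) N / (qpoch q x N * qpoch q (inverse x) N)))"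
    unfolding qpoch_def by (simp add: prod.distrib prod_dividef del: power_Suc inverse_mult_distrib)
  finally show ?thesis
    using eq t0 by (metis (no_types, lifting) mult_left_cancel power_not_zero)
qed

lemma qp_bounded: obtains B where "B > 0" "\<And>n. norm (qp x n) \<le> B"
  using BseqE[OF convergent_imp_Bseq[OF convergentI[OF qp_LIMSEQ]]] by blast

lemma residue_coeff_LIMSEQ:
  "(\<lambda>N. residue_coeff N k) \<longlonglongrightarrow> (1 - t) * t powi k * qpi t * qpi (inverse t)"
proof -
  have 1: "filterlim (\<lambda>N. nat (int N + k)) at_top sequentially" for k
    unfolding filterlim_at_top
  proof
    fix Z show "eventually (\<lambda>N. Z \<le> nat (int N + k)) sequentially"
      by (rule eventually_sequentiallyI[of "nat (int Z - k)"]) linarith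
  qed
  show ?thesis
    unfolding residue_coeff_def using 1[of "-k"]
    by (intro tendsto_mult tendsto_const filterlim_compose[OF qp_LIMSEQ] 1) auto
qed

lemma fraction_bounded:
  obtains B where "B > 0" "\<And>j. norm (x / (1 - x * q ^ Suc j)) \<le> B"
proof -
  have "(\<lambda>j. x / (1 - x * q ^ Suc j)) \<longlonglongrightarrow> x / (1 - x * 0)"
    by (intro tendsto_intros LIMSEQ_Suc LIMSEQ_power_zero q) auto
  thus ?thesis using that BseqE convergent_imp_Bseq[OF convergentI] by blast
qed

lemma norm_residue_coeff_le:
  obtains B where "B > 0" "\<And>N k. norm (residue_coeff N k) \<le> B * norm (t powi k)"
proof -
  obtain B1 where B1: "B1 > 0" "\<And>n. norm (qp t n) \<le> B1" using qp_bounded by blast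
  obtain B2 where B2: "B2 > 0" "\<And>n. norm (qp (inverse t) n) \<le> B2" using qp_bounded by blast
  show ?thesis
  proof (rule that)
    show "norm (1 - t) * B1 * B2 > 0" using B1 B2 t by simp
    fix N k
    have "norm (residue_coeff N k) \<le> norm (1 - t) * norm (t powi k) * B1 * B2"
      unfolding residue_coeff_def norm_mult using B1 B2 by (intro mult_mono) auto
    thus "norm (residue_coeff N k) \<le> norm (1 - t) * B1 * B2 * norm (t powi k)" by (simp add: mult_ac)
  qed
qed

text \<open>Dominated convergence: \<open>residue_coeff N k\<close> is bounded by a constant times
  |t^k| uniformly in N, and with the factor q^|k| the terms are dominated by geometric series of
  ratios |t q| and |q/t|, both below 1 on the annulus.\<close>

lemma tail_LIMSEQ:
  assumes "adm x"
  shows "tail x \<longlonglongrightarrow> (1 - t) * qpi t * qpi (inverse t) * (1 / (1 - x) + (suminf (\<lambda>j. lambert_term q x t (Suc j))))"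
    and "summable (\<lambda>j. norm (lambert_term q x t (Suc j)))"
proof -
  define D where "D = (1 - t) * qpi t * qpi (inverse t)"
  define g where "g = (\<lambda>x j. x / (1 - x * q ^ Suc j))"
  \<comment> \<open>Extended by 0 beyond N, so that the finite sums become series to which Tannery's
    theorem applies.\<close>
  define a where "a = (\<lambda>j N. if j < N then residue_coeff N (int (Suc j)) * (x * q ^ Suc j / (1 - x * q ^ Suc j)) -
            residue_coeff N (- int (Suc j)) * (inverse x * q ^ Suc j / (1 - inverse x * q ^ Suc j)) else 0)"
  have D0: "D \<noteq> 0"
    using qpoch_inf_adm_nonzero[OF adm_inverse_t] t qpoch_inf_1 by (simp add: D_def qpi_def)
  obtain B where B: "B > 0" "\<And>N k. norm (residue_coeff N k) \<le> B * norm (t powi k)"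
    using norm_residue_coeff_le by blast
  obtain B1 where B1: "B1 > 0" "\<And>j. norm (g x j) \<le> B1" unfolding g_def using fraction_bounded by blast
  obtain B2 where B2: "B2 > 0" "\<And>j. norm (g (inverse x) j) \<le> B2" unfolding g_def using fraction_bounded by blast
  define M where "M = (\<lambda>j. B * B1 * norm (t * q) ^ Suc j + B * B2 * norm (q / t) ^ Suc j)"
  have tan: "eventually (\<lambda>N. summable (\<lambda>j. norm (a j N))) sequentially \<and>
        summable (\<lambda>j. norm (D * lambert_term q x t (Suc j))) \<and>
        ((\<lambda>N. suminf (\<lambda>j. a j N)) \<longlonglongrightarrow> (suminf (\<lambda>j. D * lambert_term q x t (Suc j))))"
  proof (rule tannerys_theorem)
    fix j
    have "(\<lambda>N. residue_coeff N (int (Suc j)) * (x * q ^ Suc j / (1 - x * q ^ Suc j)) -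
            residue_coeff N (- int (Suc j)) * (inverse x * q ^ Suc j / (1 - inverse x * q ^ Suc j))) \<longlonglongrightarrow>
          ((1 - t) * t powi (int (Suc j)) * qpi t * qpi (inverse t)) * (x * q ^ Suc j / (1 - x * q ^ Suc j)) -
          ((1 - t) * t powi (- int (Suc j)) * qpi t * qpi (inverse t)) * (inverse x * q ^ Suc j / (1 - inverse x * q ^ Suc j))"
      by (intro tendsto_diff tendsto_mult tendsto_const residue_coeff_LIMSEQ)
    also have "((1 - t) * t powi (int (Suc j)) * qpi t * qpi (inverse t)) * (x * q ^ Suc j / (1 - x * q ^ Suc j)) -
          ((1 - t) * t powi (- int (Suc j)) * qpi t * qpi (inverse t)) * (inverse x * q ^ Suc j / (1 - inverse x * q ^ Suc j))
         = D * lambert_term q x t (Suc j)"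
      unfolding D_def lambert_term_def power_int_minus power_int_of_nat power_inverse by (simp only: ring_distribs mult_ac)
    finally show "a j \<longlonglongrightarrow> D * lambert_term q x t (Suc j)"
      by (rule Lim_transform_eventually)
         (rule eventually_mono[OF eventually_gt_at_top[of j]], simp add: a_def)
  next
    have "norm (a j N) \<le> M j" for j N
    proof -
      have "norm (residue_coeff N (int (Suc j)) * (x * q ^ Suc j / (1 - x * q ^ Suc j)) -
            residue_coeff N (- int (Suc j)) * (inverse x * q ^ Suc j / (1 - inverse x * q ^ Suc j)))
          \<le> norm (residue_coeff N (int (Suc j))) * (norm (g x j) * norm q ^ Suc j) +
            norm (residue_coeff N (- int (Suc j))) * (norm (g (inverse x) j) * norm q ^ Suc j)"
        by (rule order_trans[OF norm_triangle_ineq4]) (simp add: g_def norm_mult norm_divide norm_power)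
      also have "\<dots> \<le> B * norm (t powi int (Suc j)) * (B1 * norm q ^ Suc j) +
            B * norm (t powi (- int (Suc j))) * (B2 * norm q ^ Suc j)"
        using B(2) B1(2) B2(2) B(1) B1(1) B2(1) by (intro add_mono mult_mono) auto
      also have "\<dots> = M j"
        unfolding M_def norm_power_int power_int_minus power_int_of_nat
        by (simp add: norm_divide norm_mult norm_power power_mult_distrib power_divide field_simps)
      finally show ?thesis using B B1 B2 by (auto simp: a_def M_def)
    qed
    thus "eventually (\<lambda>(j, N). norm (a j N) \<le> M j) (at_top \<times>\<^sub>F sequentially)"
      by (intro always_eventually) auto
  next
    have "norm (q / t) < 1" using norm_tq by (simp add: field_simps)
    thus "summable M" unfolding M_def using t(2)
      by (intro summable_add summable_mult iffD2[OF summable_Suc_iff] summable_geometric) auto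
  qed auto
  show sm: "summable (\<lambda>j. norm (lambert_term q x t (Suc j)))"
    using tan D0 by (simp add: norm_mult summable_cmult_iff)
  have "(\<lambda>N. residue_coeff N 0 / (1 - x) + (suminf (\<lambda>j. a j N))) \<longlonglongrightarrow>
        ((1 - t) * t powi 0 * qpi t * qpi (inverse t)) / (1 - x) + (suminf (\<lambda>j. D * lambert_term q x t (Suc j)))"
    using tan assms by (intro tendsto_add tendsto_divide residue_coeff_LIMSEQ tendsto_const) (auto simp: adm_def)
  also have "(suminf (\<lambda>j. D * lambert_term q x t (Suc j))) = D * (suminf (\<lambda>j. lambert_term q x t (Suc j)))"
    by (intro suminf_mult summable_norm_cancel[OF sm])
  also have "(\<lambda>N. residue_coeff N 0 / (1 - x) + (suminf (\<lambda>j. a j N))) = tail x"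
  proof
    fix N
    have "(suminf (\<lambda>j. a j N)) = (\<Sum>j<N. a j N)"
      by (rule suminf_finite) (auto simp: a_def)
    also have "\<dots> = (\<Sum>j<N. residue_coeff N (int (Suc j)) * (x * q ^ Suc j / (1 - x * q ^ Suc j)) -
            residue_coeff N (- int (Suc j)) * (inverse x * q ^ Suc j / (1 - inverse x * q ^ Suc j)))"
      by (simp add: a_def)
    finally show "residue_coeff N 0 / (1 - x) + (suminf (\<lambda>j. a j N)) = tail x N" by (simp add: tail_def)
  qed
  finally show "tail x \<longlonglongrightarrow> (1 - t) * qpi t * qpi (inverse t) * (1 / (1 - x) + (suminf (\<lambda>j. lambert_term q x t (Suc j))))"
    by (simp add: D_def ring_distribs)
qed

text \<open>
  At \<open>\<zeta> = 1 / t\<close> the Lambert series becomes \<open>\<Sum>\<^sub>k\<^sub>,\<^sub>l (t\<^sup>k\<^sup>-\<^sup>l - t\<^sup>l\<^sup>-\<^sup>k) q\<^sup>k\<^sup>l\<close>, which is antisymmetric in \<open>k, l\<close>.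
\<close>

lemma lambert_antisymmetric: "(suminf (\<lambda>j. lambert_term q (inverse t) t (Suc j))) = 0"
proof -
  define F where "F = (\<lambda>(k, l). t ^ k * inverse t ^ l * q ^ (k * l))"
  have "(\<lambda>p. norm (F p)) summable_on {1..} \<times> {1..}"
  proof (rule Infinite_Sum.abs_summable_on_comparison_test)
    \<comment> \<open>For k, l >= 1 one has k l >= k + l - 1, so a product of two geometric series
      dominates; the division by \<open>q\<close> pays for the -1.\<close>
    have "((\<lambda>(k, l). (t * q) ^ k * ((inverse t * q) ^ l / q)) has_sum
            (t * q / (1 - t * q) * (inverse t * q / (1 - inverse t * q) / q))) ({1..} \<times> {1..})"
      by (intro has_sum_mult_Times has_sum_divide_const has_sum_geometric_from_1 norm_tq)
    thus "(\<lambda>p. norm (case p of (k, l) \<Rightarrow> (t * q) ^ k * ((inverse t * q) ^ l / q))) summable_on {1..} \<times> {1..}"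
      using has_sum_imp_summable summable_on_iff_abs_summable_on_complex by blast
  next
    fix p :: "nat \<times> nat" assume "p \<in> {1..} \<times> {1..}"
    then obtain k l where p: "p = (Suc k, Suc l)"
      by (cases p) (metis SigmaD1 SigmaD2 atLeast_iff not0_implies_Suc not_one_le_zero)
    have "norm (q ^ (Suc k * Suc l)) \<le> norm q ^ (k + l + 1)"
      unfolding norm_power using q by (intro power_decreasing) auto
    also have "\<dots> = norm (q ^ Suc k * q ^ Suc l / q)"
      using q by (simp add: norm_mult norm_power norm_divide power_add)
    finally have "norm (t ^ Suc k * inverse t ^ Suc l) * norm (q ^ (Suc k * Suc l)) \<le>
                  norm (t ^ Suc k * inverse t ^ Suc l) * norm (q ^ Suc k * q ^ Suc l / q)"
      by (rule mult_left_mono) auto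
    also have "\<dots> = norm ((t * q) ^ Suc k * ((inverse t * q) ^ Suc l / q))"
      by (simp add: power_mult_distrib norm_mult norm_divide mult_ac)
    finally show "norm (F p) \<le> norm (case p of (k, l) \<Rightarrow> (t * q) ^ k * ((inverse t * q) ^ l / q))"
      by (simp add: F_def p norm_mult del: power_Suc mult_Suc)
  qed
  then obtain S where S: "(F has_sum S) ({1..} \<times> {1..})"
    using abs_summable_summable summable_on_def by blast
  hence "((\<lambda>(k, l). F (l, k)) has_sum S) ({1..} \<times> {1..})" by (subst (asm) has_sum_swap)
  from has_sum_minus[OF S this]
  have "((\<lambda>p. F p - (case p of (k, l) \<Rightarrow> F (l, k))) has_sum 0) ({1..} \<times> {1..})" by simp
  hence "((\<lambda>k. lambert_term q (inverse t) t k) has_sum 0) {1..}"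
  proof (rule has_sum_SigmaD)
    fix k :: nat assume k: "k \<in> {1..}"
    have "q ^ k = q * q ^ (k - 1)" using k by (cases k) auto
    hence n: "norm (t * q ^ k) < 1" "norm (inverse t * q ^ k) < 1"
      using norm_mult_q_power[OF norm_tq(1), of "k - 1"] norm_mult_q_power[OF norm_tq(2), of "k - 1"]
      by (simp_all add: mult.assoc)
    have "((\<lambda>l. t ^ k * (inverse t * q ^ k) ^ l - inverse t ^ k * (t * q ^ k) ^ l) has_sum
       t ^ k * (inverse t * q ^ k / (1 - inverse t * q ^ k)) - inverse t ^ k * (t * q ^ k / (1 - t * q ^ k))) {1..}"
      by (intro has_sum_minus has_sum_cmult_right has_sum_geometric_from_1 n)
    thus "((\<lambda>l. F (k, l) - (case (k, l) of (k, l) \<Rightarrow> F (l, k))) has_sum lambert_term q (inverse t) t k) {1..}"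
      by (simp add: F_def lambert_term_def power_mult_distrib power_mult [symmetric] mult_ac)
  qed
  also have "{1..} = range Suc" using Suc_le_D by (auto simp: image_iff)
  finally have "((\<lambda>j. lambert_term q (inverse t) t (Suc j)) has_sum 0) UNIV"
    by (subst (asm) has_sum_reindex) (auto simp: o_def)
  thus ?thesis using has_sum_imp_sums sums_unique by fastforce
qed

text \<open>
  The terms \<open>t\<^bsup>N+1\<^esup> + \<Sum>\<^sub>j r\<^sub>j\<close> of the finite partial fractions need not converge separately, but they do not
  depend on \<open>\<zeta>\<close>. They cancel against those at \<open>\<zeta> = 1 / t\<close>, where the finite products vanish.
\<close>

theorem theta_quotient_eq_lambert:
  assumes "adm \<zeta>"
  shows "theta_quotient q \<zeta> t = 1 / (1 - \<zeta>) + t / (1 - t) + (suminf (\<lambda>j. lambert_term q \<zeta> t (Suc j)))"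
proof -
  define U where "U = (\<lambda>x N. (1 - t * x) / (1 - x) * (qpoch q (t * x) N * qpoch q (inverse (t * x)) N / (qpoch q x N * qpoch q (inverse x) N)))"
  define D where "D = (1 - t) * qpi t * qpi (inverse t)"
  have fpf: "U x N = t ^ Suc N + (\<Sum>j<N. residue_coeff N (int (Suc j))) + tail x N" if "adm x" for x N
    unfolding U_def by (rule finite_partial_fractions[OF that])
  note nz = qpoch_inf_adm_nonzero
  \<comment> \<open>The factor 1 - t x vanishes at x = 1/t. Hence the terms free of zeta equal
    \<open>- tail (inverse t) N\<close>, whose limit contributes -1/(1 - 1/t) = t/(1 - t) up to the
    factor \<open>D\<close>.\<close>
  have "U (inverse t) N = 0" for N using t0 by (simp add: U_def)
  hence eq: "U \<zeta> N = tail \<zeta> N - tail (inverse t) N" for N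
    using fpf[OF assms, of N] fpf[OF adm_inverse_t, of N] by (simp add: eq_neg_iff_add_eq_0)
  have "(\<lambda>N. tail \<zeta> N - tail (inverse t) N) \<longlonglongrightarrow>
     D * (1 / (1 - \<zeta>) + (suminf (\<lambda>j. lambert_term q \<zeta> t (Suc j)))) - D * (1 / (1 - inverse t) + 0)"
    unfolding D_def lambert_antisymmetric [symmetric]
    by (intro tendsto_diff tail_LIMSEQ adm_inverse_t assms)
  moreover have "U \<zeta> \<longlonglongrightarrow> (1 - t * \<zeta>) / (1 - \<zeta>) * (qpoch_inf q (t * \<zeta>) * qpoch_inf q (inverse (t * \<zeta>)) / (qpoch_inf q \<zeta> * qpoch_inf q (inverse \<zeta>)))"
    unfolding U_def using nz[OF assms] by (intro tendsto_mult tendsto_divide tendsto_const qpoch_LIMSEQ q) auto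
  ultimately have "(1 - t * \<zeta>) / (1 - \<zeta>) * (qpoch_inf q (t * \<zeta>) * qpoch_inf q (inverse (t * \<zeta>)) / (qpoch_inf q \<zeta> * qpoch_inf q (inverse \<zeta>)))
    = D * (1 / (1 - \<zeta>) + (suminf (\<lambda>j. lambert_term q \<zeta> t (Suc j))) - 1 / (1 - inverse t))"
    unfolding eq [symmetric] using LIMSEQ_unique by (force simp: right_diff_distrib)
  moreover have e: "t / (1 - t) = - (1 / (1 - inverse t))" using t t0 by (simp add: divide_simps) algebra
  have "1 / (1 - \<zeta>) + suminf (\<lambda>j. lambert_term q \<zeta> t (Suc j)) - 1 / (1 - inverse t) =
     1 / (1 - \<zeta>) + t / (1 - t) + suminf (\<lambda>j. lambert_term q \<zeta> t (Suc j))" by (simp add: e)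
  ultimately have "(1 - t * \<zeta>) / (1 - \<zeta>) * (qpoch_inf q (t * \<zeta>) * qpoch_inf q (inverse (t * \<zeta>)) / (qpoch_inf q \<zeta> * qpoch_inf q (inverse \<zeta>)))
    = D * (1 / (1 - \<zeta>) + t / (1 - t) + (suminf (\<lambda>j. lambert_term q \<zeta> t (Suc j))))"
    by (simp only:)
  moreover have "D \<noteq> 0" using nz[OF adm_inverse_t] t qpoch_inf_1 by (simp add: D_def qpi_def)
  \<comment> \<open>Division by \<open>D\<close> brings in the denominators that depend on t and the
    square of \<open>qpoch_inf q 1\<close>.\<close>
  ultimately have "1 / (1 - \<zeta>) + t / (1 - t) + (suminf (\<lambda>j. lambert_term q \<zeta> t (Suc j))) =
     (1 - t * \<zeta>) / (1 - \<zeta>) * (qpoch_inf q (t * \<zeta>) * qpoch_inf q (inverse (t * \<zeta>)) / (qpoch_inf q \<zeta> * qpoch_inf q (inverse \<zeta>))) / D"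
    by (metis nonzero_mult_div_cancel_left)
  also have "\<dots> = theta_quotient q \<zeta> t"
    unfolding theta_quotient_def D_def qpi_def using t qpoch_inf_1 nz[OF assms] nz[OF adm_inverse_t] assms
    by (simp add: divide_simps adm_def mult_ac power2_eq_square)
  finally show ?thesis by simp
qed

end

section \<open>Expansion of a single factor in fractional powers of \<open>q\<close>\<close>

unbundle no vec_syntax
unbundle fps_syntax

text \<open>The power series of X^a / (1 - c X^b), given by its coefficients so that growth and
  support can be read off; \<open>geo_fls\<close> identifies it with the quotient in Laurent
  series.\<close>

definition geo :: "complex \<Rightarrow> nat \<Rightarrow> nat \<Rightarrow> complex fps" where
  "geo c a b = Abs_fps (\<lambda>K. if a \<le> K \<and> b dvd (K - a) then c ^ ((K - a) div b) else 0)"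

lemma geo_nth: "geo c a b $ K = (if a \<le> K \<and> b dvd (K - a) then c ^ ((K - a) div b) else 0)"
  by (simp add: geo_def)

lemma geo_mult:
  assumes "b > 0"
  shows "geo c a b * (1 - fps_const c * fps_X ^ b) = fps_X ^ a"
proof (rule fps_ext)
  fix K
  have "(geo c a b * (1 - fps_const c * fps_X ^ b)) $ K = geo c a b $ K - c * (if K < b then 0 else geo c a b $ (K - b))"
    by (simp add: ring_distribs mult.assoc [symmetric] mult.commute[of "geo c a b"] fps_X_power_mult_right_nth)
  also have "\<dots> = (if K = a then 1 else 0)"
  proof (cases "a \<le> K")
    case True
    then obtain e where e: "K = a + e" using le_Suc_ex by blast
    show ?thesis
    proof (cases "b \<le> e")
      case True
      then obtain e' where e': "e = b + e'" using le_Suc_ex by blast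
      show ?thesis using assms by (auto simp: geo_nth e e')
    next
      case False
      hence "\<not> b dvd e \<or> e = 0" using nat_dvd_not_less by auto
      thus ?thesis using False assms by (auto simp: geo_nth e)
    qed
  qed (auto simp: geo_nth)
  finally show "(geo c a b * (1 - fps_const c * fps_X ^ b)) $ K = fps_X ^ a $ K"
    by (simp add: fps_X_power_nth)
qed

lemma one_minus_fls_nonzero:
  assumes "b \<noteq> 0"
  shows "1 - fls_const c * fls_X_intpow b \<noteq> (0 :: complex fls)"
proof
  assume "1 - fls_const c * fls_X_intpow b = 0"
  hence "fls_nth (1 - fls_const c * fls_X_intpow b) 0 = 0" by simp
  thus False using assms by (simp add: fls_times_conv_fps_times fls_X_intpow_times_conv_shift)
qed

lemma geo_fls:
  assumes "b > 0"
  shows "fps_to_fls (geo c a b) = fls_X_intpow (int a) / (1 - fls_const c * fls_X_intpow (int b))"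
proof -
  have "fps_to_fls (geo c a b * (1 - fps_const c * fps_X ^ b)) = fps_to_fls (fps_X ^ a)"
    by (simp only: geo_mult[OF assms])
  hence "fps_to_fls (geo c a b) * (1 - fls_const c * fls_X_intpow (int b)) = fls_X_intpow (int a)"
    by (simp add: fls_times_fps_to_fls fps_to_fls_power fls_X_power_conv_shift_1 del: fls_const_mult_const)
  thus ?thesis using one_minus_fls_nonzero[of "int b" c] assms by (simp add: nonzero_eq_divide_eq)
qed

lemma norm_geo_le:
  assumes "norm c \<le> C" "1 \<le> C"
  shows "norm (geo c a b $ K) \<le> C ^ K"
proof (cases "a \<le> K \<and> b dvd (K - a)")
  case True
  have "norm (c ^ ((K - a) div b)) \<le> C ^ ((K - a) div b)"
    using assms by (simp add: norm_power power_mono)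
  also have "\<dots> \<le> C ^ K"
    using assms by (intro power_increasing) (auto intro: order_trans[OF div_le_dividend])
  finally show ?thesis using True by (simp add: geo_nth)
qed (use assms in \<open>auto simp: geo_nth\<close>)

lemma geo_has_sum:
  assumes "b > 0" "norm (c * Q ^ b) < 1"
  shows "((\<lambda>K. geo c a b $ K * Q ^ K) has_sum Q ^ a / (1 - c * Q ^ b)) UNIV"
proof -
  have "((\<lambda>k. (c * Q ^ b) ^ k) has_sum 1 / (1 - c * Q ^ b)) UNIV"
  proof (rule norm_summable_imp_has_sum)
    show "summable (\<lambda>n. norm ((c * Q ^ b) ^ n))"
      unfolding norm_power using assms(2) by (intro summable_geometric) simp
  qed (rule geometric_sums[OF assms(2)])
  hence "((\<lambda>k. Q ^ a * (c * Q ^ b) ^ k) has_sum Q ^ a * (1 / (1 - c * Q ^ b))) UNIV"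
    by (rule has_sum_cmult_right)
  also have "(\<lambda>k. Q ^ a * (c * Q ^ b) ^ k) = (\<lambda>K. geo c a b $ K * Q ^ K) \<circ> (\<lambda>k. a + b * k)"
    using assms(1) by (auto simp: geo_nth power_add power_mult power_mult_distrib fun_eq_iff)
  finally have "((\<lambda>K. geo c a b $ K * Q ^ K) has_sum Q ^ a * (1 / (1 - c * Q ^ b))) (range (\<lambda>k. a + b * k))"
    by (rule iffD2[OF has_sum_reindex, rotated]) (use assms(1) in \<open>simp add: inj_on_def\<close>)
  also have "?this \<longleftrightarrow> ((\<lambda>K. geo c a b $ K * Q ^ K) has_sum Q ^ a * (1 / (1 - c * Q ^ b))) UNIV"
    by (rule has_sum_cong_neutral) (auto simp: geo_nth image_iff dvd_def le_iff_add)
  finally show ?thesis by simp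
qed

text \<open>Here Q is the variable of the series, q = Q^M, and the argument is t Q^p with p < M. For
  m > 0 this is zeta q^m Q^(p m) / (1 - zeta q^m); for m < 0 it is the inverted form, where the
  exponent |m| (M - p) is positive because p < M. These are the two halves of
  \<open>lambert_term\<close>.\<close>

definition lambert_fps :: "nat \<Rightarrow> nat \<Rightarrow> complex \<Rightarrow> int \<Rightarrow> complex fps" where
  "lambert_fps M p \<zeta> m =
     (if m > 0 then fps_const \<zeta> * geo \<zeta> (nat m * (M + p)) (nat m * M)
      else if m < 0 then - (fps_const (inverse \<zeta>) * geo (inverse \<zeta>) (nat (- m) * (M - p)) (nat (- m) * M))
      else fps_const (1 / (1 - \<zeta>)))"

text \<open>The complete mode Q^(p m) / (1 - zeta Q^(M m)): for m > 0 the term removed from the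
  Lambert part is put back, and 1 is subtracted when |t| > 1, which \<open>b\<close> records. For p
  > 0 the modulus of t Q^p is below 1 for small Q whatever t is, so \<open>b\<close> matters only
  for p = 0.\<close>

definition mode_fps :: "nat \<Rightarrow> nat \<Rightarrow> complex \<Rightarrow> bool \<Rightarrow> int \<Rightarrow> complex fps" where
  "mode_fps M p \<zeta> b m = lambert_fps M p \<zeta> m + (if m > 0 then fps_X ^ (nat m * p) else 0) - (if p = 0 \<and> b then 1 else 0)"

abbreviation base_fps :: "nat \<Rightarrow> complex \<Rightarrow> complex fps" where
  "base_fps p t \<equiv> if p = 0 then fps_const (t / (1 - t)) else fps_const t * geo t p p"

text \<open>For p < M the Lambert part of mode m starts in degree at least |m|, so a finite sum
  suffices in each degree. The distinction \<open>b\<close> does not occur: the same coefficients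
  serve on both sides of |t| = 1 and are singular only at t = 0 and, for p = 0, at t = 1.\<close>

definition factor_fps :: "nat \<Rightarrow> nat \<Rightarrow> complex \<Rightarrow> complex \<Rightarrow> complex fps" where
  "factor_fps M p \<zeta> t = Abs_fps (\<lambda>K. \<Sum>m\<in>{-int K..int K}. t powi m * lambert_fps M p \<zeta> m $ K) +
     base_fps p t"

lemma lambert_fps_nth_eq_0:
  assumes "p < M" "int K < \<bar>m\<bar>"
  shows "lambert_fps M p \<zeta> m $ K = 0"
proof -
  have "nat m * 1 \<le> nat m * (M + p)" "nat (- m) * 1 \<le> nat (- m) * (M - p)"
    using assms(1) by (intro mult_le_mono2; simp)+
  hence "\<not> nat m * (M + p) \<le> K \<or> m \<le> 0" "\<not> nat (- m) * (M - p) \<le> K \<or> m \<ge> 0"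
    using assms(2) by linarith+
  thus ?thesis using assms(2) by (auto simp: lambert_fps_def geo_nth)
qed

text \<open>Infinitely many modes occur in a given degree only for p = 0, and then on the side where
  t^m decays: m < 0 if |t| > 1, and m > 0 if |t| < 1. This one-sidedness later bounds the
  characters.\<close>

lemma mode_fps_nth_nonzero:
  assumes "p < M" "mode_fps M p \<zeta> b m $ K \<noteq> 0"
  shows "\<bar>m\<bar> \<le> int K \<or> (p = 0 \<and> (if b then m < 0 else m > 0))"
proof (rule ccontr)
  assume neg: "\<not> ?thesis"
  hence "lambert_fps M p \<zeta> m $ K = 0" by (intro lambert_fps_nth_eq_0 assms) auto
  moreover have "K < nat m * p" if "m > 0" "p \<noteq> 0"
  proof -
    have "nat m \<le> nat m * p" using that by simp
    thus ?thesis using neg that by linarith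
  qed
  ultimately show False using assms(2) neg
    by (auto simp: mode_fps_def fps_X_power_nth split: if_splits)
qed

text \<open>The algebra for modes m > 0, and in \<open>shift_negative\<close> for m < 0:
  \<open>P\<close> is Q^(p m), \<open>Y\<close> is q^m and \<open>A\<close> is the denominator of
  the mode.\<close>

lemma shift_positive:
  fixes A P Y c :: "'a::field"
  assumes "A = 1 - c * Y" "A \<noteq> 0"
  shows "c * (P * Y / A) + P = P * (1 / A)"
proof -
  have "c * (P * Y / A) * A = c * (P * Y)" using assms(2) by simp
  hence "(c * (P * Y / A) + P) * A = P" unfolding distrib_right by (simp add: assms(1) right_diff_distrib mult_ac)
  thus ?thesis using assms(2) by (simp add: nonzero_eq_divide_eq)
qed

lemma shift_negative:
  fixes A P Y Y' c c' :: "'a::field"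
  assumes "A = 1 - c * Y" "A \<noteq> 0" "c * c' = 1" "Y * Y' = 1"
  shows "- (c' * (Y' * P / (1 - c' * Y'))) = P * (1 / A)"
proof -
  have ne: "c' * Y' \<noteq> 0" using assms by auto
  have "(c' * Y') * (c * Y) = (c * c') * (Y * Y')" by (simp only: mult_ac)
  hence "1 - c' * Y' = - ((c' * Y') * A)"
    unfolding assms(1) by (simp add: right_diff_distrib assms)
  hence "- (c' * (Y' * P / (1 - c' * Y'))) = - ((c' * Y') * P / (- ((c' * Y') * A)))"
    by (simp only: times_divide_eq_right mult.assoc)
  also have "\<dots> = P / A" using ne by simp
  finally show ?thesis by simp
qed

text \<open>In the field of Laurent series 1/(1 - zeta q^m) makes sense for either sign of m, so the
  three cases of \<open>lambert_fps\<close> collapse to the factor that occurs in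
  \<open>rhs_coeff\<close>, with q replaced by Q^M.\<close>

lemma mode_fps_fls:
  assumes "p < M" "\<zeta> \<noteq> 0" "\<zeta> \<noteq> 1"
  shows "fps_to_fls (mode_fps M p \<zeta> b m) = fls_X_intpow (int p * m) *
     (1 / (1 - fls_const \<zeta> * fls_X_intpow (int M * m)) - (if p = 0 \<and> b then 1 else 0))"
proof -
  define X where "X = (\<lambda>i. fls_X_intpow i :: complex fls)"
  define c where "c = fls_const \<zeta>"
  define c' where "c' = fls_const (inverse \<zeta>)"
  define A where "A = 1 - c * X (int M * m)"
  have X_add: "X (i + j) = X i * X j" for i j
    by (simp add: X_def fls_X_intpow_times_fls_X_intpow)
  have geo_X: "fps_to_fls (geo z i j) = X (int i) / (1 - fls_const z * X (int j))" if "j > 0" for z i j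
    unfolding X_def by (rule geo_fls[OF that])
  have "fps_to_fls (lambert_fps M p \<zeta> m) + (if m > 0 then X (int p * m) else 0) = X (int p * m) * (1 / A)"
  proof (cases m "0 :: int" rule: linorder_cases)
    case greater
    then obtain n where n: "m = int n" "n > 0" by (metis zero_less_imp_eq_int)
    have A0: "A \<noteq> 0" unfolding A_def X_def c_def by (rule one_minus_fls_nonzero) (use assms greater in auto)
    have e: "int (n * (M + p)) = int p * m + int M * m" "int (n * M) = int M * m"
      using n by (simp_all add: algebra_simps)
    have "fps_to_fls (lambert_fps M p \<zeta> m) = c * (X (int (n * (M + p))) / (1 - c * X (int (n * M))))"
      using n assms by (simp add: lambert_fps_def fls_times_fps_to_fls geo_X c_def del: of_nat_mult of_nat_add)
    also have "\<dots> = c * (X (int p * m) * X (int M * m) / A)" unfolding e X_add A_def ..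
    finally show ?thesis using shift_positive[OF A_def A0] greater by simp
  next
    case less
    then obtain n where n: "m = - int n" "n > 0" by (metis zero_less_imp_eq_int neg_0_less_iff_less minus_minus)
    have YY: "X (int M * m) * X (- (int M * m)) = 1"
      unfolding X_add [symmetric] by (simp add: X_def)
    have A0: "A \<noteq> 0" unfolding A_def X_def c_def by (rule one_minus_fls_nonzero) (use assms less in auto)
    have cc: "c * c' = 1" using assms by (simp add: c_def c'_def)
    have e: "int (n * (M - p)) = - (int M * m) + int p * m" "int (n * M) = - (int M * m)"
      using assms n by (simp_all add: of_nat_diff algebra_simps)
    have "fps_to_fls (lambert_fps M p \<zeta> m) = - (c' * (X (int (n * (M - p))) / (1 - c' * X (int (n * M)))))"
      using n assms by (simp add: lambert_fps_def fls_times_fps_to_fls geo_X c'_def del: of_nat_mult of_nat_add)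
    also have "\<dots> = X (int p * m) * (1 / A)"
      unfolding e X_add using shift_negative[OF A_def A0 cc YY] by simp
    finally show ?thesis using less by simp
  next
    case equal
    have "fps_to_fls (lambert_fps M p \<zeta> m) = fls_const 1 / fls_const (1 - \<zeta>)"
      unfolding fls_const_divide_const using equal by (simp add: lambert_fps_def)
    also have "fls_const (1 - \<zeta>) = A" by (simp add: equal A_def c_def X_def flip: fls_minus_const)
    finally show ?thesis using equal by (simp add: X_def)
  qed
  moreover have "fps_to_fls (fps_X ^ (nat m * p)) = X (int p * m)" if "m > 0"
    using that by (simp add: X_def fps_to_fls_power fls_X_power_conv_shift_1 mult.commute)
  moreover have "X 0 = 1" by (simp add: X_def)
  ultimately have "fps_to_fls (mode_fps M p \<zeta> b m) = X (int p * m) * (1 / A - (if p = 0 \<and> b then 1 else 0))"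
    unfolding mode_fps_def fps_to_fls_minus fps_to_fls_plus by (auto simp: right_diff_distrib)
  thus ?thesis by (simp only: X_def A_def c_def)
qed

text \<open>In a fixed degree the Lambert part has finitely many modes. The rest must give t Q^p /
  (1 - t Q^p). For p > 0 degree K receives only the m with m p = K; for p = 0 everything is in
  degree 0, where t/(1 - t) is the sum of t^m over m > 0 if |t| < 1 and of -t^m over m <= 0 if |t| >
  1.\<close>

lemma mode_fps_has_sum:
  assumes "p < M" "t \<noteq> 0" "p = 0 \<Longrightarrow> norm t \<noteq> 1 \<and> (b \<longleftrightarrow> norm t > 1)"
  shows "((\<lambda>m. (fps_const (t powi m) * mode_fps M p \<zeta> b m) $ K) has_sum factor_fps M p \<zeta> t $ K) UNIV"
proof -
  let ?\<delta> = "\<lambda>m. (if m > 0 then fps_X ^ (nat m * p) else 0) - (if p = 0 \<and> b then 1 else 0) :: complex fps"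
  have "((\<lambda>m. t powi m * lambert_fps M p \<zeta> m $ K) has_sum (\<Sum>m\<in>{-int K..int K}. t powi m * lambert_fps M p \<zeta> m $ K)) UNIV"
    by (rule has_sum_finite_neutralI[of "{-int K..int K}"])
       (use assms in \<open>auto intro!: lambert_fps_nth_eq_0\<close>)
  moreover have "((\<lambda>m. t powi m * ?\<delta> m $ K)
      has_sum base_fps p t $ K) UNIV"
  proof (cases "p = 0")
    case False
    show ?thesis
    proof (rule has_sum_finite_neutralI[of "{m. m > 0 \<and> m * int p = int K}"])
      have "{m. m > 0 \<and> m * int p = int K} \<subseteq> {int K div int p}"
      proof
        fix m assume "m \<in> {m. m > 0 \<and> m * int p = int K}"
        hence "int K = m * int p" by simp
        thus "m \<in> {int K div int p}" using False by simp
      qed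
      thus fin: "finite {m. m > 0 \<and> m * int p = int K}" by (rule finite_subset) auto
      show "base_fps p t $ K =
        (\<Sum>m\<in>{m. m > 0 \<and> m * int p = int K}. t powi m * ?\<delta> m $ K)"
      proof (cases "p \<le> K \<and> p dvd K - p")
        case True
        then obtain e where e: "K = p + p * e" by (metis dvd_def le_add_diff_inverse)
        have "int K = int (Suc e) * int p" by (simp add: e algebra_simps)
        hence "{m. m > 0 \<and> m * int p = int K} = {int (Suc e)}" using False by auto
        hence "(\<Sum>m\<in>{m. m > 0 \<and> m * int p = int K}. t powi m * ?\<delta> m $ K)
          = t powi int (Suc e) * (fps_X ^ (nat (int (Suc e)) * p) - (if p = 0 \<and> b then 1 else 0)) $ K" by simp
        also have "\<dots> = t ^ Suc e"
          unfolding power_int_of_nat nat_int using False by (simp add: e fps_X_power_nth)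
        finally show ?thesis using False e by (simp add: geo_nth)
      next
        case no: False
        have "{m. m > 0 \<and> m * int p = int K} = {}"
        proof (rule equals0I)
          fix m assume "m \<in> {m. m > 0 \<and> m * int p = int K}"
          hence m: "m > 0" "m * int p = int K" by auto
          define n where "n = nat (m - 1)"
          have "m = int (Suc n)" using m by (simp add: n_def)
          hence "int (Suc n) * int p = int K" using m(2) by (simp only:)
          hence "int (Suc n * p) = int K" by (simp only: of_nat_mult)
          hence "K = p + p * n" by (simp del: of_nat_mult of_nat_add add: mult.commute)
          thus False using no by auto
        qed
        thus ?thesis using False no by (simp only: sum.empty) (auto simp: geo_nth)
      qed
    qed (use False in \<open>auto simp: fps_X_power_nth\<close>)
  next
    case True
    hence t: "norm t \<noteq> 1" "b \<longleftrightarrow> norm t > 1" using assms by auto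
    have hs: "((\<lambda>m. if b then (if m \<le> 0 then - (t powi m) else 0) else (if m > 0 then t powi m else 0)) has_sum t / (1 - t)) UNIV"
    proof (cases b)
      case b: True
      have ran: "range (\<lambda>n. - int n) = {..0}"
      proof safe
        fix m :: int assume "m \<le> 0"
        hence "m = - int (nat (- m))" by simp
        thus "m \<in> range (\<lambda>n. - int n)" by (rule range_eqI)
      qed auto
      hence it: "norm (inverse t) < 1" using t b by (simp add: norm_inverse inverse_less_1_iff)
      have "((\<lambda>n. (inverse t) ^ n) has_sum 1 / (1 - inverse t)) UNIV"
        using it by (intro norm_summable_imp_has_sum geometric_sums) (auto simp: norm_power intro!: summable_geometric)
      hence "((\<lambda>n. - ((inverse t) ^ n)) has_sum - (1 / (1 - inverse t))) UNIV" by (rule has_sum_uminusI)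
      also have "- (1 / (1 - inverse t)) = t / (1 - t)"
      proof -
        have "t \<noteq> 1" using t by auto
        thus ?thesis using assms(2) by (simp add: divide_simps) algebra
      qed
      also have "(\<lambda>n. - ((inverse t) ^ n)) = (\<lambda>m. if m \<le> 0 then - (t powi m) else 0) \<circ> (\<lambda>n. - int n)"
        by (auto simp: fun_eq_iff power_int_minus power_inverse)
      finally have "((\<lambda>m. if m \<le> 0 then - (t powi m) else 0) has_sum t / (1 - t)) (range (\<lambda>n. - int n))"
        by (rule iffD2[OF has_sum_reindex, rotated]) (simp add: inj_on_def)
      also have "?this \<longleftrightarrow> ((\<lambda>m. if m \<le> 0 then - (t powi m) else 0) has_sum t / (1 - t)) UNIV"
        unfolding ran by (rule has_sum_cong_neutral) auto
      finally show ?thesis using b by simp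
    next
      case b: False
      have ran: "int ` {1..} = {0<..}"
      proof safe
        fix m :: int assume "m > 0"
        hence "m = int (nat m)" "nat m \<in> {1..}" by auto
        thus "m \<in> int ` {1..}" by (rule image_eqI)
      qed auto
      hence it: "norm t < 1" using t b by linarith
      have "((\<lambda>n. t ^ n) has_sum t / (1 - t)) {1..}" by (rule has_sum_geometric_from_1[OF it])
      also have "(\<lambda>n. t ^ n) = (\<lambda>m. t powi m) \<circ> int" by (auto simp: fun_eq_iff)
      finally have "((\<lambda>m. t powi m) has_sum t / (1 - t)) (int ` {1..})"
        by (rule iffD2[OF has_sum_reindex, rotated]) (simp add: inj_on_def)
      also have "?this \<longleftrightarrow> ((\<lambda>m. if m > 0 then t powi m else 0) has_sum t / (1 - t)) UNIV"
        unfolding ran by (rule has_sum_cong_neutral) auto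
      finally show ?thesis using b by simp
    qed
    show ?thesis
    proof (cases "K = 0")
      case True
      have "(\<lambda>m. t powi m * ?\<delta> m $ K) =
            (\<lambda>m. if b then (if m \<le> 0 then - (t powi m) else 0) else (if m > 0 then t powi m else 0))"
        using \<open>p = 0\<close> True by (auto simp: fun_eq_iff)
      thus ?thesis using hs \<open>p = 0\<close> True by simp
    next
      case False
      hence "(\<lambda>m. t powi m * ?\<delta> m $ K) = (\<lambda>_. 0)"
        using \<open>p = 0\<close> by (auto simp: fun_eq_iff)
      thus ?thesis using \<open>p = 0\<close> False by simp
    qed
  qed
  ultimately have "((\<lambda>m. t powi m * lambert_fps M p \<zeta> m $ K + t powi m * ?\<delta> m $ K)
     has_sum (\<Sum>m\<in>{-int K..int K}. t powi m * lambert_fps M p \<zeta> m $ K) + base_fps p t $ K) UNIV"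
    by (rule has_sum_add)
  also have "(\<Sum>m\<in>{-int K..int K}. t powi m * lambert_fps M p \<zeta> m $ K) + base_fps p t $ K
     = factor_fps M p \<zeta> t $ K" by (simp add: factor_fps_def)
  also have "(\<lambda>m. t powi m * lambert_fps M p \<zeta> m $ K + t powi m * ?\<delta> m $ K)
     = (\<lambda>m. (fps_const (t powi m) * mode_fps M p \<zeta> b m) $ K)"
    by (simp add: mode_fps_def fun_eq_iff ring_distribs)
  finally show ?thesis .
qed

text \<open>For the passage to nongeneric points: crossing |t| = 1 is harmless, only t = 1 has to be
  avoided, and that only for p = 0.\<close>

lemma tendsto_factor_fps:
  assumes "(f \<longlongrightarrow> t) F" "t \<noteq> 0" "p = 0 \<Longrightarrow> t \<noteq> 1"
  shows "((\<lambda>x. factor_fps M p \<zeta> (f x) $ K) \<longlongrightarrow> factor_fps M p \<zeta> t $ K) F"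
  unfolding factor_fps_def using assms
  by (auto simp: geo_nth intro!: tendsto_intros)

section \<open>Products of factor series over the vertices of a simplex\<close>

lemma has_sum_finite_sum:
  fixes f :: "'a \<Rightarrow> 'b \<Rightarrow> 'c::{topological_comm_monoid_add, t2_space}"
  assumes "\<And>i. i \<in> I \<Longrightarrow> (f i has_sum s i) A"
  shows "((\<lambda>x. \<Sum>i\<in>I. f i x) has_sum (\<Sum>i\<in>I. s i)) A"
  using assms by (induction I rule: infinite_finite_induct) (auto intro!: has_sum_add)

text \<open>A coefficient of a product of two series is a finite convolution, so the induction needs
  only products of two absolutely convergent complex sums. A tuple on \<open>insert x I\<close> is
  split into its value at \<open>x\<close> and its restriction to \<open>I\<close>.\<close>

lemma has_sum_fps_prod:
  fixes f :: "'i \<Rightarrow> 'm \<Rightarrow> complex fps" and a :: "'i \<Rightarrow> complex fps"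
  assumes "finite I" "\<And>i K. i \<in> I \<Longrightarrow> ((\<lambda>m. f i m $ K) has_sum a i $ K) UNIV"
  shows "((\<lambda>m. (\<Prod>i\<in>I. f i (m i)) $ K) has_sum (\<Prod>i\<in>I. a i) $ K) (PiE I (\<lambda>_. UNIV))"
  using assms
proof (induction I arbitrary: K rule: finite_induct)
  case empty
  show ?case by (rule has_sum_finiteI) auto
next
  case (insert x I)
  let ?T = "PiE I (\<lambda>_. UNIV :: 'm set)"
  have "((\<lambda>(y, g). \<Sum>k=0..K. f x y $ k * (\<Prod>i\<in>I. f i (g i)) $ (K - k)) has_sum
         (\<Sum>k=0..K. a x $ k * (\<Prod>i\<in>I. a i) $ (K - k))) (UNIV \<times> ?T)"
    unfolding case_prod_unfold
    using has_sum_mult_Times[OF insert.prems insert.IH[OF insert.prems], of x]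
    by (intro has_sum_finite_sum) (auto simp: case_prod_unfold)
  also have "(\<lambda>(y, g). \<Sum>k=0..K. f x y $ k * (\<Prod>i\<in>I. f i (g i)) $ (K - k)) =
             (\<lambda>(y, g). (f x y * (\<Prod>i\<in>I. f i (g i))) $ K)"
    by (simp add: fps_mult_nth)
  also have "(\<Sum>k=0..K. a x $ k * (\<Prod>i\<in>I. a i) $ (K - k)) = (\<Prod>i\<in>insert x I. a i) $ K"
    using insert.hyps by (simp add: fps_mult_nth)
  finally have "((\<lambda>(y, g). (f x y * (\<Prod>i\<in>I. f i (g i))) $ K) has_sum (\<Prod>i\<in>insert x I. a i) $ K) (UNIV \<times> ?T)" .
  also have "?this \<longleftrightarrow> (((\<lambda>m. (\<Prod>i\<in>insert x I. f i (m i)) $ K) \<circ> (\<lambda>(y, g). g(x := y))) has_sum (\<Prod>i\<in>insert x I. a i) $ K) (UNIV \<times> ?T)"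
  proof (rule has_sum_cong)
    fix p :: "'m \<times> ('i \<Rightarrow> 'm)"
    obtain y g where p: "p = (y, g)" by (cases p)
    have "(\<Prod>i\<in>I. f i ((g(x := y)) i)) = (\<Prod>i\<in>I. f i (g i))"
      using insert.hyps by (intro prod.cong) auto
    thus "(case p of (y, g) \<Rightarrow> (f x y * (\<Prod>i\<in>I. f i (g i))) $ K) =
          ((\<lambda>m. (\<Prod>i\<in>insert x I. f i (m i)) $ K) \<circ> (\<lambda>(y, g). g(x := y))) p"
      using insert.hyps by (simp add: p)
  qed
  also have "\<dots> \<longleftrightarrow> ((\<lambda>m. (\<Prod>i\<in>insert x I. f i (m i)) $ K) has_sum (\<Prod>i\<in>insert x I. a i) $ K) ((\<lambda>(y, g). g(x := y)) ` (UNIV \<times> ?T))"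
    by (rule has_sum_reindex [symmetric]) (rule inj_combinator[OF insert.hyps(2)])
  also have "(\<lambda>(y, g). g(x := y)) ` (UNIV \<times> ?T) = PiE (insert x I) (\<lambda>_. UNIV)"
    by (simp add: PiE_insert_eq)
  finally show ?case .
qed

lemma tendsto_fps_prod:
  assumes "finite I" "\<And>i K. i \<in> I \<Longrightarrow> ((\<lambda>x. f i x $ K) \<longlongrightarrow> a i $ K) F"
  shows "((\<lambda>x. (\<Prod>i\<in>I. f i x) $ K) \<longlongrightarrow> (\<Prod>i\<in>I. a i :: complex fps) $ K) F"
  using assms
  by (induction I arbitrary: K rule: finite_induct) (auto simp: fps_mult_nth intro!: tendsto_intros)

text \<open>The formal counterpart of \<open>lambert_term\<close> at index j + 1, where the two
  opposite modes converge together.\<close>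

definition lambert_pair :: "nat \<Rightarrow> nat \<Rightarrow> complex \<Rightarrow> complex \<Rightarrow> nat \<Rightarrow> complex fps" where
  "lambert_pair M p \<zeta> t j = fps_const (t ^ Suc j) * lambert_fps M p \<zeta> (int (Suc j)) +
     fps_const (inverse t ^ Suc j) * lambert_fps M p \<zeta> (- int (Suc j))"

lemma factor_fps_nth:
  "factor_fps M p \<zeta> t $ K = (\<Sum>j<K. lambert_pair M p \<zeta> t j $ K) + (fps_const (1 / (1 - \<zeta>)) +
     base_fps p t) $ K"
proof -
  have "(\<Sum>m\<in>{-int K..int K}. t powi m * lambert_fps M p \<zeta> m $ K) =
        fps_const (1 / (1 - \<zeta>)) $ K + (\<Sum>j<K. lambert_pair M p \<zeta> t j $ K)"
    unfolding sum_symmetric_interval lambert_pair_def power_int_minus power_int_of_nat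
    by (simp add: power_inverse lambert_fps_def)
  thus ?thesis by (simp add: factor_fps_def)
qed

lemma lambert_pair_nth_eq_0:
  assumes "p < M" "K \<le> j"
  shows "lambert_pair M p \<zeta> t j $ K = 0"
  using assms by (simp add: lambert_pair_def lambert_fps_nth_eq_0 del: of_nat_Suc)

text \<open>Degree K only sees j < K, so the power of t is at most C^K; another C^K comes from the
  powers of zeta in \<open>geo\<close>.\<close>

lemma norm_lambert_pair_le:
  assumes C: "1 \<le> C" "norm \<zeta> \<le> C" "norm (inverse \<zeta>) \<le> C" "norm t \<le> C" "norm (inverse t) \<le> C" "p < M"
  shows "norm (lambert_pair M p \<zeta> t j $ K) \<le> 2 * C * (C\<^sup>2) ^ K"
proof (cases "j < K")
  case True
  have C': "x ^ Suc j \<le> C ^ K" if "0 \<le> x" "x \<le> C" for x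
  proof -
    have "x ^ Suc j \<le> C ^ Suc j" using that by (intro power_mono) auto
    also have "\<dots> \<le> C ^ K" using True C by (intro power_increasing) auto
    finally show ?thesis .
  qed
  have L: "norm (lambert_fps M p \<zeta> m $ K) \<le> C * C ^ K" if "m \<noteq> 0" for m
    using that C
    by (auto simp: lambert_fps_def norm_mult intro!: mult_mono norm_geo_le)
  have "norm (lambert_pair M p \<zeta> t j $ K) \<le>
      norm t ^ Suc j * norm (lambert_fps M p \<zeta> (int (Suc j)) $ K) + norm (inverse t) ^ Suc j * norm (lambert_fps M p \<zeta> (- int (Suc j)) $ K)"
    unfolding lambert_pair_def fps_add_nth fps_mult_left_const_nth
    by (rule order_trans[OF norm_triangle_ineq]) (simp add: norm_mult norm_power)
  also have "\<dots> \<le> C ^ K * (C * C ^ K) + C ^ K * (C * C ^ K)"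
    using C by (intro add_mono mult_mono L C') auto
  also have "\<dots> = 2 * C * (C\<^sup>2) ^ K" by (simp add: power2_eq_square power_mult_distrib)
  finally show ?thesis .
next
  case False
  thus ?thesis using lambert_pair_nth_eq_0[of p M K j] assms by auto
qed

lemma lambert_pair_has_sum:
  assumes "p < M" "t \<noteq> 0" "\<zeta> \<noteq> 0" "Q \<noteq> 0" "norm (\<zeta> * Q) < 1" "norm (inverse \<zeta> * Q) < 1" "norm Q < 1"
  shows "((\<lambda>K. lambert_pair M p \<zeta> t j $ K * Q ^ K) has_sum lambert_term (Q ^ M) \<zeta> (t * Q ^ p) (Suc j)) UNIV"
proof -
  have small: "norm (x * Q ^ (Suc j * M)) < 1" if "norm (x * Q) < 1" for x
  proof -
    have "norm Q ^ (Suc j * M) \<le> norm Q ^ 1"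
      using assms by (intro power_decreasing) auto
    hence "norm x * norm Q ^ (Suc j * M) \<le> norm x * norm Q"
      by (intro mult_left_mono) auto
    thus ?thesis using that by (simp add: norm_mult norm_power)
  qed
  have 1: "lambert_fps M p \<zeta> (int (Suc j)) = fps_const \<zeta> * geo \<zeta> (Suc j * (M + p)) (Suc j * M)"
          "lambert_fps M p \<zeta> (- int (Suc j)) = - (fps_const (inverse \<zeta>) * geo (inverse \<zeta>) (Suc j * (M - p)) (Suc j * M))"
    unfolding lambert_fps_def minus_minus nat_int by auto
  have "((\<lambda>K. t ^ Suc j * \<zeta> * (geo \<zeta> (Suc j * (M + p)) (Suc j * M) $ K * Q ^ K) -
              inverse t ^ Suc j * inverse \<zeta> * (geo (inverse \<zeta>) (Suc j * (M - p)) (Suc j * M) $ K * Q ^ K)) has_sum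
     t ^ Suc j * \<zeta> * (Q ^ (Suc j * (M + p)) / (1 - \<zeta> * Q ^ (Suc j * M))) -
     inverse t ^ Suc j * inverse \<zeta> * (Q ^ (Suc j * (M - p)) / (1 - inverse \<zeta> * Q ^ (Suc j * M)))) UNIV"
    using assms by (intro has_sum_minus has_sum_cmult_right geo_has_sum small) auto
  also have "(\<lambda>K. t ^ Suc j * \<zeta> * (geo \<zeta> (Suc j * (M + p)) (Suc j * M) $ K * Q ^ K) -
              inverse t ^ Suc j * inverse \<zeta> * (geo (inverse \<zeta>) (Suc j * (M - p)) (Suc j * M) $ K * Q ^ K))
      = (\<lambda>K. lambert_pair M p \<zeta> t j $ K * Q ^ K)"
    unfolding lambert_pair_def 1 by (simp add: fun_eq_iff algebra_simps del: power_Suc mult_Suc)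
  also have "t ^ Suc j * \<zeta> * (Q ^ (Suc j * (M + p)) / (1 - \<zeta> * Q ^ (Suc j * M))) -
     inverse t ^ Suc j * inverse \<zeta> * (Q ^ (Suc j * (M - p)) / (1 - inverse \<zeta> * Q ^ (Suc j * M)))
     = lambert_term (Q ^ M) \<zeta> (t * Q ^ p) (Suc j)"
  proof -
    have e1: "Q ^ (Suc j * (M + p)) = (Q ^ M) ^ Suc j * (Q ^ p) ^ Suc j"
      unfolding power_mult [symmetric] power_add [symmetric] by (rule arg_cong[where f = "\<lambda>k. Q ^ k"]) (simp add: algebra_simps)
    have "Q ^ (Suc j * (M - p)) * (Q ^ p) ^ Suc j = (Q ^ M) ^ Suc j"
    proof -
      have "Suc j * (M - p) + p * Suc j = Suc j * (M - p + p)" by (simp only: distrib_left mult.commute[of p])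
      also have "\<dots> = M * Suc j" using assms(1) by (simp add: mult.commute)
      finally show ?thesis unfolding power_mult [symmetric] power_add [symmetric] by (rule arg_cong)
    qed
    hence e2: "Q ^ (Suc j * (M - p)) = (Q ^ M) ^ Suc j * inverse (Q ^ p) ^ Suc j"
      using assms(4) by (simp add: field_simps)
    have e3: "Q ^ (Suc j * M) = (Q ^ M) ^ Suc j" by (simp only: power_mult [symmetric] mult.commute)
    show ?thesis unfolding lambert_term_def e1 e2 e3 power_mult_distrib inverse_mult_distrib
      by (simp only: times_divide_eq_right times_divide_eq_left mult_ac)
  qed
  finally show ?thesis .
qed

text \<open>Exchange of the sums over modes and degrees. Degree K has K pairs of size at most 2 C
  r^K with r = |Q| C^2. As K < 2^K, a geometric series of ratio 2 r dominates; the constant 4 in the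
  bound on |Q| keeps this ratio below 1.\<close>

lemma lambert_pair_double_sum:
  assumes C: "1 \<le> C" "norm \<zeta> \<le> C" "norm (inverse \<zeta>) \<le> C" "norm t \<le> C" "norm (inverse t) \<le> C"
    and p: "p < M" and Q: "Q \<noteq> 0" "norm Q * (4 * C\<^sup>2) < 1" and nz: "t \<noteq> 0" "\<zeta> \<noteq> 0"
    and smm: "summable (\<lambda>j. norm (lambert_term (Q ^ M) \<zeta> (t * Q ^ p) (Suc j)))"
  shows "(\<lambda>K. (\<Sum>j<K. lambert_pair M p \<zeta> t j $ K) * Q ^ K) sums (suminf (\<lambda>j. lambert_term (Q ^ M) \<zeta> (t * Q ^ p) (Suc j)))"
proof -
  define f where "f = (\<lambda>(K, j). lambert_pair M p \<zeta> t j $ K * Q ^ K)"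
  have CC: "C \<le> 4 * C\<^sup>2"
    using mult_left_mono[OF C(1), of C] C(1) unfolding power2_eq_square by linarith
  have small: "norm (x * Q) < 1" if "norm x \<le> C" for x
  proof -
    have "norm x * norm Q \<le> 4 * C\<^sup>2 * norm Q"
      using that CC by (intro mult_right_mono) auto
    thus ?thesis unfolding norm_mult using Q(2) by (metis le_less_trans mult.commute)
  qed
  have Q1: "norm Q < 1" using small[of 1] C by simp
  define r where "r = norm Q * C\<^sup>2"
  have r: "0 \<le> r" "2 * r < 1" using Q C by (auto simp: r_def)
  have bound: "norm (f (K, j)) \<le> (if j < K then 2 * C * r ^ K else 0)" for K j
  proof (cases "j < K")
    case True
    have "norm (f (K, j)) \<le> 2 * C * (C\<^sup>2) ^ K * norm Q ^ K"
      unfolding f_def prod.case norm_mult norm_power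
      by (intro mult_right_mono norm_lambert_pair_le C p) auto
    thus ?thesis using True by (simp add: r_def power_mult_distrib mult_ac)
  qed (use p lambert_pair_nth_eq_0 in \<open>auto simp: f_def\<close>)
  have "(\<lambda>(K, j). if j < K then 2 * C * r ^ K else 0) summable_on (UNIV \<times> UNIV)"
  proof (rule summable_on_SigmaI)
    fix K :: nat
    show "((\<lambda>j. case (K, j) of (K, j) \<Rightarrow> if j < K then 2 * C * r ^ K else 0) has_sum real K * (2 * C * r ^ K)) UNIV"
      by (rule has_sum_finite_neutralI[of "{..<K}"]) auto
  next
    have "summable (\<lambda>K. norm (real K * (2 * C * r ^ K)))"
    proof (rule summable_comparison_test)
      show "summable (\<lambda>K. 2 * C * (2 * r) ^ K)"
        using r by (intro summable_mult summable_geometric) auto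
      have "real K * (2 * C * r ^ K) \<le> 2 ^ K * (2 * C * r ^ K)" for K
        using C r of_nat_less_two_power[of K, where 'a=real] by (intro mult_right_mono) auto
      thus "\<exists>N. \<forall>K\<ge>N. norm (norm (real K * (2 * C * r ^ K))) \<le> 2 * C * (2 * r) ^ K"
        using C r by (auto simp: abs_mult power_mult_distrib mult_ac)
    qed
    thus "(\<lambda>K. real K * (2 * C * r ^ K)) summable_on UNIV"
      by (rule norm_summable_imp_summable_on)
  qed (use C r in auto)
  hence "(\<lambda>x. norm (f x)) summable_on (UNIV \<times> UNIV)"
  proof (rule Infinite_Sum.abs_summable_on_comparison_test')
    fix x show "norm (f x) \<le> (case x of (K, j) \<Rightarrow> if j < K then 2 * C * r ^ K else 0)"
      using bound[of "fst x" "snd x"] by (cases x) (simp only: prod.case fst_conv snd_conv)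
  qed
  then obtain S where S: "(f has_sum S) (UNIV \<times> UNIV)"
    using abs_summable_summable summable_on_def by blast
  have "((\<lambda>K. (\<Sum>j<K. lambert_pair M p \<zeta> t j $ K) * Q ^ K) has_sum S) UNIV"
  proof (rule has_sum_SigmaD[OF S])
    fix K show "((\<lambda>j. f (K, j)) has_sum (\<Sum>j<K. lambert_pair M p \<zeta> t j $ K) * Q ^ K) UNIV"
      by (rule has_sum_finite_neutralI[of "{..<K}"]) (use bound[of K] p in \<open>auto simp: f_def sum_distrib_right lambert_pair_nth_eq_0\<close>)
  qed
  moreover have "((\<lambda>j. lambert_term (Q ^ M) \<zeta> (t * Q ^ p) (Suc j)) has_sum S) UNIV"
  proof (rule has_sum_SigmaD)
    show "((\<lambda>(j, K). f (K, j)) has_sum S) (UNIV \<times> UNIV)" using S by (subst (asm) has_sum_swap)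
    show "((\<lambda>K. case (j, K) of (j, K) \<Rightarrow> f (K, j)) has_sum lambert_term (Q ^ M) \<zeta> (t * Q ^ p) (Suc j)) UNIV" for j
      unfolding f_def prod.case by (intro lambert_pair_has_sum p nz Q small C Q1)
  qed
  ultimately show ?thesis by (metis has_sum_imp_sums sums_unique)
qed

lemma lambert_base_sums:
  assumes "p > 0" "norm (t * Q ^ p) < 1"
  shows "(\<lambda>K. (fps_const t * geo t p p) $ K * Q ^ K) sums (t * Q ^ p / (1 - t * Q ^ p))"
  using has_sum_cmult_right[OF geo_has_sum[OF assms, of p], of t]
  by (intro has_sum_imp_sums) (simp add: mult_ac)

text \<open>The bound on |Q| and p < M put t Q^p into the annulus for q = Q^M, so Kronecker's
  formula applies, and its Lambert series may be rearranged by degree in Q.\<close>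

lemma factor_fps_sums:
  assumes C: "1 \<le> C" "norm \<zeta> \<le> C" "norm (inverse \<zeta>) \<le> C" "norm t \<le> C" "norm (inverse t) \<le> C"
    and p: "p < M" and Q: "Q \<noteq> 0" "norm Q * (4 * C\<^sup>2) < 1" and nz: "t \<noteq> 0" "\<zeta> \<noteq> 0" "\<zeta> \<noteq> 1" "p = 0 \<Longrightarrow> t \<noteq> 1"
  shows "(\<lambda>K. factor_fps M p \<zeta> t $ K * Q ^ K) sums theta_quotient (Q ^ M) \<zeta> (t * Q ^ p)"
proof -
  have CC: "C \<le> 4 * C\<^sup>2"
    using mult_left_mono[OF C(1), of C] C(1) unfolding power2_eq_square by linarith
  have small: "norm (x * Q) < 1" if "norm x \<le> C" for x
  proof -
    have "norm x * norm Q \<le> 4 * C\<^sup>2 * norm Q"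
      using that CC by (intro mult_right_mono) auto
    thus ?thesis unfolding norm_mult using Q(2) by (metis le_less_trans mult.commute)
  qed
  have Q1: "norm Q < 1" using small[of 1] C by simp
  have small': "norm (x * Q ^ k) < 1" if "norm x \<le> C" "k > 0" for x k
  proof -
    have "norm Q ^ k \<le> norm Q ^ 1" using Q1 that by (intro power_decreasing) auto
    hence "norm x * norm Q ^ k \<le> norm x * norm Q" by (intro mult_left_mono) auto
    thus ?thesis using small[OF that(1)] by (simp add: norm_mult norm_power)
  qed
  have M: "M > 0" using p by simp
  interpret kronecker "Q ^ M" "t * Q ^ p"
  proof
    show "Q ^ M \<noteq> 0" using Q by simp
    show "norm (Q ^ M) < 1" using small'[of 1 M] C M by simp
    have "norm (inverse t * Q ^ (M - p)) < 1" using p by (intro small' C) auto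
    moreover have "Q ^ M = Q ^ (M - p) * Q ^ p" using p by (simp flip: power_add)
    ultimately show "norm (Q ^ M) < norm (t * Q ^ p)" using nz Q
      by (simp add: norm_mult norm_divide divide_simps)
    show "norm (t * Q ^ p * Q ^ M) < 1"
      using small'[of t "p + M"] C M by (simp add: power_add mult_ac)
    show "t * Q ^ p \<noteq> 1"
      using small'[of t p] C nz by (cases "p = 0") auto
  qed
  have adm: "adm \<zeta>"
  proof -
    have "\<zeta> * (Q ^ M) ^ Suc k \<noteq> 1" "inverse \<zeta> * (Q ^ M) ^ Suc k \<noteq> 1" for k
      using small'[OF C(2), of "M * Suc k"] small'[OF C(3), of "M * Suc k"] M unfolding power_mult [symmetric]
      by (auto simp del: power_Suc mult_Suc_right)
    thus ?thesis using nz by (simp add: adm_def)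
  qed
  have "(\<lambda>K. (\<Sum>j<K. lambert_pair M p \<zeta> t j $ K) * Q ^ K) sums (suminf (\<lambda>j. lambert_term (Q ^ M) \<zeta> (t * Q ^ p) (Suc j)))"
    by (intro lambert_pair_double_sum[OF C p Q nz(1,2)] tail_LIMSEQ adm)
  moreover have const: "(\<lambda>K. fps_const c $ K * Q ^ K) sums c" for c :: complex
    using sums_single[of 0 "\<lambda>_. c"] by (rule sums_cong[THEN iffD1, rotated]) auto
  moreover have "(\<lambda>K. base_fps p t $ K * Q ^ K) sums (t * Q ^ p / (1 - t * Q ^ p))"
    using const[of "t / (1 - t)"] lambert_base_sums[of p t Q] small'[OF C(4), of p] by (cases "p = 0") auto
  ultimately have "(\<lambda>K. (\<Sum>j<K. lambert_pair M p \<zeta> t j $ K) * Q ^ K + (fps_const (1 / (1 - \<zeta>)) $ K * Q ^ K + base_fps p t $ K * Q ^ K)) sums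
     (suminf (\<lambda>j. lambert_term (Q ^ M) \<zeta> (t * Q ^ p) (Suc j)) + (1 / (1 - \<zeta>) + t * Q ^ p / (1 - t * Q ^ p)))"
    by (intro sums_add const)
  thus ?thesis unfolding factor_fps_nth theta_quotient_eq_lambert[OF adm]
    by (simp add: ring_distribs add_ac)
qed

text \<open>The filter Im tau -> infinity; statements that hold eventually are uniform in the real
  part of tau.\<close>

abbreviation "cusp \<equiv> filtercomap Im (at_top :: real filter)"

lemma norm_e2pi_small:
  assumes "\<epsilon> > 0" "M > 0"
  shows "eventually (\<lambda>\<tau>. Im \<tau> > 0 \<and> norm (e2pi (\<tau> / of_nat M)) < \<epsilon>) cusp"
proof -
  have "eventually (\<lambda>y::real. y > 0 \<and> y > - (ln \<epsilon> * M / (2 * pi))) at_top"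
    by (intro eventually_conj eventually_gt_at_top)
  hence "eventually (\<lambda>\<tau>. Im \<tau> > 0 \<and> Im \<tau> > - (ln \<epsilon> * M / (2 * pi))) cusp"
    by (rule eventually_filtercomapI)
  thus ?thesis
  proof eventually_elim
    case (elim \<tau>)
    have "norm (e2pi (\<tau> / of_nat M)) = exp (- (2 * pi * Im \<tau> / M))" by (simp add: norm_e2pi)
    also have "- (2 * pi * Im \<tau> / M) < ln \<epsilon>" using elim assms by (simp add: field_simps)
    hence "exp (- (2 * pi * Im \<tau> / M)) < exp (ln \<epsilon>)" by simp
    finally show ?case using elim assms by simp
  qed
qed

lemma phi_st_expansion:
  assumes "p < M" "e2pi s \<noteq> 1" "p = 0 \<Longrightarrow> e2pi z \<noteq> 1"
  defines "a \<equiv> factor_fps M p (e2pi s) (e2pi z)"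
  shows "fps_conv_radius a > 0"
    and "eventually (\<lambda>\<tau>. phi_st (z + of_nat p * \<tau> / of_nat M) \<tau> s = eval_fps a (e2pi (\<tau> / of_nat M))) cusp"
proof -
  define t \<zeta> where "t = e2pi z" and "\<zeta> = e2pi s"
  \<comment> \<open>The bound on zeta, t and their inverses that \<open>factor_fps_sums\<close> asks
    for; it determines the radius \<open>\<epsilon>\<close> below.\<close>
  define C where "C = Max {1, norm \<zeta>, norm (inverse \<zeta>), norm t, norm (inverse t)}"
  have C: "1 \<le> C" "norm \<zeta> \<le> C" "norm (inverse \<zeta>) \<le> C" "norm t \<le> C" "norm (inverse t) \<le> C"
    unfolding C_def by (intro Max_ge; simp)+
  have sums: "(\<lambda>K. a $ K * Q ^ K) sums theta_quotient (Q ^ M) \<zeta> (t * Q ^ p)" if "Q \<noteq> 0" "norm Q * (4 * C\<^sup>2) < 1" for Q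
    unfolding a_def t_def [symmetric] \<zeta>_def [symmetric]
    using assms(2,3) by (intro factor_fps_sums[OF C assms(1) that]) (auto simp: t_def \<zeta>_def)
  define \<epsilon> where "\<epsilon> = 1 / (4 * C\<^sup>2)"
  have \<epsilon>: "\<epsilon> > 0" using C(1) by (simp add: \<epsilon>_def)
  have lt: "norm Q * (4 * C\<^sup>2) < 1" if "norm Q < \<epsilon>" for Q :: complex
    using that C(1) by (simp add: \<epsilon>_def field_simps)
  have "summable (\<lambda>K. a $ K * of_real (\<epsilon> / 2) ^ K)"
    using sums[of "of_real (\<epsilon> / 2)"] lt[of "of_real (\<epsilon> / 2)"] \<epsilon> by (auto simp: sums_iff)
  hence "norm (of_real (\<epsilon> / 2) :: complex) \<le> fps_conv_radius a"
    unfolding fps_conv_radius_def by (rule conv_radius_geI)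
  moreover have "0 < ereal (norm (of_real (\<epsilon> / 2) :: complex))" using \<epsilon> by simp
  ultimately show "fps_conv_radius a > 0" by (rule less_le_trans[rotated])
  have "M > 0" using assms(1) by simp
  have "eventually (\<lambda>\<tau>. Im \<tau> > 0 \<and> norm (e2pi (\<tau> / of_nat M)) < \<epsilon>) cusp"
    by (rule norm_e2pi_small[OF \<epsilon> \<open>M > 0\<close>])
  thus "eventually (\<lambda>\<tau>. phi_st (z + of_nat p * \<tau> / of_nat M) \<tau> s = eval_fps a (e2pi (\<tau> / of_nat M))) cusp"
  proof eventually_elim
    case (elim \<tau>)
    define Q where "Q = e2pi (\<tau> / of_nat M)"
    have QM: "Q ^ M = e2pi \<tau>" using \<open>M > 0\<close> by (simp add: Q_def flip: e2pi_of_nat)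
    have Qp: "t * Q ^ p = e2pi (z + of_nat p * \<tau> / of_nat M)" by (simp add: Q_def t_def e2pi_add flip: e2pi_of_nat)
    have "norm (e2pi \<tau>) < 1" using elim by (simp add: norm_e2pi)
    hence "phi_st (z + of_nat p * \<tau> / of_nat M) \<tau> s = theta_quotient (Q ^ M) \<zeta> (t * Q ^ p)"
      by (simp add: phi_st_eq_theta_quotient QM Qp \<zeta>_def)
    also have "\<dots> = eval_fps a Q"
      using sums[of Q] lt[of Q] elim unfolding eval_fps_def by (simp add: sums_iff Q_def)
    finally show ?case unfolding Q_def .
  qed
qed

section \<open>Cones, edge vectors and lattices\<close>

lemma convex_cone_hull_image_finite:
  fixes f :: "'a \<Rightarrow> 'v::real_vector"
  assumes "finite A"
  shows "convex_cone hull (f ` A) = {\<Sum>a\<in>A. c a *\<^sub>R f a | c. \<forall>a\<in>A. 0 \<le> c a}" (is "_ = ?K")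
proof (rule hull_unique)
  show "f ` A \<subseteq> ?K"
  proof safe
    fix a assume a: "a \<in> A"
    hence "f a = (\<Sum>b\<in>A. (if b = a then 1 else 0) *\<^sub>R f b)"
      using assms by (simp add: if_distrib[of "\<lambda>x. x *\<^sub>R _"] cong: if_cong)
    thus "\<exists>c. f a = (\<Sum>b\<in>A. c b *\<^sub>R f b) \<and> (\<forall>b\<in>A. 0 \<le> c b)"
      by (intro exI[of _ "\<lambda>b. if b = a then 1 else 0"]) auto
  qed
  show "convex_cone ?K"
    unfolding convex_cone_iff
  proof (intro conjI ballI allI impI)
    show "0 \<in> ?K" by (rule CollectI, rule exI[of _ "\<lambda>_. 0"]) auto
  next
    fix x y assume "x \<in> ?K" "y \<in> ?K"
    then obtain c d where "x = (\<Sum>a\<in>A. c a *\<^sub>R f a)" "y = (\<Sum>a\<in>A. d a *\<^sub>R f a)" "\<forall>a\<in>A. 0 \<le> c a" "\<forall>a\<in>A. 0 \<le> d a" by auto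
    thus "x + y \<in> ?K"
      by (intro CollectI exI[of _ "\<lambda>a. c a + d a"]) (auto simp: scaleR_add_left sum.distrib)
  next
    fix x and r :: real assume "x \<in> ?K" "0 \<le> r"
    then obtain c where "x = (\<Sum>a\<in>A. c a *\<^sub>R f a)" "\<forall>a\<in>A. 0 \<le> c a" by auto
    thus "r *\<^sub>R x \<in> ?K" using \<open>0 \<le> r\<close>
      by (intro CollectI exI[of _ "\<lambda>a. r * c a"]) (auto simp: scaleR_sum_right)
  qed
next
  fix T assume T: "f ` A \<subseteq> T" "convex_cone T"
  have "(\<Sum>a\<in>B. c a *\<^sub>R f a) \<in> T" if "finite B" "B \<subseteq> A" "\<forall>a\<in>B. 0 \<le> c a" for B c
    using that
    by (induction B rule: finite_induct)
       (use T in \<open>auto intro!: convex_cone_add convex_cone_scaleR convex_cone_contains_0\<close>)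
  thus "?K \<subseteq> T" using assms by auto
qed

lemmas convex_cone_hull_finite = convex_cone_hull_image_finite[where f = "\<lambda>x. x", simplified]

text \<open>Taken of least cardinality, so that in a pointed cone every remaining generator spans an
  extreme ray, see \<open>ray_face_of\<close>.\<close>

lemma minimal_cone_generators:
  fixes A :: "'v::real_vector set"
  assumes "finite A"
  obtains A' where "finite A'" "A' \<subseteq> A" "convex_cone hull A' = convex_cone hull A"
    "\<And>a. a \<in> A' \<Longrightarrow> a \<notin> convex_cone hull (A' - {a})"
proof -
  define P where "P = (\<lambda>A'. A' \<subseteq> A \<and> convex_cone hull A' = convex_cone hull A)"
  have "P A" by (simp add: P_def)
  then obtain A' where A': "P A'" "\<And>B. P B \<Longrightarrow> card A' \<le> card B"
    using ex_has_least_nat[of P A card] by blast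
  have fin: "finite A'" using A' assms by (auto simp: P_def intro: finite_subset)
  show ?thesis
  proof (rule that)
    fix a assume a: "a \<in> A'"
    show "a \<notin> convex_cone hull (A' - {a})"
    proof
      assume "a \<in> convex_cone hull (A' - {a})"
      hence "convex_cone hull (insert a (A' - {a})) = convex_cone hull (A' - {a})" by (rule hull_redundant)
      hence "P (A' - {a})" using A'(1) a by (auto simp: P_def insert_absorb)
      from A'(2)[OF this] show False using a fin by (metis card_Diff1_less leD)
    qed
  qed (use A' fin in \<open>auto simp: P_def\<close>)
qed

text \<open>If c a lies strictly between two points of the cone, let \<open>e\<close> be the
  averaged coefficients. Minimality of the generators forces \<open>e a\<close> >= c, so the other
  terms sum to a nonpositive multiple of a. Pointedness makes this sum and then each of its terms
  vanish, so both end points lie on the ray.\<close>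

lemma ray_face_of:
  fixes A :: "'v::real_vector set"
  assumes A: "finite A" "\<And>b. b \<in> A \<Longrightarrow> b \<notin> convex_cone hull (A - {b})"
    and pointed: "convex_cone hull A \<inter> uminus ` (convex_cone hull A) = {0}" and a: "a \<in> A"
  shows "{c *\<^sub>R a | c. 0 \<le> c} face_of convex_cone hull A"
  unfolding face_of_def
proof (intro conjI ballI impI)
  let ?R = "{c *\<^sub>R a | c. 0 \<le> c}" and ?C = "convex_cone hull A"
  have comb: "(\<Sum>b\<in>B. e b *\<^sub>R b) \<in> ?C" if "B \<subseteq> A" "\<forall>b\<in>B. 0 \<le> e b" for B e
  proof -
    have "finite B" using that A by (auto intro: finite_subset)
    hence "(\<Sum>b\<in>B. e b *\<^sub>R b) \<in> convex_cone hull B" using that by (auto simp: convex_cone_hull_finite)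
    thus ?thesis using hull_mono[OF that(1)] by blast
  qed
  have aC: "c *\<^sub>R a \<in> ?C" if "0 \<le> c" for c using comb[of "{a}" "\<lambda>_. c"] a that by simp
  show "?R \<subseteq> ?C" using aC by auto
  show "convex ?R"
  proof -
    have "convex_cone ?R"
      unfolding convex_cone_iff
    proof (intro conjI ballI allI impI)
      fix x y assume "x \<in> ?R" "y \<in> ?R"
      then obtain c d where "x = c *\<^sub>R a" "y = d *\<^sub>R a" "0 \<le> c" "0 \<le> d" by auto
      thus "x + y \<in> ?R" by (intro CollectI exI[of _ "c + d"]) (simp add: scaleR_add_left)
    next
      fix x and r :: real assume "x \<in> ?R" "0 \<le> r"
      then obtain c where "x = c *\<^sub>R a" "0 \<le> c" by auto
      thus "r *\<^sub>R x \<in> ?R" using \<open>0 \<le> r\<close> by (intro CollectI exI[of _ "r * c"]) simp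
    qed (rule CollectI, rule exI[of _ 0], simp)
    thus ?thesis by (simp add: convex_cone_def)
  qed
  fix x y z assume xyz: "x \<in> ?C" "y \<in> ?C" "z \<in> ?R" "z \<in> open_segment x y"
  obtain p where p: "x = (\<Sum>b\<in>A. p b *\<^sub>R b)" "\<forall>b\<in>A. 0 \<le> p b" using xyz(1) by (auto simp: convex_cone_hull_finite[OF A(1)])
  obtain r where r: "y = (\<Sum>b\<in>A. r b *\<^sub>R b)" "\<forall>b\<in>A. 0 \<le> r b" using xyz(2) by (auto simp: convex_cone_hull_finite[OF A(1)])
  obtain c where c: "z = c *\<^sub>R a" "0 \<le> c" using xyz(3) by auto
  obtain s where s: "0 < s" "s < 1" "z = (1 - s) *\<^sub>R x + s *\<^sub>R y" using xyz(4) by (auto simp: in_segment)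
  define e where "e = (\<lambda>b. (1 - s) * p b + s * r b)"
  have e0: "0 \<le> e b" if "b \<in> A" for b using p r s that by (simp add: e_def)
  have "c *\<^sub>R a = (\<Sum>b\<in>A. e b *\<^sub>R b)"
    using s(3) c(1) unfolding p(1) r(1) e_def by (simp add: scaleR_sum_right scaleR_add_left sum.distrib)
  also have "\<dots> = e a *\<^sub>R a + (\<Sum>b\<in>A - {a}. e b *\<^sub>R b)" using a A(1) by (simp add: sum.remove)
  finally have eq: "(c - e a) *\<^sub>R a = (\<Sum>b\<in>A - {a}. e b *\<^sub>R b)" by (simp add: scaleR_diff_left)
  have ge: "c \<le> e a"
  proof (rule ccontr)
    assume "\<not> c \<le> e a"
    hence pos: "c - e a > 0" by simp
    have "a = (1 / (c - e a)) *\<^sub>R ((c - e a) *\<^sub>R a)" using pos by simp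
    also have "\<dots> = (\<Sum>b\<in>A - {a}. (e b / (c - e a)) *\<^sub>R b)" unfolding eq by (simp add: scaleR_sum_right)
    also have "\<dots> \<in> convex_cone hull (A - {a})"
      using A(1) pos e0 by (subst convex_cone_hull_finite) (auto intro!: exI[of _ "\<lambda>b. e b / (c - e a)"])
    finally show False using A(2)[OF a] by simp
  qed
  have zero: "x = 0" if "x \<in> ?C" "- x \<in> ?C" for x
  proof -
    have "x \<in> uminus ` ?C" using that(2) by (metis image_eqI minus_minus)
    thus ?thesis using that(1) pointed by blast
  qed
  have "(\<Sum>b\<in>A - {a}. e b *\<^sub>R b) = 0"
  proof (rule zero)
    show "(\<Sum>b\<in>A - {a}. e b *\<^sub>R b) \<in> ?C" using e0 by (intro comb) auto
    have "- (\<Sum>b\<in>A - {a}. e b *\<^sub>R b) = (e a - c) *\<^sub>R a" unfolding eq [symmetric] by (simp add: scaleR_diff_left)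
    thus "- (\<Sum>b\<in>A - {a}. e b *\<^sub>R b) \<in> ?C" using aC[of "e a - c"] ge by simp
  qed
  \<comment> \<open>A term and its negative, which is the sum of the remaining terms, both lie in
    the pointed cone.\<close>
  have eb: "e b = 0" if b: "b \<in> A - {a}" for b
  proof (rule ccontr)
    assume nz: "e b \<noteq> 0"
    have "(\<Sum>b\<in>A - {a}. e b *\<^sub>R b) = e b *\<^sub>R b + (\<Sum>d\<in>A - {a} - {b}. e d *\<^sub>R d)"
      using A(1) b by (intro sum.remove) auto
    hence "- (e b *\<^sub>R b) = (\<Sum>d\<in>A - {a} - {b}. e d *\<^sub>R d)"
      using \<open>(\<Sum>b\<in>A - {a}. e b *\<^sub>R b) = 0\<close> by (simp add: neg_eq_iff_add_eq_0)
    moreover have "(\<Sum>d\<in>A - {a} - {b}. e d *\<^sub>R d) \<in> ?C" using e0 by (intro comb) auto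
    moreover have "e b *\<^sub>R b \<in> ?C" using comb[of "{b}" e] b e0 by auto
    ultimately have "e b *\<^sub>R b = 0" by (intro zero) auto
    hence "b = 0" using nz by simp
    thus False using A(2)[of b] b by (simp add: convex_cone_hull_contains_0)
  qed
  have pr: "p b = 0" "r b = 0" if "b \<in> A - {a}" for b
  proof -
    have "(1 - s) * p b \<ge> 0" "s * r b \<ge> 0" "(1 - s) * p b + s * r b = 0" using that p r s eb[OF that] by (auto simp: e_def)
    hence "(1 - s) * p b = 0" "s * r b = 0" by linarith+
    thus "p b = 0" "r b = 0" using s by auto
  qed
  have "x = p a *\<^sub>R a" "y = r a *\<^sub>R a"
    unfolding p(1) r(1) using pr a A(1) by (simp_all add: sum.remove[of A a])
  thus "x \<in> ?R" "y \<in> ?R" using p r a by auto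
qed

section \<open>Edge vectors as cone generators and their dual bases\<close>

lemma linear_coordinate:
  fixes B :: "'v::real_vector set"
  assumes "independent B" "span B = UNIV"
  shows "linear (\<lambda>x. representation B x b)"
  by (rule linearI) (simp_all add: assms representation_add representation_scale)

locale edge_fan =
  fixes L :: "'v::real_vector set" and n :: nat and \<Delta> :: "('i, 'v) multi_fan" and V :: "'i \<Rightarrow> 'v"
  assumes lattice: "lattice_of_rank L n" and fan: "simplicial_multi_fan L n \<Delta>" and edges: "edge_vectors L \<Delta> V"
begin

abbreviation "\<S> \<equiv> simplices \<Delta>"
abbreviation "\<T> \<equiv> k_simplices \<Delta> n"
abbreviation "u \<equiv> dual_basis V"
abbreviation "\<H> \<equiv> H_group L \<Delta> V"
abbreviation "regular \<equiv> regular_points L n \<Delta> V"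

lemma fan_conjuncts:
  shows "finite_simplicial_complex \<S>" "\<forall>J\<in>\<S>. card J \<le> n" "\<T> \<noteq> {}" "cone_of \<Delta> {} = {0}"
proof -
  note f = fan[unfolded simplicial_multi_fan_def]
  show "finite_simplicial_complex \<S>" by (rule conjunct1[OF f])
  note f = f[THEN conjunct2]
  show "\<forall>J\<in>\<S>. card J \<le> n" by (rule conjunct1[OF f])
  note f = f[THEN conjunct2]
  show "\<T> \<noteq> {}" by (rule conjunct1[OF f])
  note f = f[THEN conjunct2, THEN conjunct2, THEN conjunct2]
  show "cone_of \<Delta> {} = {0}" by (rule conjunct1[OF f])
qed

lemma finite_simplices: "finite \<S>"
  and finite_simplex: "J \<in> \<S> \<Longrightarrow> finite J"
  and subset_simplex: "I \<in> \<S> \<Longrightarrow> J \<subseteq> I \<Longrightarrow> J \<in> \<S>"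
  and card_simplex: "J \<in> \<S> \<Longrightarrow> card J \<le> n"
  using fan_conjuncts unfolding finite_simplicial_complex_def by auto

lemma topD: "I \<in> \<T> \<Longrightarrow> I \<in> \<S>" "I \<in> \<T> \<Longrightarrow> card I = n" "I \<in> \<T> \<Longrightarrow> finite I"
  using finite_simplex by (auto simp: k_simplices_def)

lemma finite_top: "finite \<T>"
  using finite_simplices by (auto simp: k_simplices_def)

text \<open>A multi-fan only comes with rational cones, their dimensions and isomorphisms of face
  posets. A minimal generator spans a face of dimension 1, which must be the cone of a single vertex
  and so contains \<open>V i\<close>; hence the generators are positive multiples of edge vectors.
  Independence follows from the dimension.\<close>

lemma cone_of_props:
  assumes "I \<in> \<S>"
  shows "cone_of \<Delta> I = {\<Sum>i\<in>I. c i *\<^sub>R V i | c. \<forall>i\<in>I. 0 \<le> c i}" (is "_ = ?K")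
    and "inj_on V I" "independent (V ` I)"
proof -
  have sc: "strongly_convex_rational_cone L (cone_of \<Delta> J)" "dim (cone_of \<Delta> J) = card J" if "J \<in> \<S>" for J
    using fan that unfolding simplicial_multi_fan_def by auto
  have faces: "bij_betw (cone_of \<Delta>) (Pow I) {F. F face_of cone_of \<Delta> I \<and> F \<noteq> {}} \<and>
       (\<forall>J1 J2. J1 \<subseteq> I \<and> J2 \<subseteq> I \<longrightarrow> (J1 \<subseteq> J2 \<longleftrightarrow> cone_of \<Delta> J1 \<subseteq> cone_of \<Delta> J2))"
    using fan[unfolded simplicial_multi_fan_def, THEN conjunct2, THEN conjunct2, THEN conjunct2, THEN conjunct2, THEN conjunct2, THEN conjunct2] assms
    by (rule bspec)
  note bij = faces[THEN conjunct1]
  have mono: "J1 \<subseteq> J2 \<longleftrightarrow> cone_of \<Delta> J1 \<subseteq> cone_of \<Delta> J2" if "J1 \<subseteq> I" "J2 \<subseteq> I" for J1 J2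
    using faces that by simp
  have fin: "finite I" using assms finite_simplex by blast
  obtain A0 where A0: "finite A0" "cone_of \<Delta> I = convex_cone hull A0"
    using sc[OF assms] by (auto simp: strongly_convex_rational_cone_def)
  obtain A where A: "finite A" "convex_cone hull A = cone_of \<Delta> I" "\<And>a. a \<in> A \<Longrightarrow> a \<notin> convex_cone hull (A - {a})"
    using minimal_cone_generators[OF A0(1)] A0(2) by metis
  have pointed: "convex_cone hull A \<inter> uminus ` (convex_cone hull A) = {0}"
    using sc[OF assms] by (simp add: A(2) strongly_convex_rational_cone_def)
  have V: "V i \<noteq> 0" "V i \<in> cone_of \<Delta> {i}" if "i \<in> I" for i
    using that subset_simplex[OF assms, of "{i}"] edges by (auto simp: edge_vectors_def vertices_def)
  have gen: "\<exists>i\<in>I. \<exists>c>0. a = c *\<^sub>R V i" if a: "a \<in> A" for a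
  proof -
    let ?R = "{c *\<^sub>R a | c. 0 \<le> c}"
    have a0: "a \<noteq> 0" using A(3)[OF a] by (auto simp: convex_cone_hull_contains_0)
    have "?R face_of cone_of \<Delta> I" using ray_face_of[OF A(1,3) pointed a] A(2) by simp
    moreover have aR: "a \<in> ?R" by (auto intro!: exI[of _ 1])
    ultimately have "?R \<in> cone_of \<Delta> ` Pow I" using bij by (auto simp: bij_betw_def)
    then obtain J where J: "J \<subseteq> I" "?R = cone_of \<Delta> J" by auto
    have "span ?R = span {a}"
    proof (rule span_eq[THEN iffD2], intro conjI)
      show "?R \<subseteq> span {a}" by (auto simp: span_singleton)
      show "{a} \<subseteq> span ?R" using span_base[OF aR] by simp
    qed
    hence "dim ?R = card {a}" using a0 by (intro dim_eq_card) (auto simp: dependent_single)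
    hence "card J = 1" using sc(2)[OF subset_simplex[OF assms J(1)]] J(2) by simp
    then obtain i where i: "J = {i}" by (auto simp: card_1_singleton_iff)
    have iI: "i \<in> I" using J i by auto
    have "V i \<in> ?R" using V[OF iI] J(2) i by simp
    then obtain c where c: "V i = c *\<^sub>R a" "0 \<le> c" by auto
    have "c \<noteq> 0" using c V[OF iI] by auto
    hence "a = (1 / c) *\<^sub>R V i" "1 / c > 0" using c by auto
    thus ?thesis using iI by blast
  qed
  have K: "?K = convex_cone hull (V ` I)" by (rule convex_cone_hull_image_finite[OF fin, symmetric])
  have "a \<in> ?K" if a: "a \<in> A" for a
  proof -
    obtain i c where ic: "i \<in> I" "c > 0" "a = c *\<^sub>R V i" using gen[OF a] by blast
    thus ?thesis unfolding K using convex_cone_hull_mul[OF hull_inc[of "V i" "V ` I"], of c] by simp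
  qed
  hence "cone_of \<Delta> I \<subseteq> ?K"
    unfolding A(2) [symmetric] K by (intro hull_minimal convex_cone_convex_cone_hull) auto
  moreover have "V i \<in> cone_of \<Delta> I" if "i \<in> I" for i
    using V(2)[OF that] mono[of "{i}" I] that by auto
  hence "?K \<subseteq> cone_of \<Delta> I"
    unfolding A(2) [symmetric] K by (intro hull_minimal convex_cone_convex_cone_hull) auto
  ultimately show eq: "cone_of \<Delta> I = ?K" by blast
  have sub: "?K \<subseteq> span (V ` I)" by (auto intro!: span_sum intro: span_scale span_base)
  \<comment> \<open>No set with fewer than \<open>card I\<close> elements spans the cone. For the
    set of edge vectors this gives injectivity, for that set less one redundant vector it gives
    independence.\<close>
  have dim: "card I \<le> card W" if "finite W" "V ` I \<subseteq> span W" for W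
  proof -
    have "cone_of \<Delta> I \<subseteq> span W" unfolding eq using sub span_minimal[OF that(2) subspace_span] by blast
    thus ?thesis using dim_le_card[of "cone_of \<Delta> I" W] sc(2)[OF assms] that by simp
  qed
  have "card I \<le> card (V ` I)" using fin by (intro dim) (auto intro: span_base)
  hence "card (V ` I) = card I" using card_image_le[OF fin, of V] by simp
  thus inj: "inj_on V I" using fin by (intro eq_card_imp_inj_on)
  show "independent (V ` I)"
  proof
    assume "dependent (V ` I)"
    then obtain a where a: "a \<in> V ` I" "a \<in> span (V ` I - {a})" by (auto simp: dependent_def)
    have "V ` I \<subseteq> span (V ` I - {a})" using a by (metis insert_Diff insert_subset span_superset)
    hence "card I \<le> card (V ` I - {a})" using fin by (intro dim) auto
    also have "\<dots> < card (V ` I)" using a fin by (intro card_Diff1_less) auto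
    finally show False using inj by (simp add: card_image)
  qed
qed

lemma inj_V: "J \<in> \<S> \<Longrightarrow> inj_on V J" by (rule cone_of_props)
lemma indep_V: "J \<in> \<S> \<Longrightarrow> independent (V ` J)" by (rule cone_of_props)

lemma span_cone_of:
  assumes "J \<in> \<S>"
  shows "span (cone_of \<Delta> J) = span (V ` J)"
proof (rule span_eq[THEN iffD2], intro conjI)
  show "cone_of \<Delta> J \<subseteq> span (V ` J)"
    unfolding cone_of_props(1)[OF assms] by (auto intro!: span_sum intro: span_scale span_base)
  show "V ` J \<subseteq> span (cone_of \<Delta> J)"
  proof
    fix x assume "x \<in> V ` J"
    then obtain i where i: "i \<in> J" "x = V i" by auto
    have "x = (\<Sum>j\<in>J. (if j = i then 1 else 0) *\<^sub>R V j)"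
      using finite_simplex[OF assms] i by (simp add: if_distrib[of "\<lambda>x. x *\<^sub>R _"] cong: if_cong)
    hence "x \<in> cone_of \<Delta> J"
      unfolding cone_of_props(1)[OF assms] using i by (intro CollectI exI[of _ "\<lambda>j. if j = i then 1 else 0"]) auto
    thus "x \<in> span (cone_of \<Delta> J)" by (rule span_base)
  qed
qed

lemma dim_cone_of: "J \<in> \<S> \<Longrightarrow> dim (cone_of \<Delta> J) = card J"
  using fan unfolding simplicial_multi_fan_def by auto

definition basis :: "'v set" where
  "basis = (SOME B. finite B \<and> card B = n \<and> independent B \<and> span B = UNIV \<and> L = int_span B)"

lemma basis: "finite basis" "card basis = n" "independent basis" "span basis = UNIV"
  and L_eq: "L = int_span basis"
proof -
  have "finite basis \<and> card basis = n \<and> independent basis \<and> span basis = UNIV \<and> L = int_span basis"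
    unfolding basis_def using lattice unfolding lattice_of_rank_def by (rule someI_ex)
  thus "finite basis" "card basis = n" "independent basis" "span basis = UNIV" "L = int_span basis" by auto
qed

lemma span_top:
  assumes "I \<in> \<T>"
  shows "span (V ` I) = UNIV"
proof -
  note I = topD[OF assms]
  have card: "card (V ` I) = card basis" using I inj_V[OF I(1)] basis by (simp add: card_image)
  have "basis \<subseteq> span (V ` I)"
  proof
    fix b assume b: "b \<in> basis"
    show "b \<in> span (V ` I)"
    proof (rule ccontr)
      assume nb: "b \<notin> span (V ` I)"
      hence ind: "independent (insert b (V ` I))" using indep_V[OF I(1)] by (simp add: independent_insert)
      have "insert b (V ` I) \<subseteq> span basis" unfolding basis(4) by (rule subset_UNIV)
      from independent_span_bound[OF basis(1) ind this] have "card (insert b (V ` I)) \<le> card basis" ..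
      moreover have "b \<notin> V ` I" using nb span_base[of b "V ` I"] by auto
      ultimately show False using card I by simp
    qed
  qed
  hence "span basis \<subseteq> span (V ` I)" by (rule span_minimal) (rule subspace_span)
  thus ?thesis using basis by auto
qed

lemma dual_basis_sum:
  assumes "J \<in> \<S>" "x \<in> span (V ` J)"
  shows "(\<Sum>i\<in>J. u J i x *\<^sub>R V i) = x"
proof -
  have "(\<Sum>b\<in>V ` J. representation (V ` J) x b *\<^sub>R b) = x"
    using assms finite_simplex indep_V by (intro sum_representation_eq) auto
  thus ?thesis using inj_V[OF assms(1)] by (simp add: sum.reindex dual_basis_def)
qed

lemma dual_basis_add:
  "J \<in> \<S> \<Longrightarrow> x \<in> span (V ` J) \<Longrightarrow> y \<in> span (V ` J) \<Longrightarrow> u J i (x + y) = u J i x + u J i y"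
  by (simp add: dual_basis_def representation_add indep_V)

lemma dual_basis_diff:
  "J \<in> \<S> \<Longrightarrow> x \<in> span (V ` J) \<Longrightarrow> y \<in> span (V ` J) \<Longrightarrow> u J i (x - y) = u J i x - u J i y"
  by (simp add: dual_basis_def representation_diff indep_V)

lemma dual_basis_scale:
  "J \<in> \<S> \<Longrightarrow> x \<in> span (V ` J) \<Longrightarrow> u J i (c *\<^sub>R x) = c * u J i x"
  by (simp add: dual_basis_def representation_scale indep_V)

lemma dual_basis_V:
  assumes "J \<in> \<S>" "i \<in> J" "j \<in> J"
  shows "u J i (V j) = (if i = j then 1 else 0)"
  using assms indep_V inj_V by (auto simp: dual_basis_def representation_basis inj_on_def)

lemma dual_basis_comb:
  assumes "J \<in> \<S>" "i \<in> J"
  shows "u J i (\<Sum>j\<in>J. c j *\<^sub>R V j) = c i"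
proof -
  have "u J i (\<Sum>j\<in>J. c j *\<^sub>R V j) = (\<Sum>j\<in>J. u J i (c j *\<^sub>R V j))"
    unfolding dual_basis_def using assms indep_V
    by (subst representation_sum) (auto intro: span_scale span_base)
  also have "\<dots> = (\<Sum>j\<in>J. c j * (if i = j then 1 else 0))"
    using assms by (intro sum.cong refl) (simp add: dual_basis_scale dual_basis_V span_base)
  also have "\<dots> = c i" using assms finite_simplex by (simp add: if_distrib cong: if_cong)
  finally show ?thesis .
qed

lemma linear_dual_basis:
  assumes "I \<in> \<T>"
  shows "linear (u I i)"
  using linear_coordinate[OF indep_V span_top] topD(1) assms by (simp add: dual_basis_def)

lemma comb_in_span: "(\<Sum>j\<in>J. c j *\<^sub>R V j) \<in> span (V ` J)"
  by (auto intro!: span_sum intro: span_scale span_base)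

text \<open>By this compatibility of coordinates H_J can be regarded as a part of H_I for a face J
  of I, see \<open>box_subset\<close>.\<close>

lemma dual_basis_subset:
  assumes "I \<in> \<S>" "J \<subseteq> I" "x \<in> span (V ` J)"
  shows "i \<in> J \<Longrightarrow> u I i x = u J i x" and "i \<in> I - J \<Longrightarrow> u I i x = 0"
proof -
  have J: "J \<in> \<S>" using assms subset_simplex by blast
  have "x = (\<Sum>j\<in>J. u J j x *\<^sub>R V j)" using dual_basis_sum[OF J assms(3)] by simp
  also have "\<dots> = (\<Sum>j\<in>I. (if j \<in> J then u J j x else 0) *\<^sub>R V j)"
    using assms(2) finite_simplex[OF assms(1)] by (intro sum.mono_neutral_cong_left) auto
  finally have "u I i x = (if i \<in> J then u J i x else 0)" if "i \<in> I" for i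
    using dual_basis_comb[OF assms(1) that, of "\<lambda>j. if j \<in> J then u J j x else 0"] by simp
  thus "i \<in> J \<Longrightarrow> u I i x = u J i x" "i \<in> I - J \<Longrightarrow> u I i x = 0" using assms(2) by auto
qed

lemma in_span_subset:
  assumes "I \<in> \<S>" "J \<subseteq> I" "x \<in> span (V ` I)" "\<And>i. i \<in> I - J \<Longrightarrow> u I i x = 0"
  shows "x \<in> span (V ` J)"
proof -
  have "x = (\<Sum>i\<in>I. u I i x *\<^sub>R V i)" using dual_basis_sum assms by simp
  also have "\<dots> = (\<Sum>i\<in>J. u I i x *\<^sub>R V i)"
    using assms finite_simplex by (intro sum.mono_neutral_right) auto
  finally show ?thesis using comb_in_span by metis
qed

end

section \<open>Lattice coordinates, half-open boxes and the groups H_J\<close>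

lemma representation_comb:
  fixes B :: "'v::real_vector set"
  assumes "independent B" "finite B" "b \<in> B"
  shows "representation B (\<Sum>x\<in>B. c x *\<^sub>R x) b = c b"
proof -
  have "representation B (\<Sum>x\<in>B. c x *\<^sub>R x) b = (\<Sum>x\<in>B. representation B (c x *\<^sub>R x) b)"
    using assms by (subst representation_sum) (auto intro: span_scale span_base)
  also have "\<dots> = (\<Sum>x\<in>B. c x * (if b = x then 1 else 0))"
    using assms by (intro sum.cong refl) (simp add: representation_scale representation_basis span_base)
  also have "\<dots> = c b" using assms by (simp add: if_distrib cong: if_cong)
  finally show ?thesis .
qed

lemma linear_expand_basis:
  assumes "linear f" "independent B" "finite B" "span B = UNIV"
  shows "f x = (\<Sum>b\<in>B. representation B x b *\<^sub>R f b)"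
proof -
  have "f x = f (\<Sum>b\<in>B. representation B x b *\<^sub>R b)"
    using assms by (subst sum_representation_eq) auto
  thus ?thesis using assms(1) by (simp add: linear_sum linear_scale)
qed

context edge_fan
begin

abbreviation "rep x b \<equiv> representation basis x b"

lemma rep_linear: "rep (x + y) b = rep x b + rep y b" "rep (x - y) b = rep x b - rep y b" "rep (c *\<^sub>R x) b = c * rep x b"
  by (simp_all add: representation_add representation_diff representation_scale basis)

lemma rep_sum: "rep (sum f A) b = (\<Sum>a\<in>A. rep (f a) b)"
  by (simp add: representation_sum basis)

lemma sum_rep: "(\<Sum>b\<in>basis. rep x b *\<^sub>R b) = x"
  using basis by (intro sum_representation_eq) auto

lemma L_iff: "x \<in> L \<longleftrightarrow> (\<forall>b\<in>basis. rep x b \<in> \<int>)"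
proof
  assume "x \<in> L"
  then obtain m where m: "x = (\<Sum>b\<in>basis. of_int (m b) *\<^sub>R b)" by (subst (asm) L_eq) (auto simp: int_span_def)
  show "\<forall>b\<in>basis. rep x b \<in> \<int>" unfolding m using basis by (simp add: representation_comb)
next
  assume *: "\<forall>b\<in>basis. rep x b \<in> \<int>"
  have "x = (\<Sum>b\<in>basis. rep x b *\<^sub>R b)" by (simp add: sum_rep)
  also have "\<dots> = (\<Sum>b\<in>basis. of_int \<lfloor>rep x b\<rfloor> *\<^sub>R b)" using * by (intro sum.cong refl) simp
  finally show "x \<in> L" by (subst L_eq) (auto simp: int_span_def)
qed

lemma L_add: "x \<in> L \<Longrightarrow> y \<in> L \<Longrightarrow> x + y \<in> L"
  and L_diff: "x \<in> L \<Longrightarrow> y \<in> L \<Longrightarrow> x - y \<in> L"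
  and L_scale: "x \<in> L \<Longrightarrow> c \<in> \<int> \<Longrightarrow> c *\<^sub>R x \<in> L"
  by (auto simp: L_iff rep_linear)

lemma L_sum: "(\<And>a. a \<in> A \<Longrightarrow> f a \<in> L) \<Longrightarrow> sum f A \<in> L"
  by (auto simp: L_iff rep_sum)

lemma V_in_L: "J \<in> \<S> \<Longrightarrow> i \<in> J \<Longrightarrow> V i \<in> L"
  using edges subset_simplex[of J "{i}"] by (auto simp: edge_vectors_def vertices_def)

lemma basis_subset_L: "basis \<subseteq> L"
  by (auto simp: L_iff representation_basis basis)

lemma finite_bounded_lattice: "finite {x \<in> L. \<forall>b\<in>basis. \<bar>rep x b\<bar> \<le> K}"
proof (rule finite_subset)
  let ?F = "PiE basis (\<lambda>_. {- \<lceil>K\<rceil>..\<lceil>K\<rceil>})"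
  show "finite ((\<lambda>m. \<Sum>b\<in>basis. of_int (m b) *\<^sub>R b) ` ?F)"
    using basis(1) by (intro finite_imageI finite_PiE) auto
  show "{x \<in> L. \<forall>b\<in>basis. \<bar>rep x b\<bar> \<le> K} \<subseteq> (\<lambda>m. \<Sum>b\<in>basis. of_int (m b) *\<^sub>R b) ` ?F"
  proof
    fix x assume x: "x \<in> {x \<in> L. \<forall>b\<in>basis. \<bar>rep x b\<bar> \<le> K}"
    show "x \<in> (\<lambda>m. \<Sum>b\<in>basis. of_int (m b) *\<^sub>R b) ` ?F"
    proof (rule image_eqI)
      have "x = (\<Sum>b\<in>basis. rep x b *\<^sub>R b)" by (simp add: sum_rep)
      also have "\<dots> = (\<Sum>b\<in>basis. of_int (restrict (\<lambda>b. \<lfloor>rep x b\<rfloor>) basis b) *\<^sub>R b)"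
        using x by (intro sum.cong refl) (auto simp: L_iff)
      finally show "x = (\<Sum>b\<in>basis. of_int (restrict (\<lambda>b. \<lfloor>rep x b\<rfloor>) basis b) *\<^sub>R b)" .
      have "- \<lceil>K\<rceil> \<le> \<lfloor>rep x b\<rfloor> \<and> \<lfloor>rep x b\<rfloor> \<le> \<lceil>K\<rceil>" if "b \<in> basis" for b
      proof -
        have "\<bar>rep x b\<bar> \<le> K" using x that by auto
        thus ?thesis by linarith
      qed
      thus "restrict (\<lambda>b. \<lfloor>rep x b\<rfloor>) basis \<in> ?F" by auto
    qed
  qed
qed

lemma dual_lattice_basis: "m \<in> dual_lattice L \<Longrightarrow> b \<in> basis \<Longrightarrow> m b \<in> \<int>"
  using basis_subset_L by (auto simp: dual_lattice_def)

lemma finite_bounded_dual_lattice: "finite {m \<in> dual_lattice L. \<forall>b\<in>basis. \<bar>m b\<bar> \<le> K}"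
proof (rule finite_imageD)
  let ?D = "{m \<in> dual_lattice L. \<forall>b\<in>basis. \<bar>m b\<bar> \<le> K}"
  show "finite ((\<lambda>m. restrict m basis) ` ?D)"
  proof (rule finite_subset)
    show "(\<lambda>m. restrict m basis) ` ?D \<subseteq> PiE basis (\<lambda>_. real_of_int ` {- \<lceil>K\<rceil>..\<lceil>K\<rceil>})"
    proof safe
      fix m b assume m: "m \<in> dual_lattice L" "\<forall>b\<in>basis. \<bar>m b\<bar> \<le> K" "b \<in> basis"
      then obtain k where k: "m b = of_int k" using dual_lattice_basis Ints_cases by metis
      have "\<bar>of_int k\<bar> \<le> K" using m k by metis
      hence "k \<in> {- \<lceil>K\<rceil>..\<lceil>K\<rceil>}" by (simp, linarith)
      thus "restrict m basis b \<in> real_of_int ` {- \<lceil>K\<rceil>..\<lceil>K\<rceil>}" using m k by auto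
    qed auto
    show "finite (PiE basis (\<lambda>_. real_of_int ` {- \<lceil>K\<rceil>..\<lceil>K\<rceil>}))"
      using basis(1) by (intro finite_PiE) auto
  qed
  show "inj_on (\<lambda>m. restrict m basis) ?D"
  proof (rule inj_onI)
    fix m m' assume mm: "m \<in> ?D" "m' \<in> ?D" "restrict m basis = restrict m' basis"
    have "m b = m' b" if "b \<in> basis" for b using fun_cong[OF mm(3), of b] that by simp
    moreover have "linear m" "linear m'" using mm by (auto simp: dual_lattice_def)
    ultimately show "m = m'" using linear_expand_basis[OF _ basis(3,1,4)]
      by (metis (no_types, lifting) ext sum.cong)
  qed
qed

lemma int_pairing_V:
  assumes "\<mu> \<in> dual_lattice L" "J \<in> \<S>" "i \<in> J"
  shows "of_int (int_pairing \<mu> (V i)) = \<mu> (V i)"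
proof -
  have "\<mu> (V i) \<in> \<int>" using assms V_in_L[OF assms(2,3)] by (auto simp: dual_lattice_def)
  thus ?thesis by (simp add: int_pairing_def)
qed

lemma dual_lattice_expand:
  assumes "\<mu> \<in> dual_lattice L" "J \<in> \<S>" "x \<in> span (V ` J)"
  shows "\<mu> x = (\<Sum>i\<in>J. of_int (int_pairing \<mu> (V i)) * u J i x)"
proof -
  have lin: "linear \<mu>" using assms(1) by (simp add: dual_lattice_def)
  have "\<mu> x = \<mu> (\<Sum>i\<in>J. u J i x *\<^sub>R V i)" by (simp add: dual_basis_sum[OF assms(2,3)])
  thus ?thesis using int_pairing_V[OF assms(1,2)]
    by (simp add: linear_sum[OF lin] linear_scale[OF lin] mult.commute)
qed

lemma edge_lattice_iff:
  assumes "J \<in> \<S>"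
  shows "x \<in> edge_lattice V J \<longleftrightarrow> x \<in> span (V ` J) \<and> (\<forall>i\<in>J. u J i x \<in> \<int>)"
proof
  assume "x \<in> edge_lattice V J"
  then obtain m where m: "x = (\<Sum>i\<in>J. of_int (m (V i)) *\<^sub>R V i)"
    using inj_V[OF assms] by (auto simp: edge_lattice_def int_span_def sum.reindex)
  show "x \<in> span (V ` J) \<and> (\<forall>i\<in>J. u J i x \<in> \<int>)"
    unfolding m using dual_basis_comb[OF assms, of _ "\<lambda>i. of_int (m (V i))"] comb_in_span by auto
next
  assume *: "x \<in> span (V ` J) \<and> (\<forall>i\<in>J. u J i x \<in> \<int>)"
  have "x = (\<Sum>i\<in>J. u J i x *\<^sub>R V i)" using dual_basis_sum[OF assms] * by simp
  also have "\<dots> = (\<Sum>i\<in>J. of_int \<lfloor>representation (V ` J) x (V i)\<rfloor> *\<^sub>R V i)"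
    using * by (intro sum.cong refl) (auto simp: dual_basis_def)
  also have "\<dots> = (\<Sum>b\<in>V ` J. of_int \<lfloor>representation (V ` J) x b\<rfloor> *\<^sub>R b)"
    using inj_V[OF assms] by (simp add: sum.reindex)
  finally show "x \<in> edge_lattice V J" by (auto simp: edge_lattice_def int_span_def)
qed

text \<open>The normal representatives of H_J. Lattice points of a half-open parallelepiped, unlike
  classes, can be compared between simplices: for a face J of I, \<open>box J\<close> lies in
  \<open>box I\<close>.\<close>

definition box :: "'i set \<Rightarrow> 'v set" where
  "box J = {x \<in> L. x \<in> span (V ` J) \<and> (\<forall>i\<in>J. 0 \<le> u J i x \<and> u J i x < 1)}"

definition reduce :: "'i set \<Rightarrow> 'v \<Rightarrow> 'v" where
  "reduce J x = x - (\<Sum>i\<in>J. of_int \<lfloor>u J i x\<rfloor> *\<^sub>R V i)"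

lemma reduce:
  assumes "J \<in> \<S>" "x \<in> L" "x \<in> span (V ` J)"
  shows "i \<in> J \<Longrightarrow> u J i (reduce J x) = frac (u J i x)" and "reduce J x \<in> box J"
proof -
  have u: "u J i (reduce J x) = frac (u J i x)" if "i \<in> J" for i
    unfolding reduce_def frac_def
    using assms that dual_basis_comb[OF assms(1) that, of "\<lambda>i. of_int \<lfloor>u J i x\<rfloor>"]
    by (simp add: dual_basis_diff comb_in_span)
  thus "i \<in> J \<Longrightarrow> u J i (reduce J x) = frac (u J i x)" .
  have "reduce J x \<in> L" unfolding reduce_def
    using assms V_in_L by (intro L_diff L_sum L_scale) auto
  moreover have "reduce J x \<in> span (V ` J)" unfolding reduce_def using assms by (intro span_diff comb_in_span)
  ultimately show "reduce J x \<in> box J" using u by (auto simp: box_def frac_lt_1)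
qed

lemma span_eqI:
  assumes "J \<in> \<S>" "x \<in> span (V ` J)" "y \<in> span (V ` J)" "\<And>i. i \<in> J \<Longrightarrow> u J i x = u J i y"
  shows "x = y"
proof -
  have "(\<Sum>i\<in>J. u J i x *\<^sub>R V i) = (\<Sum>i\<in>J. u J i y *\<^sub>R V i)" using assms(4) by simp
  thus ?thesis using dual_basis_sum assms(1-3) by simp
qed

lemma box_eqI:
  assumes "J \<in> \<S>" "x \<in> box J" "y \<in> box J" "\<And>i. i \<in> J \<Longrightarrow> u J i x - u J i y \<in> \<int>"
  shows "x = y"
proof (rule span_eqI[OF assms(1)])
  fix i assume i: "i \<in> J"
  then obtain k where k: "u J i x - u J i y = of_int k" using assms(4) Ints_cases by metis
  have "0 \<le> u J i x" "u J i x < 1" "0 \<le> u J i y" "u J i y < 1" using assms i by (auto simp: box_def)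
  hence "-1 < real_of_int k" "real_of_int k < 1" using k by linarith+
  hence "k = 0" by linarith
  thus "u J i x = u J i y" using k by simp
qed (use assms in \<open>auto simp: box_def\<close>)

lemma finite_box:
  assumes "J \<in> \<S>"
  shows "finite (box J)"
proof (rule finite_subset[OF _ finite_bounded_lattice])
  \<comment> \<open>Coordinates in the box are below 1, so the triangle inequality bounds each basis
    coordinate; summing over the basis gives one constant for all.\<close>
  define K where "K = (\<Sum>b\<in>basis. \<Sum>i\<in>J. \<bar>rep (V i) b\<bar>)"
  show "box J \<subseteq> {x \<in> L. \<forall>b\<in>basis. \<bar>rep x b\<bar> \<le> K}"
  proof safe
    fix x b assume x: "x \<in> box J" and b: "b \<in> basis"
    have "rep x b = rep (\<Sum>i\<in>J. u J i x *\<^sub>R V i) b" using x dual_basis_sum[OF assms] by (simp add: box_def)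
    also have "\<dots> = (\<Sum>i\<in>J. u J i x * rep (V i) b)" by (simp add: rep_sum rep_linear)
    finally have "\<bar>rep x b\<bar> \<le> (\<Sum>i\<in>J. \<bar>u J i x * rep (V i) b\<bar>)" by (simp add: sum_abs)
    also have "\<dots> \<le> (\<Sum>i\<in>J. 1 * \<bar>rep (V i) b\<bar>)"
      unfolding abs_mult using x by (intro sum_mono mult_right_mono) (auto simp: box_def)
    also have "\<dots> \<le> K" unfolding K_def using b basis(1)
      by (intro order_trans[OF _ member_le_sum[of b]]) (auto intro: sum_nonneg)
    finally show "\<bar>rep x b\<bar> \<le> K" .
  qed (simp add: box_def)
qed

lemma zero_in_box: "J \<in> \<S> \<Longrightarrow> 0 \<in> box J"
  using reduce(2)[of J 0] by (auto simp: box_def L_iff representation_zero dual_basis_def span_zero)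

lemma card_box_pos: "J \<in> \<S> \<Longrightarrow> card (box J) > 0"
  using finite_box zero_in_box by (auto simp: card_gt_0_iff)

lemma sub_lattice_eq: "J \<in> \<S> \<Longrightarrow> sub_lattice L \<Delta> J = {x \<in> L. x \<in> span (V ` J)}"
  by (auto simp: sub_lattice_def span_cone_of)

abbreviation "coset J x \<equiv> {y \<in> L. y \<in> span (V ` J) \<and> (\<forall>i\<in>J. u J i x - u J i y \<in> \<int>)}"

lemma H_group_iff:
  assumes "J \<in> \<S>"
  shows "h \<in> \<H> J \<longleftrightarrow> (\<exists>x. x \<in> L \<and> x \<in> span (V ` J) \<and>
           h = coset J x)"
proof -
  have "{(x, y). x \<in> sub_lattice L \<Delta> J \<and> y \<in> sub_lattice L \<Delta> J \<and> x - y \<in> edge_lattice V J} `` {x} =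
        coset J x" if "x \<in> L" "x \<in> span (V ` J)" for x
    using that assms
    by (auto simp: sub_lattice_eq edge_lattice_iff dual_basis_diff span_diff)
  thus ?thesis unfolding H_group_def quotient_def by (auto simp: sub_lattice_eq[OF assms])
qed

lemma normal_rep:
  assumes "J \<in> \<S>" "h \<in> \<H> J"
  shows "normal_rep V J h \<in> h" "normal_rep V J h \<in> box J"
    "\<And>x i. x \<in> h \<Longrightarrow> i \<in> J \<Longrightarrow> u J i x - u J i (normal_rep V J h) \<in> \<int>"
    "\<And>x. x \<in> h \<Longrightarrow> x \<in> L \<and> x \<in> span (V ` J)"
proof -
  obtain x where x: "x \<in> L" "x \<in> span (V ` J)"
    "h = coset J x"
    using assms H_group_iff by auto
  note r = reduce[OF assms(1) x(1,2)]
  have rh: "reduce J x \<in> h" using r by (auto simp: x(3) box_def frac_def)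
  have "normal_rep V J h = reduce J x"
    unfolding normal_rep_def
  proof (rule the_equality)
    show "reduce J x \<in> h \<and> (\<forall>i\<in>J. 0 \<le> u J i (reduce J x) \<and> u J i (reduce J x) < 1)"
      using rh r(2) by (auto simp: box_def)
    fix y assume y: "y \<in> h \<and> (\<forall>i\<in>J. 0 \<le> u J i y \<and> u J i y < 1)"
    show "y = reduce J x"
    proof (rule box_eqI[OF assms(1) _ r(2)])
      show "y \<in> box J" using y by (auto simp: x(3) box_def)
      fix i assume i: "i \<in> J"
      have "u J i x - u J i y \<in> \<int>" "u J i x - u J i (reduce J x) \<in> \<int>" using y rh i by (auto simp: x(3))
      from Ints_diff[OF this(2,1)] show "u J i y - u J i (reduce J x) \<in> \<int>" by simp
    qed
  qed
  thus nh: "normal_rep V J h \<in> h" "normal_rep V J h \<in> box J" using rh r by auto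
  fix y assume y: "y \<in> h"
  thus "y \<in> L \<and> y \<in> span (V ` J)" by (auto simp: x(3))
  fix i assume i: "i \<in> J"
  have "u J i x - u J i y \<in> \<int>" "u J i x - u J i (normal_rep V J h) \<in> \<int>" using y nh i by (auto simp: x(3))
  from Ints_diff[OF this(2,1)] show "u J i y - u J i (normal_rep V J h) \<in> \<int>" by simp
qed

lemma bij_betw_normal_rep:
  assumes "J \<in> \<S>"
  shows "bij_betw (normal_rep V J) (\<H> J) (box J)"
  unfolding bij_betw_def
proof
  show "inj_on (normal_rep V J) (\<H> J)"
  proof (rule inj_onI)
    fix h h' assume h: "h \<in> \<H> J" "h' \<in> \<H> J" "normal_rep V J h = normal_rep V J h'"
    have sub: "h = coset J (normal_rep V J h)"
      if hh: "h \<in> \<H> J" for h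
    proof -
      obtain x where x: "x \<in> L" "x \<in> span (V ` J)"
        "h = coset J x"
        using assms H_group_iff hh by auto
      have xn: "u J i x - u J i (normal_rep V J h) \<in> \<int>" if "i \<in> J" for i
        using normal_rep(3)[OF assms hh _ that, of x] x by auto
      have iff: "u J i x - u J i y \<in> \<int> \<longleftrightarrow> u J i (normal_rep V J h) - u J i y \<in> \<int>" if "i \<in> J" for i y
        using Ints_diff[OF _ xn[OF that], of "u J i x - u J i y"] Ints_add[OF _ xn[OF that], of "u J i (normal_rep V J h) - u J i y"]
        by auto
      note x(3)
      also have "coset J x =
         coset J (normal_rep V J h)"
        using iff by (intro Collect_cong conj_cong ball_cong refl)
      finally show ?thesis .
    qed
    show "h = h'" by (rule trans[OF sub[OF h(1), unfolded h(3)] sub[OF h(2), symmetric]])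
  qed
  show "normal_rep V J ` \<H> J = box J"
  proof safe
    fix h assume "h \<in> \<H> J"
    thus "normal_rep V J h \<in> box J" by (rule normal_rep(2)[OF assms])
  next
    fix x assume x: "x \<in> box J"
    define h where "h = coset J x"
    have h: "h \<in> \<H> J" using x H_group_iff[OF assms] by (auto simp: h_def box_def)
    have "x \<in> h" using x by (auto simp: h_def box_def)
    hence "x = normal_rep V J h" using normal_rep[OF assms h] x by (intro box_eqI[OF assms]) auto
    thus "x \<in> normal_rep V J ` \<H> J" using h by blast
  qed
qed

lemma card_H_group: "J \<in> \<S> \<Longrightarrow> card (\<H> J) = card (box J)"
  using bij_betw_normal_rep bij_betw_same_card by blast

lemma sum_H_group: "J \<in> \<S> \<Longrightarrow> (\<Sum>h\<in>\<H> J. g (normal_rep V J h)) = (\<Sum>x\<in>box J. g x)"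
  using bij_betw_normal_rep by (rule sum.reindex_bij_betw)

text \<open>Pigeonhole: with N = \<open>card (box I)\<close>, two of the multiples 0, ..., N of
  \<open>x\<close> have the same reduction, so some k - j <= N clears the denominator. It divides
  N!, which therefore serves all \<open>x\<close> and \<open>i\<close>.\<close>

lemma box_denominator:
  assumes "I \<in> \<T>" "x \<in> L" "i \<in> I"
  shows "fact (card (box I)) * u I i x \<in> \<int>"
proof -
  have I: "I \<in> \<S>" using topD assms by blast
  have sp: "y \<in> span (V ` I)" for y using span_top[OF assms(1)] by simp
  define N where "N = card (box I)"
  define f where "f = (\<lambda>k::nat. reduce I (real k *\<^sub>R x))"
  have kL: "real k *\<^sub>R x \<in> L" for k using assms by (intro L_scale) auto
  have "f ` {..N} \<subseteq> box I" unfolding f_def using reduce(2)[OF I kL sp] by auto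
  hence "card (f ` {..N}) \<le> N" unfolding N_def by (intro card_mono finite_box I)
  hence "\<not> inj_on f {..N}" using card_image[of f "{..N}"] by auto
  then obtain j k where jk: "j \<le> N" "k \<le> N" "j < k" "f j = f k"
    unfolding inj_on_def by (metis atMost_iff linorder_neqE_nat)
  have "frac (real j * u I i x) = frac (real k * u I i x)"
    using arg_cong[OF jk(4), of "u I i"] reduce(1)[OF I kL sp assms(3)]
    by (simp add: f_def dual_basis_scale[OF I sp])
  hence "real k * u I i x - real j * u I i x = of_int (\<lfloor>real k * u I i x\<rfloor> - \<lfloor>real j * u I i x\<rfloor>)"
    by (simp add: frac_def)
  hence "real (k - j) * u I i x \<in> \<int>" using jk(3) by (simp add: of_nat_diff left_diff_distrib)
  moreover have "k - j dvd fact N" using jk by (intro dvd_fact) auto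
  then obtain c where "fact N = (k - j) * c" by (auto simp: dvd_def)
  hence "real (fact N) = real (k - j) * real c" by (metis of_nat_mult)
  hence "fact N * u I i x = real c * (real (k - j) * u I i x)" by (simp add: mult_ac)
  ultimately show ?thesis unfolding N_def [symmetric] by (metis Ints_mult Ints_of_nat)
qed

text \<open>Multiplied over all top simplices, so that every fractional power of q in the genus is a
  power of the single variable Q = q^(1/\<open>denom\<close>).\<close>

definition denom :: nat where "denom = (\<Prod>I\<in>\<T>. fact (card (box I)))"

lemma denom_pos: "denom > 0"
  using finite_top by (simp add: denom_def)

lemma denom:
  assumes "I \<in> \<T>" "x \<in> L" "i \<in> I"
  shows "real denom * u I i x \<in> \<int>"
proof -
  have "denom = fact (card (box I)) * (\<Prod>I\<in>\<T> - {I}. fact (card (box I)))"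
    unfolding denom_def using assms finite_top by (simp add: prod.remove)
  hence "real denom * u I i x = real (\<Prod>I\<in>\<T> - {I}. fact (card (box I))) * (fact (card (box I)) * u I i x)"
    by simp
  thus ?thesis using box_denominator[OF assms] by (metis Ints_mult Ints_of_nat)
qed

abbreviation "form I m x \<equiv> \<Sum>i\<in>I. of_int (m i :: int) * u I i x"

text \<open>If the form takes a nonintegral value at some y in L, translation by y, reduced to the
  box, permutes the box and multiplies every summand by a number other than 1, so the sum
  vanishes.\<close>

lemma character_orthogonality:
  assumes I: "I \<in> \<T>"
  defines "\<mu> \<equiv> (\<lambda>m x. \<Sum>i\<in>I. of_int (m i) * u I i x)"
  shows "(\<Sum>x\<in>box I. e2pi (- of_real (\<mu> m x))) = (if \<mu> m ` L \<subseteq> \<int> then of_nat (card (box I)) else 0)"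
proof (cases "\<mu> m ` L \<subseteq> \<int>")
  case True
  have "e2pi (- of_real (\<mu> m x)) = 1" if "x \<in> box I" for x
  proof -
    have "\<mu> m x \<in> \<int>" using that True by (auto simp: box_def)
    then obtain k where "\<mu> m x = of_int k" by (auto simp: Ints_def)
    thus ?thesis by (simp add: e2pi_eq_1_iff)
  qed
  thus ?thesis using True by simp
next
  case False
  then obtain y where y: "y \<in> L" "\<mu> m y \<notin> \<int>" by auto
  have IS: "I \<in> \<S>" using topD I by blast
  have sp: "y \<in> span (V ` I)" for y using span_top[OF I] by simp
  define f where "f = (\<lambda>x. reduce I (x + y))"
  have xy: "x + y \<in> L" if "x \<in> box I" for x using that y by (auto simp: box_def intro: L_add)
  have uf: "u I i (f x) = frac (u I i x + u I i y)" if "x \<in> box I" "i \<in> I" for x i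
    unfolding f_def using reduce(1)[OF IS xy[OF that(1)] sp that(2)] by (simp add: dual_basis_add[OF IS sp sp])
  have sub: "f ` box I \<subseteq> box I" unfolding f_def using reduce(2)[OF IS xy sp] by auto
  have "inj_on f (box I)"
  proof (rule inj_onI)
    fix x x' assume x: "x \<in> box I" "x' \<in> box I" "f x = f x'"
    show "x = x'"
    proof (rule box_eqI[OF IS x(1,2)])
      fix i assume i: "i \<in> I"
      have "frac (u I i x + u I i y) = frac (u I i x' + u I i y)" using uf x i by metis
      hence "u I i x - u I i x' = of_int (\<lfloor>u I i x + u I i y\<rfloor> - \<lfloor>u I i x' + u I i y\<rfloor>)" by (simp add: frac_def)
      thus "u I i x - u I i x' \<in> \<int>" by simp
    qed
  qed
  hence bij: "bij_betw f (box I) (box I)"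
    using endo_inj_surj[OF finite_box[OF IS] sub] by (simp add: bij_betw_def)
  have "e2pi (- of_real (\<mu> m (f x))) = e2pi (- of_real (\<mu> m y)) * e2pi (- of_real (\<mu> m x))" if x: "x \<in> box I" for x
  proof -
    have "\<mu> m (f x) = \<mu> m x + \<mu> m y - of_int (\<Sum>i\<in>I. m i * \<lfloor>u I i x + u I i y\<rfloor>)"
    proof -
      have "\<mu> m (f x) = (\<Sum>i\<in>I. of_int (m i) * (u I i x + u I i y - of_int \<lfloor>u I i x + u I i y\<rfloor>))"
        unfolding \<mu>_def by (intro sum.cong refl) (simp add: uf[OF x] frac_def)
      thus ?thesis by (simp add: \<mu>_def algebra_simps sum.distrib sum_subtractf)
    qed
    hence "- complex_of_real (\<mu> m (f x)) = - of_real (\<mu> m y) + - of_real (\<mu> m x) + of_int (\<Sum>i\<in>I. m i * \<lfloor>u I i x + u I i y\<rfloor>)"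
      by simp
    moreover have "e2pi (of_int k) = 1" for k by (simp add: e2pi_eq_1_iff)
    ultimately show ?thesis by (simp only: e2pi_add) simp
  qed
  hence "(\<Sum>x\<in>box I. e2pi (- of_real (\<mu> m (f x)))) = e2pi (- of_real (\<mu> m y)) * (\<Sum>x\<in>box I. e2pi (- of_real (\<mu> m x)))"
    by (simp add: sum_distrib_left)
  moreover have "(\<Sum>x\<in>box I. e2pi (- of_real (\<mu> m (f x)))) = (\<Sum>x\<in>box I. e2pi (- of_real (\<mu> m x)))"
    by (rule sum.reindex_bij_betw[OF bij])
  moreover have "e2pi (- of_real (\<mu> m y)) \<noteq> 1"
  proof
    assume "e2pi (- of_real (\<mu> m y)) = 1"
    then obtain k where "- complex_of_real (\<mu> m y) = of_int k" by (auto simp: e2pi_eq_1_iff simp: Ints_def)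
    hence "- \<mu> m y = of_int k" by (metis of_real_eq_iff of_real_minus of_real_of_int_eq)
    hence "\<mu> m y = of_int (- k)" by simp
    thus False using y(2) by simp
  qed
  ultimately show ?thesis using False by auto
qed

end

section \<open>Generic vectors and degrees\<close>

lemma zeta_pow_add: "zeta_pow \<sigma> (a + b) = zeta_pow \<sigma> a * zeta_pow \<sigma> b"
  by (simp add: zeta_pow_def e2pi_add ring_distribs)

lemma zeta_pow_0 [simp]: "zeta_pow \<sigma> 0 = 1"
  by (simp add: zeta_pow_def)

lemma zeta_pow_sum: "zeta_pow \<sigma> (sum f A) = (\<Prod>a\<in>A. zeta_pow \<sigma> (f a))"
  by (induction A rule: infinite_finite_induct) (simp_all add: zeta_pow_add)

lemma zeta_pow_nonzero [simp]: "zeta_pow \<sigma> a \<noteq> 0"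
  by (simp add: zeta_pow_def)

lemma fls_X_intpow_sum:
  "(fls_X_intpow (sum f A) :: complex fls) = (\<Prod>a\<in>A. fls_X_intpow (f a))"
proof (induction A rule: infinite_finite_induct)
  case (insert x A)
  have "(fls_X_intpow (sum f (insert x A)) :: complex fls) = fls_X_intpow (f x) * fls_X_intpow (sum f A)"
    unfolding fls_X_intpow_times_fls_X_intpow using insert.hyps by simp
  thus ?case unfolding prod.insert[OF insert.hyps] insert.IH [symmetric] .
qed simp_all

lemma fls_const_prod: "fls_const (\<Prod>a\<in>A. f a :: complex) = (\<Prod>a\<in>A. fls_const (f a))"
  by (induction A rule: infinite_finite_induct) (simp_all flip: fls_const_mult_const)

lemma fls_compose_power_sum: "fls_compose_power (sum f A) d = (\<Sum>a\<in>A. fls_compose_power (f a) d)"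
  by (induction A rule: infinite_finite_induct) simp_all

lemma fls_compose_power_prod:
  "d > 0 \<Longrightarrow> fls_compose_power (prod f A :: complex fls) d = (\<Prod>a\<in>A. fls_compose_power (f a) d)"
  by (induction A rule: infinite_finite_induct) simp_all

lemma fls_compose_power_inverse:
  assumes "d > 0" "f \<noteq> 0"
  shows "fls_compose_power (1 / f :: complex fls) d = 1 / fls_compose_power f d"
proof -
  have "fls_compose_power f d * fls_compose_power (1 / f) d = fls_compose_power (f * (1 / f)) d"
    by (rule fls_compose_power_mult [symmetric])
  also have "f * (1 / f) = 1" using assms(2) by simp
  also have "fls_compose_power 1 d = (1 :: complex fls)" using assms(1) by simp
  finally have *: "fls_compose_power f d * fls_compose_power (1 / f) d = 1" .
  hence "fls_compose_power f d \<noteq> 0" by auto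
  thus ?thesis using * by (simp add: nonzero_eq_divide_eq mult.commute)
qed

lemma fps_to_fls_prod: "fps_to_fls (prod f A :: complex fps) = (\<Prod>a\<in>A. fps_to_fls (f a))"
  by (induction A rule: infinite_finite_induct) (simp_all add: fls_times_fps_to_fls)

lemma fps_to_fls_sum: "fps_to_fls (sum f A :: complex fps) = (\<Sum>a\<in>A. fps_to_fls (f a))"
  by (induction A rule: infinite_finite_induct) simp_all

context edge_fan
begin

text \<open>One condition on v that makes its image generic for every projected multi-fan, see
  \<open>generic_proj_generic\<close>; the same v then computes all degrees.\<close>

definition generic :: "'v \<Rightarrow> bool" where
  "generic v \<longleftrightarrow> (\<forall>J\<in>\<S>. card J < n \<longrightarrow> v \<notin> span (V ` J))"

lemma generic_dual_basis_nonzero: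
  assumes "generic v" "I \<in> \<T>" "i \<in> I"
  shows "u I i v \<noteq> 0"
proof
  assume z: "u I i v = 0"
  note I = topD[OF assms(2)]
  have "v \<in> span (V ` (I - {i}))"
    by (rule in_span_subset[OF I(1)]) (use span_top[OF assms(2)] z assms in auto)
  moreover have "card (I - {i}) < n" using I(2) card_Diff1_less[OF I(3) assms(3)] by simp
  moreover have "I - {i} \<in> \<S>" using subset_simplex[OF I(1), of "I - {i}"] by blast
  ultimately show False using assms(1) by (auto simp: generic_def)
qed

lemma proj_class_eq_iff:
  assumes "J \<in> \<S>"
  shows "proj_class \<Delta> J x = proj_class \<Delta> J y \<longleftrightarrow> x - y \<in> span (V ` J)"
proof
  assume "proj_class \<Delta> J x = proj_class \<Delta> J y"
  moreover have "x \<in> proj_class \<Delta> J x" unfolding proj_class_def by (auto intro!: exI[of _ 0] span_zero)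
  ultimately obtain z where "x = y + z" "z \<in> span (cone_of \<Delta> J)" unfolding proj_class_def by auto
  thus "x - y \<in> span (V ` J)" by (simp add: span_cone_of[OF assms])
next
  assume *: "x - y \<in> span (V ` J)"
  have "proj_class \<Delta> J x \<subseteq> proj_class \<Delta> J y" if "x - y \<in> span (V ` J)" for x y
  proof
    fix z assume "z \<in> proj_class \<Delta> J x"
    then obtain s where s: "z = x + s" "s \<in> span (V ` J)" by (auto simp: proj_class_def span_cone_of[OF assms])
    have "z = y + ((x - y) + s)" using s by simp
    moreover have "(x - y) + s \<in> span (V ` J)" using that s by (intro span_add)
    ultimately show "z \<in> proj_class \<Delta> J y" unfolding proj_class_def span_cone_of[OF assms] by blast
  qed
  moreover have "y - x \<in> span (V ` J)" using span_neg[OF *] by simp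
  ultimately show "proj_class \<Delta> J x = proj_class \<Delta> J y" using * by blast
qed

text \<open>Modulo the span of C(J) the coordinates along J are free and the others are those of v.
  They are positive and not merely nonnegative by genericity.\<close>

lemma proj_class_in_cone_iff:
  assumes "generic v" "I \<in> \<T>" "J \<subseteq> I"
  shows "proj_class \<Delta> J v \<in> proj_class \<Delta> J ` cone_of \<Delta> I \<longleftrightarrow> (\<forall>i\<in>I - J. u I i v > 0)"
proof
  note I = topD[OF assms(2)]
  have J: "J \<in> \<S>" using subset_simplex[OF I(1) assms(3)] .
  have sp: "x \<in> span (V ` I)" for x using span_top[OF assms(2)] by simp
  {
    assume "proj_class \<Delta> J v \<in> proj_class \<Delta> J ` cone_of \<Delta> I"
    then obtain x where x: "x \<in> cone_of \<Delta> I" "v - x \<in> span (V ` J)" using proj_class_eq_iff[OF J] by auto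
    obtain c where c: "x = (\<Sum>i\<in>I. c i *\<^sub>R V i)" "\<forall>i\<in>I. 0 \<le> c i" using x(1) cone_of_props(1)[OF I(1)] by auto
    show "\<forall>i\<in>I - J. u I i v > 0"
    proof
      fix i assume i: "i \<in> I - J"
      have "u I i (v - x) = 0" by (rule dual_basis_subset(2)[OF I(1) assms(3) x(2) i])
      hence "u I i v = c i" using dual_basis_diff[OF I(1) sp sp] dual_basis_comb[OF I(1), of i c] i c(1) by simp
      thus "u I i v > 0" using c(2) i generic_dual_basis_nonzero[OF assms(1,2), of i] by force
    qed
  }
  assume pos: "\<forall>i\<in>I - J. u I i v > 0"
  \<comment> \<open>The representative of the class of v with coordinates 0 along J.\<close>
  define x where "x = (\<Sum>i\<in>I. (if i \<in> J then 0 else u I i v) *\<^sub>R V i)"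
  have "x \<in> cone_of \<Delta> I" unfolding cone_of_props(1)[OF I(1)] x_def using pos
    by (intro CollectI exI[of _ "\<lambda>i. if i \<in> J then 0 else u I i v"]) (auto intro: less_imp_le)
  moreover have "v - x \<in> span (V ` J)"
  proof (rule in_span_subset[OF I(1) assms(3) sp])
    fix i assume i: "i \<in> I - J"
    thus "u I i (v - x) = 0"
      using dual_basis_diff[OF I(1) sp sp] dual_basis_comb[OF I(1), of i "\<lambda>i. if i \<in> J then 0 else u I i v"]
      by (simp add: x_def)
  qed
  ultimately show "proj_class \<Delta> J v \<in> proj_class \<Delta> J ` cone_of \<Delta> I"
    using proj_class_eq_iff[OF J] by blast
qed

lemma generic_proj_generic:
  assumes "generic v" "J \<in> \<S>"
  shows "proj_generic n \<Delta> J (proj_class \<Delta> J v)"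
  unfolding proj_generic_def
proof (intro conjI ballI impI)
  fix K assume K: "K \<in> simplices (projected \<Delta> J)"
    and dim: "dim (cone_of \<Delta> K) - dim (cone_of \<Delta> J) < n - dim (cone_of \<Delta> J)"
  have KS: "K \<in> \<S>" "J \<subseteq> K" using K by (auto simp: projected_def)
  have "card K < n" using dim unfolding dim_cone_of[OF KS(1)] dim_cone_of[OF assms(2)] by linarith
  hence nv: "v \<notin> span (V ` K)" using assms(1) KS by (auto simp: generic_def)
  show "proj_class \<Delta> J v \<notin> proj_class \<Delta> J ` span (cone_of \<Delta> K)"
  proof
    assume "proj_class \<Delta> J v \<in> proj_class \<Delta> J ` span (cone_of \<Delta> K)"
    then obtain y where y: "y \<in> span (V ` K)" "v - y \<in> span (V ` J)"
      using proj_class_eq_iff[OF assms(2)] span_cone_of[OF KS(1)] by auto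
    have "v - y \<in> span (V ` K)" using y(2) span_mono[OF image_mono[OF KS(2)]] by blast
    from span_add[OF this y(1)] show False using nv by simp
  qed
qed auto

text \<open>The description in \<open>proj_degree\<close> determines a number only if the quotient
  has a generic point; the image of v is one, and it evaluates the degree.\<close>

lemma proj_degree_eq:
  assumes "complete_multi_fan n \<Delta>" "generic v" "J \<in> \<S>"
  shows "proj_degree n \<Delta> J = (\<Sum>I\<in>{I\<in>\<T>. J \<subseteq> I \<and> (\<forall>i\<in>I - J. u I i v > 0)}. weight \<Delta> I)"
proof -
  let ?v = "proj_class \<Delta> J v"
  note g = generic_proj_generic[OF assms(2,3)]
  obtain m where m: "\<And>v. proj_generic n \<Delta> J v \<Longrightarrow> local_degree n (projected \<Delta> J) v = m"
    using assms(1,3) unfolding complete_multi_fan_def proj_pre_complete_def by blast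
  have "proj_degree n \<Delta> J = m"
    unfolding proj_degree_def
  proof (rule the_equality)
    show "\<forall>v. proj_generic n \<Delta> J v \<longrightarrow> local_degree n (projected \<Delta> J) v = m" using m by blast
    show "m' = m" if "\<forall>v. proj_generic n \<Delta> J v \<longrightarrow> local_degree n (projected \<Delta> J) v = m'" for m'
      using that g m[OF g] by auto
  qed
  also have "m = local_degree n (projected \<Delta> J) ?v" using m[OF g] by simp
  also have "\<dots> = (\<Sum>I\<in>{I\<in>\<T>. J \<subseteq> I \<and> (\<forall>i\<in>I - J. u I i v > 0)}. weight \<Delta> I)"
    unfolding local_degree_def
  proof (rule sum.cong)
    show "{I \<in> k_simplices (projected \<Delta> J) n. ?v \<in> cone_of (projected \<Delta> J) I} = {I\<in>\<T>. J \<subseteq> I \<and> (\<forall>i\<in>I - J. u I i v > 0)}"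
      using proj_class_in_cone_iff[OF assms(2)] by (auto simp: k_simplices_def projected_def)
  qed (simp add: weight_def projected_def)
  finally show ?thesis .
qed

lemma box_subset:
  assumes "I \<in> \<S>" "J \<subseteq> I"
  shows "box J = {x \<in> box I. \<forall>i\<in>I - J. u I i x = 0}"
proof safe
  fix x assume x: "x \<in> box J"
  hence sp: "x \<in> span (V ` J)" by (simp add: box_def)
  show "x \<in> box I" unfolding box_def
  proof (intro CollectI conjI ballI)
    show "x \<in> span (V ` I)" using sp span_mono[OF image_mono[OF assms(2)]] by blast
    fix i assume i: "i \<in> I"
    show "0 \<le> u I i x" "u I i x < 1"
      using i x dual_basis_subset[OF assms sp] by (cases "i \<in> J"; force simp: box_def)+
  qed (use x in \<open>auto simp: box_def\<close>)
  show "u I i x = 0" if "i \<in> I" "i \<notin> J" for i using dual_basis_subset(2)[OF assms sp] that by auto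
next
  fix x assume x: "x \<in> box I" "\<forall>i\<in>I - J. u I i x = 0"
  have sp: "x \<in> span (V ` J)" by (rule in_span_subset[OF assms]) (use x in \<open>auto simp: box_def\<close>)
  have "0 \<le> u J i x \<and> u J i x < 1" if "i \<in> J" for i
    using x(1) that assms(2) unfolding dual_basis_subset(1)[OF assms sp that, symmetric] by (auto simp: box_def)
  thus "x \<in> box J" using x sp by (simp add: box_def)
qed

text \<open>The twist \<open>u J i x\<close> in units of 1/\<open>denom\<close>: adding
  \<open>u J i x\<close> times tau to z multiplies t by Q^p with this p.\<close>

definition pidx :: "'i set \<Rightarrow> 'v \<Rightarrow> 'i \<Rightarrow> nat" where
  "pidx J x i = nat \<lfloor>real denom * u J i x\<rfloor>"

lemma pidx:
  assumes "I \<in> \<T>" "x \<in> box I" "i \<in> I"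
  shows "real (pidx I x i) = real denom * u I i x" "pidx I x i < denom" "pidx I x i = 0 \<longleftrightarrow> u I i x = 0"
proof -
  have x: "x \<in> L" "0 \<le> u I i x" "u I i x < 1" using assms by (auto simp: box_def)
  have "real denom * u I i x \<in> \<int>" by (rule denom[OF assms(1) x(1) assms(3)])
  moreover have "real denom * u I i x \<ge> 0" using x by simp
  ultimately show p: "real (pidx I x i) = real denom * u I i x" by (auto simp: pidx_def)
  have "real denom * u I i x < real denom * 1" using x denom_pos by (intro mult_strict_left_mono) auto
  thus "pidx I x i < denom" using p by simp
  show "pidx I x i = 0 \<longleftrightarrow> u I i x = 0" using p denom_pos
    by (metis less_numeral_extra(3) mult_eq_0_iff of_nat_0 of_nat_eq_iff)
qed

end

locale divisor_fan = edge_fan L n \<Delta> V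
  for L :: "'v::real_vector set" and n :: nat and \<Delta> :: "('i, 'v) multi_fan" and V :: "'i \<Rightarrow> 'v" +
  fixes d :: "'i \<Rightarrow> rat" and \<sigma> :: complex
  assumes complete: "complete_multi_fan n \<Delta>"
    and zeta_neq_1: "\<And>i. i \<in> vertices \<Delta> \<Longrightarrow> zeta_pow \<sigma> (of_rat (d i)) \<noteq> 1"
begin

abbreviation "\<zeta> i \<equiv> zeta_pow \<sigma> (of_rat (d i))"
abbreviation "twist I i x \<equiv> zeta_pow \<sigma> (of_rat (d i) * u I i x)"
abbreviation "rhs \<equiv> rhs_coeff L n \<Delta> V d \<sigma>"
abbreviation "genus r \<equiv> elliptic_genus L n \<Delta> V d r \<sigma>"

lemma zeta_neq_1': "J \<in> \<S> \<Longrightarrow> i \<in> J \<Longrightarrow> \<zeta> i \<noteq> 1"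
  using zeta_neq_1 subset_simplex[of J "{i}"] by (auto simp: vertices_def)

text \<open>As a series in Q, the coefficient of the monomial with exponents \<open>m i\<close> in
  the variables t of the factors, for the summand of I whose h1 has normal representative x, when Im
  w = v.\<close>

definition local_fps :: "'v \<Rightarrow> ('i \<Rightarrow> int) \<Rightarrow> 'i set \<Rightarrow> 'v \<Rightarrow> complex fps" where
  "local_fps v m I x = (\<Prod>i\<in>I. fps_const (twist I i x) *
      mode_fps denom (pidx I x i) (\<zeta> i) (u I i v > 0) (m i))"

text \<open>The coefficient of the character \<open>-\<mu>\<close> as computed with imaginary part
  v. The factor 1/|H_I| of the genus is absent because the sum over h2 cancels it.\<close>

definition genus_coeff :: "'v \<Rightarrow> ('v \<Rightarrow> real) \<Rightarrow> complex fps" where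
  "genus_coeff v \<mu> = (\<Sum>I\<in>\<T>. fps_const (of_int (weight \<Delta> I)) *
     (\<Sum>x\<in>box I. local_fps v (\<lambda>i. int_pairing \<mu> (V i)) I x))"

text \<open>A factor has a subtracted 1 exactly if its twist is trivial and
  \<open>u I i v > 0\<close>. Choosing this term at all vertices outside J therefore restricts x to
  \<open>box J\<close> and I to the simplices whose projected cone contains the image of v. The sum
  over these I is the degree of the projection, and x then runs over H_J. Substituting
  Q^\<open>denom\<close> for q makes both sides comparable.\<close>

lemma genus_coeff_fls:
  assumes v: "generic v" and \<mu>: "\<mu> \<in> dual_lattice L"
  shows "fps_to_fls (genus_coeff v \<mu>) = fls_compose_power (rhs \<mu>) denom"
proof -
  define m where "m = (\<lambda>i. int_pairing \<mu> (V i))"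
  define X where "X = (\<lambda>i. fls_X_intpow i :: complex fls)"
  define G where "G = (\<lambda>i. 1 / (1 - fls_const (\<zeta> i) * X (int denom * m i)))"
  define c where "c = (\<lambda>J x i. fls_const (twist J i x) * X (int (pidx J x i) * m i))"
  define t where "t = (\<lambda>J x. \<Prod>i\<in>J. c J x i * G i)"
  define P where "P = (\<lambda>I J. \<forall>i\<in>I - J. u I i v > 0)"
  define s where "s = (\<lambda>J. (-1) ^ (n - card J) * (\<Sum>x\<in>box J. t J x))"
  let ?Y = "\<lambda>I x J. if P I J \<and> (\<forall>i\<in>I - J. u I i x = 0) then (-1) ^ (n - card J) * t J x else 0"
  let ?e = "\<lambda>I x i. if u I i x = 0 \<and> u I i v > 0 then -1 else 0 :: complex fls"
  let ?A = "\<lambda>J h k. fls_compose_power (fls_const ((-1) ^ (n - k) * of_int (proj_degree n \<Delta> J) * zeta_pow \<sigma> (f_xi V d J h)) *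
    fls_X_intpow (int_pairing \<mu> (v_vec V J h)) *
    (\<Prod>i\<in>J. 1 / (1 - fls_const (\<zeta> i) * fls_X_intpow (int_pairing \<mu> (V i))))) denom"
  have M: "denom > 0" by (rule denom_pos)
  have mi: "int_pairing \<mu> (V i) = m i" for i by (simp add: m_def)
  have local_eq: "fps_to_fls (local_fps v m I x) =
      (\<Sum>J\<in>Pow I. ?Y I x J)"
    if I: "I \<in> \<T>" and x: "x \<in> box I" for I x
  proof -
    note I' = topD[OF I]
    have "fps_to_fls (local_fps v m I x) = (\<Prod>i\<in>I. c I x i * G i + ?e I x i)"
      unfolding local_fps_def fps_to_fls_prod fls_times_fps_to_fls
    proof (rule prod.cong[OF refl])
      fix i assume i: "i \<in> I"
      note p = pidx[OF I x i]
      have "fps_to_fls (mode_fps denom (pidx I x i) (\<zeta> i) (u I i v > 0) (m i)) =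
        X (int (pidx I x i) * m i) * (G i - (if pidx I x i = 0 \<and> u I i v > 0 then 1 else 0))"
        unfolding X_def G_def using p(2) zeta_neq_1'[OF I'(1) i] by (intro mode_fps_fls) auto
      moreover have "c I x i = 1" if "u I i x = 0"
        using that p(3) by (simp add: c_def X_def)
      moreover have "c I x i = fls_const (twist I i x) * X (int (pidx I x i) * m i)" by (simp add: c_def)
      ultimately show "fps_to_fls (fps_const (twist I i x)) *
        fps_to_fls (mode_fps denom (pidx I x i) (\<zeta> i) (u I i v > 0) (m i)) =
        c I x i * G i + ?e I x i"
        using p(3) by (auto simp: right_diff_distrib mult.assoc)
    qed
    also have "\<dots> = (\<Sum>J\<in>Pow I. (\<Prod>i\<in>J. c I x i * G i) * (\<Prod>i\<in>I - J. ?e I x i))"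
      by (rule prod_add[OF I'(3)])
    also have "\<dots> = (\<Sum>J\<in>Pow I. ?Y I x J)"
    proof (rule sum.cong[OF refl])
      fix J assume "J \<in> Pow I"
      hence J: "J \<subseteq> I" by simp
      show "(\<Prod>i\<in>J. c I x i * G i) * (\<Prod>i\<in>I - J. ?e I x i) =
        (?Y I x J)"
      proof (cases "P I J \<and> (\<forall>i\<in>I - J. u I i x = 0)")
        case True
        have "x \<in> box J" using box_subset[OF I'(1) J] x True by auto
        hence sp: "x \<in> span (V ` J)" by (simp add: box_def)
        have "c I x i = c J x i" if "i \<in> J" for i
          using dual_basis_subset(1)[OF I'(1) J sp that] by (simp add: c_def pidx_def)
        hence "(\<Prod>i\<in>J. c I x i * G i) = t J x" by (simp add: t_def)
        moreover have "(\<Prod>i\<in>I - J. ?e I x i) = (\<Prod>i\<in>I - J. -1)"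
          using True by (intro prod.cong) (auto simp: P_def)
        moreover have "card (I - J) = n - card J" using I' J by (simp add: card_Diff_subset finite_subset)
        ultimately show ?thesis using True by simp
      next
        case False
        then obtain i where "i \<in> I - J" "\<not> (u I i x = 0 \<and> u I i v > 0)" by (auto simp: P_def)
        hence "(\<Prod>i\<in>I - J. ?e I x i) = 0"
          using I'(3) by (intro prod_zero) auto
        thus ?thesis unfolding if_not_P[OF False] by simp
      qed
    qed
    finally show ?thesis .
  qed
  have sum_local: "(\<Sum>x\<in>box I. fps_to_fls (local_fps v m I x)) =
     (\<Sum>J\<in>Pow I. if P I J then s J else 0)" if I: "I \<in> \<T>" for I
  proof -
    note I' = topD[OF I]
    have "(\<Sum>x\<in>box I. fps_to_fls (local_fps v m I x)) =
      (\<Sum>J\<in>Pow I. \<Sum>x\<in>box I. ?Y I x J)"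
      by (subst sum.swap) (intro sum.cong refl local_eq I)
    also have "\<dots> = (\<Sum>J\<in>Pow I. if P I J then s J else 0)"
    proof (rule sum.cong[OF refl])
      fix J assume "J \<in> Pow I"
      hence J: "J \<subseteq> I" by simp
      have "(\<Sum>x\<in>box I. ?Y I x J) =
            (\<Sum>x\<in>{x \<in> box I. \<forall>i\<in>I - J. u I i x = 0}. if P I J then (-1) ^ (n - card J) * t J x else 0)"
        using finite_box[OF I'(1)] by (intro sum.mono_neutral_cong_right) auto
      thus "(\<Sum>x\<in>box I. ?Y I x J) =
        (if P I J then s J else 0)"
        unfolding box_subset[OF I'(1) J, symmetric] by (simp add: sum_distrib_left s_def)
    qed
    finally show ?thesis .
  qed
  have "fps_to_fls (genus_coeff v \<mu>) = (\<Sum>I\<in>\<T>. fls_const (of_int (weight \<Delta> I)) * (\<Sum>x\<in>box I. fps_to_fls (local_fps v m I x)))"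
    unfolding genus_coeff_def m_def [symmetric] fps_to_fls_sum fls_times_fps_to_fls by simp
  also have "\<dots> = (\<Sum>I\<in>\<T>. \<Sum>J\<in>\<S>. if J \<subseteq> I \<and> P I J then of_int (weight \<Delta> I) * s J else 0)"
  proof (rule sum.cong[OF refl])
    fix I assume I: "I \<in> \<T>"
    have "Pow I \<subseteq> \<S>" using subset_simplex[OF topD(1)[OF I]] by auto
    hence "(\<Sum>J\<in>Pow I. if P I J then of_int (weight \<Delta> I) * s J else 0) =
      (\<Sum>J\<in>\<S>. if J \<subseteq> I \<and> P I J then of_int (weight \<Delta> I) * s J else 0)"
      using finite_simplices by (intro sum.mono_neutral_cong_left) auto
    thus "fls_const (of_int (weight \<Delta> I)) * (\<Sum>x\<in>box I. fps_to_fls (local_fps v m I x)) =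
      (\<Sum>J\<in>\<S>. if J \<subseteq> I \<and> P I J then of_int (weight \<Delta> I) * s J else 0)"
      unfolding sum_local[OF I] by (simp add: sum_distrib_left if_distrib fls_of_int [symmetric] cong: if_cong)
  qed
  also have "\<dots> = (\<Sum>J\<in>\<S>. (\<Sum>I\<in>{I\<in>\<T>. J \<subseteq> I \<and> P I J}. of_int (weight \<Delta> I)) * s J)"
    using finite_top by (subst sum.swap) (simp add: sum_distrib_right sum.If_cases Int_def)
  also have "\<dots> = (\<Sum>J\<in>\<S>. of_int (proj_degree n \<Delta> J) * s J)"
    by (intro sum.cong refl) (simp add: proj_degree_eq[OF complete v] P_def)
  finally have lhs: "fps_to_fls (genus_coeff v \<mu>) = (\<Sum>J\<in>\<S>. of_int (proj_degree n \<Delta> J) * s J)" .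
  have term_eq: "?A J h k =
      of_int (proj_degree n \<Delta> J) * ((-1) ^ (n - k) * t J (normal_rep V J h))"
    if J: "J \<in> \<S>" and h: "h \<in> \<H> J" for J h k
  proof -
    define x where "x = normal_rep V J h"
    have x: "x \<in> box J" unfolding x_def by (rule normal_rep(2)[OF J h])
    have xL: "x \<in> L" "x \<in> span (V ` J)" using x by (auto simp: box_def)
    have vv: "v_vec V J h = x" unfolding v_vec_def f_coord_def x_def [symmetric] by (rule dual_basis_sum[OF J xL(2)])
    have G: "fls_compose_power (1 / (1 - fls_const (\<zeta> i) * fls_X_intpow (m i))) denom = G i" if i: "i \<in> J" for i
    proof -
      \<comment> \<open>For \<open>m i = 0\<close> the denominator is the constant 1 - zeta, so it
        is nonzero only because zeta differs from 1.\<close>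
      have "1 - fls_const (\<zeta> i) * fls_X_intpow (m i) \<noteq> 0"
      proof (cases "m i = 0")
        case True
        thus ?thesis using zeta_neq_1'[OF J i] by (simp add: fls_const_eq_1_iff eq_commute[of 1])
      qed (rule one_minus_fls_nonzero)
      from fls_compose_power_inverse[OF M this]
      show ?thesis using M by (simp add: G_def X_def del: fls_compose_power_shift)
    qed
    have int: "\<mu> y \<in> \<int>" if "y \<in> L" for y using \<mu> that by (auto simp: dual_lattice_def)
    \<comment> \<open>A top simplex above J is chosen because \<open>denom\<close> clears the
      denominators of coordinates on top simplices.\<close>
    obtain I where I: "I \<in> \<T>" "J \<subseteq> I" using fan J unfolding simplicial_multi_fan_def by meson
    have xI: "x \<in> box I" using x box_subset[OF topD(1)[OF I(1)] I(2)] by auto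
    have pJ: "real (pidx J x i) = real denom * u J i x" if "i \<in> J" for i
      using pidx(1)[OF I(1) xI, of i] dual_basis_subset(1)[OF topD(1)[OF I(1)] I(2) xL(2) that] that I(2)
      by (auto simp: pidx_def)
    have "real_of_int (int denom * int_pairing \<mu> x) = real denom * \<mu> x"
      using int[OF xL(1)] by (simp add: int_pairing_def)
    also have "\<mu> x = (\<Sum>i\<in>J. of_int (m i) * u J i x)"
      unfolding m_def by (rule dual_lattice_expand[OF \<mu> J xL(2)])
    also have "real denom * \<dots> = (\<Sum>i\<in>J. real (pidx J x i) * real_of_int (m i))"
      unfolding sum_distrib_left by (intro sum.cong refl) (simp add: pJ)
    also have "\<dots> = real_of_int (\<Sum>i\<in>J. int (pidx J x i) * m i)" by simp
    finally have e: "int denom * int_pairing \<mu> x = (\<Sum>i\<in>J. int (pidx J x i) * m i)" by linarith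
    have eq1: "?A J h k =
      fls_const ((-1) ^ (n - k) * of_int (proj_degree n \<Delta> J) * zeta_pow \<sigma> (f_xi V d J h)) *
        X (int denom * int_pairing \<mu> x) * (\<Prod>i\<in>J. G i)"
      unfolding fls_compose_power_mult fls_compose_power_prod[OF M] vv mi
      using G M by (simp add: X_def cong: prod.cong)
    have eq2: "X (int denom * int_pairing \<mu> x) = (\<Prod>i\<in>J. X (int (pidx J x i) * m i))"
      unfolding e X_def by (rule fls_X_intpow_sum)
    have eq3: "zeta_pow \<sigma> (f_xi V d J h) = (\<Prod>i\<in>J. twist J i x)"
      unfolding f_xi_def f_coord_def x_def [symmetric] by (rule zeta_pow_sum)
    have eq4: "fls_const ((-1) ^ (n - k) * of_int (proj_degree n \<Delta> J) * (\<Prod>i\<in>J. twist J i x)) =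
      (-1) ^ (n - k) * of_int (proj_degree n \<Delta> J) * (\<Prod>i\<in>J. fls_const (twist J i x))"
      by (simp add: fls_const_prod fls_const_power fls_of_int [symmetric] flip: fls_const_mult_const)
    show ?thesis
      by (rule trans[OF eq1], unfold eq2 eq3 eq4) (simp add: t_def c_def prod.distrib x_def mult_ac)
  qed
  have inner: "(\<Sum>h\<in>\<H> J. of_int (proj_degree n \<Delta> J) * ((-1) ^ (n - card J) * t J (normal_rep V J h))) =
     of_int (proj_degree n \<Delta> J) * s J" if "J \<in> \<S>" for J
    using sum_H_group[OF that, of "t J"] by (simp add: s_def sum_distrib_left [symmetric])
  have "fls_compose_power (rhs \<mu>) denom =
     (\<Sum>k = 0..n. \<Sum>J\<in>k_simplices \<Delta> k. of_int (proj_degree n \<Delta> J) * s J)"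
    unfolding rhs_coeff_def fls_compose_power_sum
  proof (intro sum.cong refl)
    fix k J assume J: "J \<in> k_simplices \<Delta> k"
    hence J': "J \<in> \<S>" "card J = k" by (auto simp: k_simplices_def)
    show "(\<Sum>h\<in>\<H> J. ?A J h k) =
      of_int (proj_degree n \<Delta> J) * s J"
      using term_eq[OF J'(1), of _ k] inner[OF J'(1)] J'(2) by simp
  qed
  also have "\<dots> = (\<Sum>J\<in>\<S>. of_int (proj_degree n \<Delta> J) * s J)"
    unfolding k_simplices_def using card_simplex
    by (subst sum.group[OF finite_simplices, of "{0..n}" card]) auto
  finally show ?thesis using lhs by simp
qed

end

section \<open>Expansions along \<open>Im \<tau> \<longrightarrow> \<infinity>\<close> and generic points\<close>

lemma finite_line_inter_subspace:
  fixes W :: "'v::real_vector set"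
  assumes "subspace W" "x \<notin> W"
  shows "finite {s. y + s *\<^sub>R x \<in> W}"
proof -
  have "s = t" if "y + s *\<^sub>R x \<in> W" "y + t *\<^sub>R x \<in> W" for s t
  proof (rule ccontr)
    assume "s \<noteq> t"
    have "(y + s *\<^sub>R x) - (y + t *\<^sub>R x) \<in> W" using that by (intro subspace_diff assms)
    hence "(s - t) *\<^sub>R x \<in> W" by (simp add: scaleR_diff_left)
    from subspace_scale[OF assms(1) this, of "1 / (s - t)"] show False
      using \<open>s \<noteq> t\<close> assms(2) by simp
  qed
  hence "{s. y + s *\<^sub>R x \<in> W} = {} \<or> (\<exists>s. {s. y + s *\<^sub>R x \<in> W} = {s})" by blast
  thus ?thesis by auto
qed

text \<open>If x avoids the others but lies in the new subspace W, take y outside W: the line y + s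
  x never meets W and meets each of the others at most once.\<close>

lemma finite_union_subspaces:
  fixes F :: "'v::real_vector set set"
  assumes "finite F" "\<And>W. W \<in> F \<Longrightarrow> subspace W" "\<And>W. W \<in> F \<Longrightarrow> W \<noteq> UNIV"
  shows "\<exists>x. \<forall>W\<in>F. x \<notin> W"
  using assms
proof (induction F rule: finite_induct)
  case (insert W F)
  then obtain x where x: "\<forall>W\<in>F. x \<notin> W" by auto
  obtain y where y: "y \<notin> W" using insert.prems by auto
  show ?case
  proof (cases "x \<in> W")
    case True
    have "finite (\<Union>W\<in>F. {s. y + s *\<^sub>R x \<in> W})"
      using insert x by (intro finite_UN_I finite_line_inter_subspace) auto
    then obtain s :: real where s: "s \<notin> (\<Union>W\<in>F. {s. y + s *\<^sub>R x \<in> W})"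
      using ex_new_if_finite infinite_UNIV_char_0 by blast
    have "y + s *\<^sub>R x \<notin> W"
    proof
      assume "y + s *\<^sub>R x \<in> W"
      moreover have "s *\<^sub>R x \<in> W" using True insert.prems by (intro subspace_scale) auto
      ultimately have "(y + s *\<^sub>R x) - s *\<^sub>R x \<in> W" using insert.prems by (intro subspace_diff) auto
      thus False using y by simp
    qed
    thus ?thesis using s by auto
  qed (use x in auto)
qed auto

lemma finite_avoid_at:
  assumes "finite (A :: real set)"
  shows "eventually (\<lambda>s. s \<notin> A) (at x)"
proof -
  have "open (- (A - {x}))" using assms by (intro open_Compl finite_imp_closed) auto
  thus ?thesis unfolding eventually_at_topological by (intro exI[of _ "- (A - {x})"]) auto
qed

lemma fps_prod_nth_nonzero:
  fixes f :: "'i \<Rightarrow> 'a::comm_ring_1 fps"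
  assumes "finite I" "(\<Prod>i\<in>I. f i) $ K \<noteq> 0" "i \<in> I"
  shows "\<exists>k\<le>K. f i $ k \<noteq> 0"
proof (rule ccontr)
  assume "\<not> ?thesis"
  hence z: "f i $ k = 0" if "k \<le> K" for k using that by blast
  have "(\<Prod>i\<in>I. f i) $ K = (f i * (\<Prod>i\<in>I - {i}. f i)) $ K" using assms by (simp add: prod.remove)
  also have "\<dots> = 0" unfolding fps_mult_nth by (intro sum.neutral ballI) (simp add: z)
  finally show False using assms by simp
qed

text \<open>
  \<open>M\<close> is the common denominator of the fractional powers of \<open>q\<close>: the expansion variable is \<open>q\<^bsup>1/M\<^esup>\<close>.
\<close>

definition expands :: "nat \<Rightarrow> (complex \<Rightarrow> complex) \<Rightarrow> complex fps \<Rightarrow> bool" where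
  "expands M f a \<longleftrightarrow> fps_conv_radius a > 0 \<and>
     eventually (\<lambda>\<tau>. f \<tau> = eval_fps a (e2pi (\<tau> / of_nat M))) cusp"

lemma eventually_less_radius:
  assumes "M > 0" "r > (0 :: ereal)"
  shows "eventually (\<lambda>\<tau>. ereal (norm (e2pi (\<tau> / of_nat M))) < r) cusp"
proof -
  obtain e where e: "0 < ereal e" "ereal e < r" using ereal_dense2[OF assms(2)] by auto
  have "eventually (\<lambda>\<tau>. Im \<tau> > 0 \<and> norm (e2pi (\<tau> / of_nat M)) < e) cusp"
    using e assms by (intro norm_e2pi_small) auto
  thus ?thesis by eventually_elim (use e in \<open>auto intro: less_trans[of _ "ereal e"]\<close>)
qed

lemma expands_const: "expands M (\<lambda>_. c) (fps_const c)"
  by (simp add: expands_def)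

lemma expands_mult:
  assumes "M > 0" "expands M f a" "expands M g b"
  shows "expands M (\<lambda>\<tau>. f \<tau> * g \<tau>) (a * b)"
  unfolding expands_def
proof
  have "min (fps_conv_radius a) (fps_conv_radius b) > 0" using assms by (auto simp: expands_def)
  thus "fps_conv_radius (a * b) > 0" using fps_conv_radius_mult less_le_trans by blast
  have "eventually (\<lambda>\<tau>. ereal (norm (e2pi (\<tau> / of_nat M))) < fps_conv_radius a) cusp"
       "eventually (\<lambda>\<tau>. ereal (norm (e2pi (\<tau> / of_nat M))) < fps_conv_radius b) cusp"
    using assms by (intro eventually_less_radius; simp add: expands_def)+
  moreover have "eventually (\<lambda>\<tau>. f \<tau> = eval_fps a (e2pi (\<tau> / of_nat M))) cusp"
       "eventually (\<lambda>\<tau>. g \<tau> = eval_fps b (e2pi (\<tau> / of_nat M))) cusp"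
    using assms by (auto simp: expands_def)
  ultimately show "eventually (\<lambda>\<tau>. f \<tau> * g \<tau> = eval_fps (a * b) (e2pi (\<tau> / of_nat M))) cusp"
    by eventually_elim (simp add: eval_fps_mult)
qed

lemma expands_add:
  assumes "M > 0" "expands M f a" "expands M g b"
  shows "expands M (\<lambda>\<tau>. f \<tau> + g \<tau>) (a + b)"
  unfolding expands_def
proof
  have "min (fps_conv_radius a) (fps_conv_radius b) > 0" using assms by (auto simp: expands_def)
  thus "fps_conv_radius (a + b) > 0" using fps_conv_radius_add less_le_trans by blast
  have "eventually (\<lambda>\<tau>. ereal (norm (e2pi (\<tau> / of_nat M))) < fps_conv_radius a) cusp"
       "eventually (\<lambda>\<tau>. ereal (norm (e2pi (\<tau> / of_nat M))) < fps_conv_radius b) cusp"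
    using assms by (intro eventually_less_radius; simp add: expands_def)+
  moreover have "eventually (\<lambda>\<tau>. f \<tau> = eval_fps a (e2pi (\<tau> / of_nat M))) cusp"
       "eventually (\<lambda>\<tau>. g \<tau> = eval_fps b (e2pi (\<tau> / of_nat M))) cusp"
    using assms by (auto simp: expands_def)
  ultimately show "eventually (\<lambda>\<tau>. f \<tau> + g \<tau> = eval_fps (a + b) (e2pi (\<tau> / of_nat M))) cusp"
    by eventually_elim (simp add: eval_fps_add)
qed

lemma expands_sum:
  assumes "M > 0" "\<And>x. x \<in> A \<Longrightarrow> expands M (f x) (a x)"
  shows "expands M (\<lambda>\<tau>. \<Sum>x\<in>A. f x \<tau>) (\<Sum>x\<in>A. a x)"
  using assms(2)
  by (induction A rule: infinite_finite_induct)
     (auto intro!: expands_add assms(1) simp: expands_const[of _ 0, simplified])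

lemma expands_prod:
  assumes "M > 0" "\<And>x. x \<in> A \<Longrightarrow> expands M (f x) (a x)"
  shows "expands M (\<lambda>\<tau>. \<Prod>x\<in>A. f x \<tau>) (\<Prod>x\<in>A. a x)"
  using assms(2)
  by (induction A rule: infinite_finite_induct)
     (auto intro!: expands_mult assms(1) simp: expands_const[of _ 1, simplified])

lemma expands_cong:
  assumes "expands M f a" "eventually (\<lambda>\<tau>. f \<tau> = g \<tau>) cusp"
  shows "expands M g a"
  unfolding expands_def
proof
  have "eventually (\<lambda>\<tau>. f \<tau> = eval_fps a (e2pi (\<tau> / of_nat M))) cusp"
    using assms(1) by (simp add: expands_def)
  with assms(2) show "eventually (\<lambda>\<tau>. g \<tau> = eval_fps a (e2pi (\<tau> / of_nat M))) cusp"
    by eventually_elim simp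
qed (use assms(1) in \<open>simp add: expands_def\<close>)

text \<open>Turns a half-plane Im tau >= b into the disc |q| < exp(-2 pi b) that
  \<open>q_expansion\<close> asks for.\<close>

lemma eventually_Im_imp_norm_e2pi:
  assumes "eventually P cusp"
  shows "\<exists>\<epsilon>>0. \<forall>\<tau>. Im \<tau> > 0 \<and> norm (e2pi \<tau>) < \<epsilon> \<longrightarrow> P \<tau>"
proof -
  obtain b where b: "\<And>\<tau>. Im \<tau> \<ge> b \<Longrightarrow> P \<tau>"
    using assms by (auto simp: eventually_filtercomap_at_top_linorder)
  show ?thesis
  proof (intro exI[of _ "exp (- 2 * pi * b)"] conjI allI impI)
    fix \<tau> assume "Im \<tau> > 0 \<and> norm (e2pi \<tau>) < exp (- 2 * pi * b)"
    hence "pi * b < pi * Im \<tau>" by (simp add: norm_e2pi)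
    hence "b < Im \<tau>" using pi_gt_zero by (simp only: mult_less_cancel_left_pos)
    thus "P \<tau>" by (intro b) simp
  qed auto
qed

context edge_fan
begin

lemma span_simplex_neq_UNIV:
  assumes "J \<in> \<S>" "card J < n"
  shows "span (V ` J) \<noteq> UNIV"
proof
  assume s: "span (V ` J) = UNIV"
  have fin: "finite (V ` J)" using finite_simplex[OF assms(1)] by simp
  have "card basis \<le> card (V ` J)"
    using independent_span_bound[OF fin basis(3)] s by auto
  also have "\<dots> \<le> card J" using finite_simplex[OF assms(1)] by (rule card_image_le)
  finally show False using assms(2) basis(2) by simp
qed

lemma generic_exists: "\<exists>v. generic v"
proof -
  have "\<exists>x. \<forall>W\<in>(\<lambda>J. span (V ` J)) ` {J \<in> \<S>. card J < n}. x \<notin> W"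
    by (rule finite_union_subspaces) (use finite_simplices span_simplex_neq_UNIV in \<open>auto simp: subspace_span\<close>)
  thus ?thesis by (auto simp: generic_def)
qed

lemma finite_nongeneric_line:
  assumes "generic v"
  shows "finite {s. \<not> generic (y + s *\<^sub>R v)}"
proof (rule finite_subset)
  show "{s. \<not> generic (y + s *\<^sub>R v)} \<subseteq> (\<Union>J\<in>{J \<in> \<S>. card J < n}. {s. y + s *\<^sub>R v \<in> span (V ` J)})"
    by (auto simp: generic_def)
  show "finite (\<Union>J\<in>{J \<in> \<S>. card J < n}. {s. y + s *\<^sub>R v \<in> span (V ` J)})"
    using finite_simplices assms
    by (intro finite_UN_I finite_line_inter_subspace subspace_span) (auto simp: generic_def)
qed

lemma generic_uminus: "generic v \<Longrightarrow> generic (- v)"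
  using span_neg by (force simp: generic_def)

text \<open>A generic e + t v with t nonzero is found on the line through e and rescaled by 1/t.
  Bounds for a functional at v and at v + s e then bound its value at e.\<close>

lemma generic_perturb:
  assumes "generic v"
  shows "\<exists>s\<noteq>0. generic (v + s *\<^sub>R e)"
proof -
  have "finite (insert 0 {t. \<not> generic (e + t *\<^sub>R v)})" using finite_nongeneric_line[OF assms] by simp
  then obtain t :: real where t: "t \<noteq> 0" "generic (e + t *\<^sub>R v)"
    using ex_new_if_finite infinite_UNIV_char_0 by (metis insertCI mem_Collect_eq)
  have "generic (v + (1 / t) *\<^sub>R e)"
    unfolding generic_def
  proof (intro ballI impI notI)
    fix J assume J: "J \<in> \<S>" "card J < n" "v + (1 / t) *\<^sub>R e \<in> span (V ` J)"
    from span_scale[OF J(3), of t] have "e + t *\<^sub>R v \<in> span (V ` J)" using t by (simp add: scaleR_add_right add.commute)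
    thus False using t J by (auto simp: generic_def)
  qed
  thus ?thesis using t by (intro exI[of _ "1 / t"]) simp
qed

lemma cpairing_add: "linear f \<Longrightarrow> cpairing f (w + w') = cpairing f w + cpairing f w'"
  by (simp add: cpairing_def linear_add complex_eq_iff)

lemma cpairing_diff: "linear f \<Longrightarrow> cpairing f (w - w') = cpairing f w - cpairing f w'"
  by (simp add: cpairing_def linear_diff complex_eq_iff)

lemma cpairing_cscale: "linear f \<Longrightarrow> cpairing f (cscale c x) = c * of_real (f x)"
  by (simp add: cpairing_def cscale_def linear_scale complex_eq_iff)

text \<open>The value at \<open>(w, y)\<close> of the variable \<open>t\<close> of the factor indexed by \<open>i\<close>.\<close>

definition tval :: "'i set \<Rightarrow> 'i \<Rightarrow> 'v \<times> 'v \<Rightarrow> 'v \<Rightarrow> complex" where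
  "tval I i w y = e2pi (- cpairing (u I i) w - of_real (u I i y))"

lemma tval_nonzero [simp]: "tval I i w y \<noteq> 0"
  by (simp add: tval_def)

text \<open>So |t| > 1 exactly if \<open>u I i\<close> is positive on the imaginary part of w: this
  expresses the flag \<open>b\<close> of \<open>mode_fps\<close> through v.\<close>

lemma norm_tval: "norm (tval I i w y) = exp (2 * pi * u I i (snd w))"
  by (simp add: tval_def norm_e2pi cpairing_def)

lemma tval_neq_1:
  assumes "I \<in> \<T>" "i \<in> I" "w \<in> regular" "y \<in> L"
  shows "tval I i w y \<noteq> 1"
proof -
  note lin = linear_dual_basis[OF assms(1), of i]
  have "cpairing (u I i) (w + cscale 1 y) \<notin> \<int>" using assms by (auto simp: regular_points_def)
  hence "cpairing (u I i) w + of_real (u I i y) \<notin> \<int>" by (simp add: cpairing_add[OF lin] cpairing_cscale[OF lin])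
  hence "- (cpairing (u I i) w + of_real (u I i y)) \<notin> \<int>" by (metis Ints_minus minus_minus)
  thus ?thesis by (simp add: tval_def e2pi_eq_1_iff)
qed

lemma tendsto_tval:
  assumes "I \<in> \<T>"
  shows "((\<lambda>s. tval I i (fst w, snd w + s *\<^sub>R g) y) \<longlongrightarrow> tval I i w y) (at 0)"
proof -
  note lin = linear_dual_basis[OF assms, of i]
  have "cpairing (u I i) (fst w, snd w + s *\<^sub>R g) = cpairing (u I i) w + \<i> * of_real (s * u I i g)" for s
    by (simp add: cpairing_def linear_add[OF lin] linear_scale[OF lin] complex_eq_iff)
  hence "tval I i (fst w, snd w + s *\<^sub>R g) y =
     e2pi (- (cpairing (u I i) w + \<i> * of_real (s * u I i g)) - of_real (u I i y))" for s
    by (simp add: tval_def)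
  moreover have "((\<lambda>s. e2pi (- (cpairing (u I i) w + \<i> * of_real (s * u I i g)) - of_real (u I i y))) \<longlongrightarrow>
     e2pi (- (cpairing (u I i) w + \<i> * of_real (0 * u I i g)) - of_real (u I i y))) (at 0)"
    unfolding e2pi_def by (intro tendsto_intros)
  ultimately show ?thesis by (simp add: tval_def)
qed

lemma tendsto_character:
  assumes "linear m"
  shows "((\<lambda>s. character m (fst w, snd w + s *\<^sub>R g)) \<longlongrightarrow> character m w) (at 0)"
proof -
  have "cpairing m (fst w, snd w + s *\<^sub>R g) = cpairing m w + \<i> * of_real (s * m g)" for s
    by (simp add: cpairing_def linear_add[OF assms] linear_scale[OF assms] complex_eq_iff)
  moreover have "((\<lambda>s. e2pi (cpairing m w + \<i> * of_real (s * m g))) \<longlongrightarrow> e2pi (cpairing m w + \<i> * of_real (0 * m g))) (at 0)"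
    unfolding e2pi_def by (intro tendsto_intros)
  ultimately show ?thesis by (simp add: character_def)
qed

text \<open>The edge vectors of a top simplex span, so an element of the dual lattice is determined
  by its integers on them; conversely a tuple of integers defines a form that may fail to be
  integral on L. This turns sums over modes into sums over characters.\<close>

lemma dual_lattice_bij:
  assumes I: "I \<in> \<T>"
  shows "bij_betw (\<lambda>\<mu>. restrict (\<lambda>i. int_pairing \<mu> (V i)) I) (dual_lattice L)
     {m \<in> PiE I (\<lambda>_. UNIV). form I m ` L \<subseteq> \<int>}"
    (is "bij_betw ?R _ ?D")
proof (rule bij_betwI[where g = "\<lambda>m x. \<Sum>i\<in>I. of_int (m i) * u I i x"])
  note I' = topD[OF I]
  have sp: "x \<in> span (V ` I)" for x using span_top[OF I] by simp
  have eq: "(\<lambda>x. \<Sum>i\<in>I. of_int (?R \<mu> i) * u I i x) = \<mu>"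
    if \<mu>: "\<mu> \<in> dual_lattice L" for \<mu>
    using dual_lattice_expand[OF \<mu> I'(1) sp] by (simp add: fun_eq_iff)
  show "?R \<in> dual_lattice L \<rightarrow>
     ?D"
  proof
    fix \<mu> assume \<mu>: "\<mu> \<in> dual_lattice L"
    show "?R \<mu> \<in> ?D"
      unfolding mem_Collect_eq eq[OF \<mu>] using \<mu> by (auto simp: dual_lattice_def)
  qed
  show "(\<lambda>m x. \<Sum>i\<in>I. of_int (m i) * u I i x) \<in>
     ?D \<rightarrow> dual_lattice L"
  proof
    fix m assume m: "m \<in> ?D"
    have "linear (form I m)"
      by (rule linearI)
         (simp_all add: linear_add[OF linear_dual_basis[OF I]] linear_scale[OF linear_dual_basis[OF I]]
            ring_distribs sum.distrib sum_distrib_left mult_ac)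
    thus "form I m \<in> dual_lattice L" using m by (auto simp: dual_lattice_def)
  qed
  show "(\<lambda>x. \<Sum>i\<in>I. of_int (?R \<mu> i) * u I i x) = \<mu>" if "\<mu> \<in> dual_lattice L" for \<mu>
    by (rule eq[OF that])
  show "restrict (\<lambda>i. int_pairing (form I m) (V i)) I = m"
    if m: "m \<in> ?D" for m
  proof
    fix i
    have "(\<Sum>j\<in>I. of_int (m j) * u I j (V i)) = of_int (m i)" if "i \<in> I"
    proof -
      have "(\<Sum>j\<in>I. of_int (m j) * u I j (V i)) = (\<Sum>j\<in>I. of_int (m j) * (if j = i then 1 else 0))"
        using dual_basis_V[OF I'(1) _ that] by (intro sum.cong refl) simp
      thus ?thesis using that I' by (simp add: if_distrib cong: if_cong)
    qed
    thus "restrict (\<lambda>i. int_pairing (form I m) (V i)) I i = m i"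
      using m by (auto simp: int_pairing_def PiE_def extensional_def)
  qed
qed

end

section \<open>The expansion of the genus\<close>

lemma of_real_of_rat: "of_real (of_rat a) = (of_rat a :: complex)"
  by (cases a) (simp add: of_rat_rat)

context divisor_fan
begin

definition point_fps :: "'i set \<Rightarrow> 'v \<Rightarrow> 'v \<times> 'v \<Rightarrow> 'v \<Rightarrow> complex fps" where
  "point_fps I x w y = (\<Prod>i\<in>I. fps_const (twist I i x) *
     factor_fps denom (pidx I x i) (\<zeta> i) (tval I i w y))"

text \<open>h1 enters through its normal representative, which keeps the index p below
  \<open>denom\<close>. h2 enters through the given choice \<open>r\<close>, as it only multiplies t
  by a number of modulus 1.\<close>

definition genus_fps :: "('i set \<Rightarrow> 'v set \<Rightarrow> 'v) \<Rightarrow> 'v \<times> 'v \<Rightarrow> complex fps" where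
  "genus_fps r w = (\<Sum>I\<in>\<T>. fps_const (of_int (weight \<Delta> I) / of_nat (card (\<H> I))) *
     (\<Sum>(h1, h2)\<in>\<H> I \<times> \<H> I. point_fps I (normal_rep V I h1) w (r I h2)))"

lemma genus_fps_nth: "genus_fps r w $ K = (\<Sum>I\<in>\<T>. of_int (weight \<Delta> I) / of_nat (card (\<H> I)) *
     (\<Sum>(h1, h2)\<in>\<H> I \<times> \<H> I. point_fps I (normal_rep V I h1) w (r I h2)) $ K)"
  by (subst genus_fps_def, subst fps_sum_nth) (simp only: fps_mult_left_const_nth)

text \<open>The given representative \<open>y1\<close> differs from the normal one by an integer k
  in the coordinate i. Quasi-periodicity turns this into the multiplier zeta^(-d k), and the leading
  power of zeta changes by the inverse amount.\<close>

lemma factor_expands: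
  assumes I: "I \<in> \<T>" and i: "i \<in> I" and h1: "h1 \<in> \<H> I" and y1: "y1 \<in> h1" and y2: "y2 \<in> L"
    and w: "w \<in> regular"
  defines "x \<equiv> normal_rep V I h1"
  shows "expands denom (\<lambda>\<tau>. twist I i y1 *
           phi_st (cpairing (u I i) (- w + cscale \<tau> y1 - cscale 1 y2)) \<tau> (of_rat (d i) * \<sigma>))
     (fps_const (twist I i x) * factor_fps denom (pidx I x i) (\<zeta> i) (tval I i w y2))"
proof (rule expands_cong)
  note I' = topD[OF I] and lin = linear_dual_basis[OF I, of i]
  note nr = normal_rep[OF I'(1) h1, folded x_def]
  note p = pidx[OF I nr(2) i]
  define z where "z = - cpairing (u I i) w - of_real (u I i y2)"
  define s where "s = of_rat (d i) * \<sigma>"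
  have zeta: "e2pi s = \<zeta> i" by (simp add: s_def zeta_pow_def of_real_of_rat)
  have t: "e2pi z = tval I i w y2" by (simp add: z_def tval_def)
  have ne: "e2pi z \<noteq> 1" unfolding t by (rule tval_neq_1[OF I i w y2])
  have ph: "expands denom (\<lambda>\<tau>. phi_st (z + of_nat (pidx I x i) * \<tau> / of_nat denom) \<tau> s)
     (factor_fps denom (pidx I x i) (\<zeta> i) (tval I i w y2))"
    unfolding expands_def using phi_st_expansion[OF p(2), of s z] zeta_neq_1'[OF I'(1) i] ne by (simp add: zeta t)
  show "expands denom (\<lambda>\<tau>. twist I i x * phi_st (z + of_nat (pidx I x i) * \<tau> / of_nat denom) \<tau> s)
     (fps_const (twist I i x) * factor_fps denom (pidx I x i) (\<zeta> i) (tval I i w y2))"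
    by (intro expands_mult expands_const ph denom_pos)
  obtain k where k: "u I i y1 = u I i x + of_int k"
    using nr(3)[OF y1 i] by (metis Ints_cases add.commute diff_add_cancel)
  have "eventually (\<lambda>\<tau>. Im \<tau> > 0 \<and> norm (e2pi (\<tau> / of_nat denom)) < 1) cusp"
    by (rule norm_e2pi_small) (auto simp: denom_pos)
  thus "eventually (\<lambda>\<tau>. twist I i x * phi_st (z + of_nat (pidx I x i) * \<tau> / of_nat denom) \<tau> s =
     twist I i y1 *
           phi_st (cpairing (u I i) (- w + cscale \<tau> y1 - cscale 1 y2)) \<tau> (of_rat (d i) * \<sigma>)) cusp"
  proof eventually_elim
    case (elim \<tau>)
    have px: "of_nat (pidx I x i) = of_nat denom * complex_of_real (u I i x)"
      using arg_cong[OF p(1), of complex_of_real] by simp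
    hence ux: "of_nat (pidx I x i) * \<tau> / of_nat denom = of_real (u I i x) * \<tau>"
      using denom_pos by simp
    have "cpairing (u I i) (- w + cscale \<tau> y1 - cscale 1 y2) =
      (z + of_real (u I i x) * \<tau>) + of_int k * \<tau>"
      by (simp add: cpairing_diff[OF lin] cpairing_add[OF lin] cpairing_cscale[OF lin] z_def k algebra_simps)
    hence "phi_st (cpairing (u I i) (- w + cscale \<tau> y1 - cscale 1 y2)) \<tau> s =
      e2pi (- of_int k * s) * phi_st (z + of_real (u I i x) * \<tau>) \<tau> s"
      using phi_st_shift[of \<tau>] elim by simp
    moreover have "twist I i y1 = twist I i x * e2pi (of_int k * s)"
      unfolding zeta_pow_def e2pi_add [symmetric] by (rule arg_cong[of _ _ e2pi]) (simp add: k s_def of_real_of_rat algebra_simps)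
    moreover have "e2pi (of_int k * s) * e2pi (- of_int k * s) = 1"
      unfolding e2pi_add [symmetric] by simp
    ultimately show ?case unfolding ux s_def [symmetric] by (simp add: mult.assoc)
  qed
qed

lemma genus_expands:
  assumes r: "\<And>I h. I \<in> \<T> \<Longrightarrow> h \<in> \<H> I \<Longrightarrow> r I h \<in> h"
    and w: "w \<in> regular"
  shows "expands denom (\<lambda>\<tau>. genus r \<tau> w) (genus_fps r w)"
proof -
  have rL: "r I h \<in> L" if "I \<in> \<T>" "h \<in> \<H> I" for I h
    using normal_rep(4)[OF topD(1) _ r] that by blast
  show ?thesis
    unfolding elliptic_genus_def genus_fps_def point_fps_def case_prod_unfold
    by (intro expands_sum expands_mult expands_const expands_prod denom_pos factor_expands r w rL) auto
qed

lemma point_fps_has_sum: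
  assumes I: "I \<in> \<T>" and x: "x \<in> box I" and v: "generic (snd w)"
  shows "((\<lambda>m. (\<Prod>i\<in>I. tval I i w y powi m i) * local_fps (snd w) m I x $ K) has_sum point_fps I x w y $ K) (PiE I (\<lambda>_. UNIV))"
proof -
  let ?f = "\<lambda>i m. fps_const (twist I i x) * (fps_const (tval I i w y powi m) *
      mode_fps denom (pidx I x i) (\<zeta> i) (u I i (snd w) > 0) m)"
  note I' = topD[OF I]
  have "((\<lambda>m. (\<Prod>i\<in>I. ?f i (m i)) $ K) has_sum point_fps I x w y $ K) (PiE I (\<lambda>_. UNIV))"
    unfolding point_fps_def
  proof (rule has_sum_fps_prod[OF I'(3)])
    fix i K assume i: "i \<in> I"
    note p = pidx[OF I x i]
    have "u I i (snd w) \<noteq> 0" by (rule generic_dual_basis_nonzero[OF v I i])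
    hence "((\<lambda>m. (fps_const (tval I i w y powi m) * mode_fps denom (pidx I x i) (\<zeta> i) (u I i (snd w) > 0) m) $ K)
       has_sum factor_fps denom (pidx I x i) (\<zeta> i) (tval I i w y) $ K) UNIV"
      using p(2) by (intro mode_fps_has_sum) (auto simp: norm_tval zero_less_mult_iff)
    from has_sum_cmult_right[OF this, of "twist I i x"]
    show "((\<lambda>m. ?f i m $ K) has_sum
      (fps_const (twist I i x) * factor_fps denom (pidx I x i) (\<zeta> i) (tval I i w y)) $ K) UNIV"
      by simp
  qed
  also have "(\<lambda>m. (\<Prod>i\<in>I. ?f i (m i)) $ K) =
    (\<lambda>m. (\<Prod>i\<in>I. tval I i w y powi m i) * local_fps (snd w) m I x $ K)"
  proof
    fix m :: "'i \<Rightarrow> int"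
    have c: "(\<Prod>i\<in>A. fps_const (tval I i w y powi m i)) = fps_const (\<Prod>i\<in>A. tval I i w y powi m i)" for A
      by (induction A rule: infinite_finite_induct) simp_all
    have "(\<Prod>i\<in>I. ?f i (m i)) =
      (\<Prod>i\<in>I. fps_const (tval I i w y powi m i)) * local_fps (snd w) m I x"
      unfolding local_fps_def prod.distrib [symmetric] by (intro prod.cong refl) (simp only: mult_ac)
    thus "(\<Prod>i\<in>I. ?f i (m i)) $ K =
      (\<Prod>i\<in>I. tval I i w y powi m i) * local_fps (snd w) m I x $ K"
      unfolding c by simp
  qed
  finally show ?thesis .
qed

text \<open>For integral exponents the product depends only on the class of \<open>r h\<close>, so
  the sum may be taken over the box, where orthogonality applies. Here the characters outside the
  dual lattice disappear.\<close>

lemma sum_tval: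
  assumes I: "I \<in> \<T>" and r: "\<And>h. h \<in> \<H> I \<Longrightarrow> r h \<in> h"
  shows "(\<Sum>h\<in>\<H> I. \<Prod>i\<in>I. tval I i w (r h) powi m i) =
    (if form I m ` L \<subseteq> \<int>
     then of_nat (card (\<H> I)) * e2pi (- (\<Sum>i\<in>I. of_int (m i) * cpairing (u I i) w)) else 0)"
proof -
  note I' = topD[OF I]
  define \<mu> where "\<mu> = form I m"
  define A where "A = e2pi (- (\<Sum>i\<in>I. of_int (m i) * cpairing (u I i) w))"
  have "(\<Prod>i\<in>I. tval I i w (r h) powi m i) = A * e2pi (- of_real (\<mu> (normal_rep V I h)))"
    if h: "h \<in> \<H> I" for h
  proof -
    note nr = normal_rep(3)[OF I'(1) h r[OF h]]
    have "(\<Prod>i\<in>I. tval I i w (r h) powi m i) = e2pi (\<Sum>i\<in>I. of_int (m i) * (- cpairing (u I i) w - of_real (u I i (r h))))"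
      unfolding tval_def e2pi_of_int [symmetric] e2pi_sum ..
    also have "(\<Sum>i\<in>I. of_int (m i) * (- cpairing (u I i) w - of_real (u I i (r h)))) =
       - (\<Sum>i\<in>I. of_int (m i) * cpairing (u I i) w) + - of_real (\<mu> (r h))"
      by (simp add: \<mu>_def sum_negf sum_subtractf right_diff_distrib)
    also have "e2pi \<dots> = A * e2pi (- of_real (\<mu> (r h)))" by (simp only: e2pi_add A_def)
    also have "e2pi (- of_real (\<mu> (r h))) = e2pi (- of_real (\<mu> (normal_rep V I h)))"
    proof -
      have "\<mu> (r h) - \<mu> (normal_rep V I h) = (\<Sum>i\<in>I. of_int (m i) * (u I i (r h) - u I i (normal_rep V I h)))"
        by (simp add: \<mu>_def sum_subtractf right_diff_distrib)
      also have "\<dots> \<in> \<int>" using nr by (intro Ints_sum Ints_mult) auto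
      finally obtain k where "\<mu> (r h) - \<mu> (normal_rep V I h) = of_int k" by (rule Ints_cases)
      hence "\<mu> (r h) = \<mu> (normal_rep V I h) + of_int k" by simp
      hence "- complex_of_real (\<mu> (r h)) = - of_real (\<mu> (normal_rep V I h)) + of_int (- k)" by simp
      hence "e2pi (- of_real (\<mu> (r h))) = e2pi (- of_real (\<mu> (normal_rep V I h))) * e2pi (of_int (- k))"
        by (simp only: e2pi_add)
      moreover have "e2pi (of_int (- k)) = 1" unfolding e2pi_eq_1_iff by (rule Ints_of_int)
      ultimately show ?thesis by simp
    qed
    finally show ?thesis .
  qed
  hence "(\<Sum>h\<in>\<H> I. \<Prod>i\<in>I. tval I i w (r h) powi m i) =
     (\<Sum>h\<in>\<H> I. A * e2pi (- of_real (\<mu> (normal_rep V I h))))" by simp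
  also have "\<dots> = A * (\<Sum>x\<in>box I. e2pi (- of_real (\<mu> x)))"
    unfolding sum_distrib_left by (rule sum_H_group[OF I'(1)])
  also have "(\<Sum>x\<in>box I. e2pi (- of_real (\<mu> x))) = (if \<mu> ` L \<subseteq> \<int> then of_nat (card (box I)) else 0)"
    unfolding \<mu>_def by (rule character_orthogonality[OF I])
  finally show ?thesis by (simp add: \<mu>_def A_def card_H_group[OF I'(1)])
qed

lemma character_eq:
  assumes I: "I \<in> \<T>" and \<mu>: "\<mu> \<in> dual_lattice L"
  shows "character (\<lambda>x. - \<mu> x) w = e2pi (- (\<Sum>i\<in>I. of_int (int_pairing \<mu> (V i)) * cpairing (u I i) w))"
proof -
  have "\<mu> x = (\<Sum>i\<in>I. of_int (int_pairing \<mu> (V i)) * u I i x)" for x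
    by (rule dual_lattice_expand[OF \<mu> topD(1)[OF I]]) (simp add: span_top[OF I])
  hence "cpairing (\<lambda>x. - \<mu> x) w = - (\<Sum>i\<in>I. of_int (int_pairing \<mu> (V i)) * cpairing (u I i) w)"
    by (simp add: cpairing_def complex_eq_iff sum_negf)
  thus ?thesis by (simp add: character_def)
qed

text \<open>In each degree the sum over mode tuples of a top simplex is reindexed by the dual
  lattice. The other tuples vanish in the sum over h2, whose value on the remaining ones contains
  the factor |H_I| that cancels the denominator.\<close>

lemma genus_fps_has_sum:
  assumes r: "\<And>I h. I \<in> \<T> \<Longrightarrow> h \<in> \<H> I \<Longrightarrow> r I h \<in> h" and v: "generic (snd w)"
  shows "((\<lambda>\<mu>. character (\<lambda>x. - \<mu> x) w * genus_coeff (snd w) \<mu> $ K) has_sum genus_fps r w $ K) (dual_lattice L)"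
proof -
  let ?P = "\<lambda>I x. \<Sum>h\<in>\<H> I. point_fps I x w (r I h) $ K"
  let ?\<chi> = "\<lambda>\<mu>. character (\<lambda>x. - \<mu> x) w"
  define m where "m = (\<lambda>\<mu> i. int_pairing \<mu> (V i))"
  have top_sum: "((\<lambda>\<mu>. ?\<chi> \<mu> * local_fps (snd w) (m \<mu>) I x $ K) has_sum
     ?P I x / of_nat (card (\<H> I))) (dual_lattice L)"
    if I: "I \<in> \<T>" and x: "x \<in> box I" for I x
  proof -
    note I' = topD[OF I]
    let ?N = "of_nat (card (\<H> I)) :: complex"
    let ?D = "{m \<in> PiE I (\<lambda>_. UNIV). form I m ` L \<subseteq> \<int>}"
    let ?e = "\<lambda>m. e2pi (- (\<Sum>i\<in>I. of_int (m i) * cpairing (u I i) w))"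
    let ?T = "\<lambda>m. \<Sum>h\<in>\<H> I. (\<Prod>i\<in>I. tval I i w (r I h) powi m i) * local_fps (snd w) m I x $ K"
    have N: "?N \<noteq> 0" using card_box_pos[OF I'(1)] card_H_group[OF I'(1)] by simp
    have "((\<lambda>m. ?T m / ?N) has_sum
      ?P I x / ?N) (PiE I (\<lambda>_. UNIV))"
      by (intro has_sum_divide_const has_sum_finite_sum point_fps_has_sum I x v)
    also have "?this \<longleftrightarrow> ((\<lambda>m. ?e m * local_fps (snd w) m I x $ K) has_sum
      ?P I x / ?N) ?D"
    proof (rule has_sum_cong_neutral)
      fix m assume "m \<in> PiE I (\<lambda>_. UNIV) - ?D"
      thus "?T m / ?N = 0"
        unfolding sum_distrib_right [symmetric] using sum_tval[OF I r[OF I], of w m] by auto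
    next
      fix m assume "m \<in> PiE I (\<lambda>_. UNIV) \<inter> ?D"
      thus "?T m / ?N =
        ?e m * local_fps (snd w) m I x $ K"
        unfolding sum_distrib_right [symmetric] using sum_tval[OF I r[OF I], of w m] N by auto
    qed auto
    also have "\<dots> \<longleftrightarrow> ((\<lambda>\<mu>. ?e (restrict (m \<mu>) I) * local_fps (snd w) (restrict (m \<mu>) I) I x $ K) has_sum
      ?P I x / ?N) (dual_lattice L)"
      unfolding m_def by (rule has_sum_reindex_bij_betw[OF dual_lattice_bij[OF I], symmetric])
    also have "\<dots> \<longleftrightarrow> ((\<lambda>\<mu>. ?\<chi> \<mu> * local_fps (snd w) (m \<mu>) I x $ K) has_sum
      ?P I x / ?N) (dual_lattice L)"
    proof (rule has_sum_cong)
      fix \<mu> assume \<mu>: "\<mu> \<in> dual_lattice L"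
      have "local_fps (snd w) (restrict (m \<mu>) I) I x = local_fps (snd w) (m \<mu>) I x"
        unfolding local_fps_def by (intro prod.cong refl) auto
      moreover have "?e (restrict (m \<mu>) I) = ?\<chi> \<mu>"
        unfolding character_eq[OF I \<mu>] by (simp add: m_def cong: sum.cong)
      ultimately show "?e (restrict (m \<mu>) I) * local_fps (snd w) (restrict (m \<mu>) I) I x $ K =
        ?\<chi> \<mu> * local_fps (snd w) (m \<mu>) I x $ K" by simp
    qed
    finally show ?thesis .
  qed
  have "((\<lambda>\<mu>. \<Sum>I\<in>\<T>. of_int (weight \<Delta> I) * (\<Sum>x\<in>box I. ?\<chi> \<mu> * local_fps (snd w) (m \<mu>) I x $ K)) has_sum
     (\<Sum>I\<in>\<T>. of_int (weight \<Delta> I) * (\<Sum>x\<in>box I. ?P I x / of_nat (card (\<H> I))))) (dual_lattice L)"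
    by (intro has_sum_finite_sum has_sum_cmult_right top_sum)
  also have "(\<lambda>\<mu>. \<Sum>I\<in>\<T>. of_int (weight \<Delta> I) * (\<Sum>x\<in>box I. ?\<chi> \<mu> * local_fps (snd w) (m \<mu>) I x $ K)) =
     (\<lambda>\<mu>. ?\<chi> \<mu> * genus_coeff (snd w) \<mu> $ K)"
    by (simp add: genus_coeff_def m_def fps_sum_nth sum_distrib_left mult_ac)
  also have "(\<Sum>I\<in>\<T>. of_int (weight \<Delta> I) * (\<Sum>x\<in>box I. ?P I x / of_nat (card (\<H> I)))) =
     genus_fps r w $ K"
    unfolding genus_fps_nth
  proof (rule sum.cong[OF refl])
    fix I assume I: "I \<in> \<T>"
    have "(\<Sum>(h1, h2)\<in>\<H> I \<times> \<H> I. point_fps I (normal_rep V I h1) w (r I h2)) $ K =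
       (\<Sum>h1\<in>\<H> I. \<Sum>h\<in>\<H> I. point_fps I (normal_rep V I h1) w (r I h) $ K)"
      by (simp add: fps_sum_nth sum.cartesian_product case_prod_unfold)
    also have "\<dots> = (\<Sum>x\<in>box I. \<Sum>h\<in>\<H> I. point_fps I x w (r I h) $ K)"
      by (rule sum_H_group[OF topD(1)[OF I]])
    finally show "of_int (weight \<Delta> I) * (\<Sum>x\<in>box I. ?P I x / of_nat (card (\<H> I))) =
      of_int (weight \<Delta> I) / of_nat (card (\<H> I)) *
      (\<Sum>(h1, h2)\<in>\<H> I \<times> \<H> I. point_fps I (normal_rep V I h1) w (r I h2)) $ K"
      by (simp add: sum_divide_distrib [symmetric])
  qed
  finally show ?thesis .
qed

text \<open>For |m i| <= K the bound is clear. The modes beyond that range have a sign for which the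
  left side is at most 0, by \<open>mode_fps_nth_nonzero\<close>.\<close>

lemma local_fps_support:
  assumes I: "I \<in> \<T>" and x: "x \<in> box I" and nz: "local_fps v m I x $ K \<noteq> 0" and i: "i \<in> I"
  shows "of_int (m i) * u I i v \<le> of_nat K * \<bar>u I i v\<bar>"
proof -
  note I' = topD[OF I]
  obtain k where k: "k \<le> K" "mode_fps denom (pidx I x i) (\<zeta> i) (u I i v > 0) (m i) $ k \<noteq> 0"
    using fps_prod_nth_nonzero[OF I'(3) nz[unfolded local_fps_def] i] by auto
  from mode_fps_nth_nonzero[OF pidx(2)[OF I x i] k(2)] show ?thesis
  proof
    assume "\<bar>m i\<bar> \<le> int k"
    hence "\<bar>real_of_int (m i)\<bar> \<le> of_nat K" using k(1) by linarith
    hence "\<bar>real_of_int (m i)\<bar> * \<bar>u I i v\<bar> \<le> of_nat K * \<bar>u I i v\<bar>" by (intro mult_right_mono) auto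
    moreover have "of_int (m i) * u I i v \<le> \<bar>real_of_int (m i)\<bar> * \<bar>u I i v\<bar>"
      unfolding abs_mult [symmetric] by (rule abs_ge_self)
    ultimately show ?thesis by linarith
  next
    assume "pidx I x i = 0 \<and> (if u I i v > 0 then m i < 0 else m i > 0)"
    hence "of_int (m i) * u I i v \<le> 0" by (auto simp: mult_le_0_iff split: if_splits)
    moreover have "0 \<le> of_nat K * \<bar>u I i v\<bar>" by simp
    ultimately show ?thesis by linarith
  qed
qed

definition coord_norm :: "'v \<Rightarrow> real" where
  "coord_norm v = (\<Sum>I\<in>\<T>. \<Sum>i\<in>I. \<bar>u I i v\<bar>)"

lemma genus_coeff_support:
  assumes \<mu>: "\<mu> \<in> dual_lattice L" and nz: "genus_coeff v \<mu> $ K \<noteq> 0"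
  shows "\<mu> v \<le> of_nat K * coord_norm v"
proof -
  define m where "m = (\<lambda>i. int_pairing \<mu> (V i))"
  have "(\<Sum>I\<in>\<T>. of_int (weight \<Delta> I) * (\<Sum>x\<in>box I. local_fps v m I x $ K)) \<noteq> 0"
    using nz by (simp add: genus_coeff_def m_def fps_sum_nth)
  then obtain I where I: "I \<in> \<T>" "(\<Sum>x\<in>box I. local_fps v m I x $ K) \<noteq> 0"
    by (metis (no_types, lifting) mult_zero_right sum.neutral)
  then obtain x where x: "x \<in> box I" "local_fps v m I x $ K \<noteq> 0" by (meson sum.neutral)
  note I' = topD[OF I(1)]
  have "\<mu> v = (\<Sum>i\<in>I. of_int (m i) * u I i v)"
    unfolding m_def by (rule dual_lattice_expand[OF \<mu> I'(1)]) (simp add: span_top[OF I(1)])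
  also have "\<dots> \<le> (\<Sum>i\<in>I. of_nat K * \<bar>u I i v\<bar>)"
    by (intro sum_mono local_fps_support[OF I(1) x])
  also have "\<dots> = of_nat K * (\<Sum>i\<in>I. \<bar>u I i v\<bar>)" by (simp add: sum_distrib_left)
  also have "\<dots> \<le> of_nat K * coord_norm v" unfolding coord_norm_def
    using finite_top I(1) by (intro mult_left_mono member_le_sum) (auto intro: sum_nonneg)
  finally show ?thesis .
qed

lemma genus_coeff_independent:
  assumes "generic v" "generic v'" "\<mu> \<in> dual_lattice L"
  shows "genus_coeff v \<mu> = genus_coeff v' \<mu>"
  using genus_coeff_fls[OF assms(1,3)] genus_coeff_fls[OF assms(2,3)] by (metis fps_to_fls_eq_imp_fps_eq)

text \<open>The coefficients are the same for every generic direction, and -v is generic with v, so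
  the one-sided bound holds in both directions.\<close>

lemma genus_coeff_abs_support:
  assumes v: "generic v" "generic v'" and \<mu>: "\<mu> \<in> dual_lattice L" and nz: "genus_coeff v' \<mu> $ K \<noteq> 0"
  shows "\<bar>\<mu> v\<bar> \<le> of_nat K * (coord_norm v + coord_norm (- v))"
proof -
  have lin: "linear \<mu>" using \<mu> by (simp add: dual_lattice_def)
  have "genus_coeff v \<mu> $ K \<noteq> 0" "genus_coeff (- v) \<mu> $ K \<noteq> 0"
    using nz genus_coeff_independent[OF v(2,1) \<mu>] genus_coeff_independent[OF v(2) generic_uminus[OF v(1)] \<mu>] by auto
  from this[THEN genus_coeff_support[OF \<mu>]]
  have "\<mu> v \<le> of_nat K * coord_norm v" "- \<mu> v \<le> of_nat K * coord_norm (- v)" by (auto simp: linear_neg[OF lin])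
  moreover have "0 \<le> of_nat K * coord_norm v" "0 \<le> of_nat K * coord_norm (- v)"
    by (auto simp: coord_norm_def intro!: mult_nonneg_nonneg sum_nonneg)
  ultimately show ?thesis by (simp add: distrib_left)
qed

text \<open>Two-sided bounds at v and at a generic v + s e bound \<open>\<mu> e\<close> for each
  basis vector e of L, and only finitely many points of the dual lattice satisfy such
  bounds.\<close>

lemma finite_genus_coeff_support:
  assumes v: "generic v"
  shows "finite {\<mu> \<in> dual_lattice L. genus_coeff v \<mu> $ K \<noteq> 0}"
proof -
  obtain s where s: "\<And>e. s e \<noteq> 0" "\<And>e. generic (v + s e *\<^sub>R e)"
    using generic_perturb[OF v] by metis
  define b where "b = (\<lambda>v. of_nat K * (coord_norm v + coord_norm (- v)))"
  have b0: "b v \<ge> 0" for v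
    by (auto simp: b_def coord_norm_def intro!: mult_nonneg_nonneg add_nonneg_nonneg sum_nonneg)
  define B where "B = (\<Sum>e\<in>basis. (b v + b (v + s e *\<^sub>R e)) / \<bar>s e\<bar>)"
  have "\<bar>\<mu> e\<bar> \<le> B" if \<mu>: "\<mu> \<in> dual_lattice L" "genus_coeff v \<mu> $ K \<noteq> 0" and e: "e \<in> basis" for \<mu> e
  proof -
    have lin: "linear \<mu>" using \<mu> by (simp add: dual_lattice_def)
    have "\<bar>\<mu> v\<bar> \<le> b v" "\<bar>\<mu> (v + s e *\<^sub>R e)\<bar> \<le> b (v + s e *\<^sub>R e)"
      unfolding b_def by (rule genus_coeff_abs_support[OF _ v \<mu>]; rule v s(2))+
    moreover have "\<mu> (v + s e *\<^sub>R e) = \<mu> v + s e * \<mu> e" by (simp add: linear_add[OF lin] linear_scale[OF lin])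
    ultimately have "\<bar>s e * \<mu> e\<bar> \<le> b v + b (v + s e *\<^sub>R e)" by linarith
    hence "\<bar>\<mu> e\<bar> \<le> (b v + b (v + s e *\<^sub>R e)) / \<bar>s e\<bar>"
      using s(1)[of e] by (simp add: abs_mult pos_le_divide_eq mult.commute)
    also have "\<dots> \<le> B" unfolding B_def
      using basis(1) e b0 by (intro member_le_sum) auto
    finally show ?thesis .
  qed
  hence "{\<mu> \<in> dual_lattice L. genus_coeff v \<mu> $ K \<noteq> 0} \<subseteq> {\<mu> \<in> dual_lattice L. \<forall>e\<in>basis. \<bar>\<mu> e\<bar> \<le> B}" by auto
  thus ?thesis by (rule finite_subset) (rule finite_bounded_dual_lattice)
qed

text \<open>The substitution of Q^\<open>denom\<close> for q in \<open>genus_coeff_fls\<close>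
  leaves only integral powers of q, although single factors have fractional ones.\<close>

lemma genus_coeff_nth:
  assumes "generic v" "\<mu> \<in> dual_lattice L"
  shows "genus_coeff v \<mu> $ K = (if denom dvd K then fls_nth (rhs \<mu>) (int (K div denom)) else 0)"
proof -
  have "genus_coeff v \<mu> $ K = fls_nth (fps_to_fls (genus_coeff v \<mu>)) (int K)" by simp
  also have "\<dots> = fls_nth (fls_compose_power (rhs \<mu>) denom) (int K)"
    by (simp only: genus_coeff_fls[OF assms])
  also have "\<dots> = (if denom dvd K then fls_nth (rhs \<mu>) (int (K div denom)) else 0)"
    using denom_pos by (simp add: fls_compose_power.rep_eq zdiv_int)
  finally show ?thesis .
qed

text \<open>The bracket is computed among Laurent series; its principal part vanishes because it
  agrees with a power series after the substitution.\<close>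

lemma rhs_coeff_nth_neg:
  assumes "\<mu> \<in> dual_lattice L" "N < 0"
  shows "fls_nth (rhs \<mu>) N = 0"
proof -
  obtain v where v: "generic v" using generic_exists by blast
  have "fls_nth (rhs \<mu>) N = fls_nth (fls_compose_power (rhs \<mu>) denom) (int denom * N)"
    using denom_pos by (simp add: fls_compose_power.rep_eq)
  also have "\<dots> = fls_nth (fps_to_fls (genus_coeff v \<mu>)) (int denom * N)"
    by (simp only: genus_coeff_fls[OF v assms(1)])
  also have "\<dots> = 0" using assms(2) denom_pos by (simp add: mult_less_0_iff)
  finally show ?thesis .
qed

definition rhs_support :: "nat \<Rightarrow> ('v \<Rightarrow> real) set" where
  "rhs_support N = {\<mu> \<in> dual_lattice L. fls_nth (rhs \<mu>) (int N) \<noteq> 0}"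

lemma finite_rhs_support: "finite (rhs_support N)"
proof -
  obtain v where v: "generic v" using generic_exists by blast
  have "rhs_support N = {\<mu> \<in> dual_lattice L. genus_coeff v \<mu> $ (denom * N) \<noteq> 0}"
    using genus_coeff_nth[OF v] denom_pos by (auto simp: rhs_support_def)
  thus ?thesis using finite_genus_coeff_support[OF v] by simp
qed

definition rhs_eval :: "nat \<Rightarrow> 'v \<times> 'v \<Rightarrow> complex" where
  "rhs_eval N w = (\<Sum>\<mu>\<in>rhs_support N. character (\<lambda>x. - \<mu> x) w * fls_nth (rhs \<mu>) (int N))"

lemma genus_fps_nth_generic:
  assumes r: "\<And>I h. I \<in> \<T> \<Longrightarrow> h \<in> \<H> I \<Longrightarrow> r I h \<in> h" and v: "generic (snd w)"
  shows "genus_fps r w $ K = (if denom dvd K then rhs_eval (K div denom) w else 0)"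
proof (cases "denom dvd K")
  case True
  have "((\<lambda>\<mu>. character (\<lambda>x. - \<mu> x) w * genus_coeff (snd w) \<mu> $ K) has_sum rhs_eval (K div denom) w) (dual_lattice L)"
  proof (rule has_sum_finite_neutralI[of "rhs_support (K div denom)"])
    show "rhs_eval (K div denom) w = (\<Sum>\<mu>\<in>rhs_support (K div denom). character (\<lambda>x. - \<mu> x) w * genus_coeff (snd w) \<mu> $ K)"
      unfolding rhs_eval_def using True
      by (intro sum.cong refl) (auto simp: genus_coeff_nth[OF v] rhs_support_def)
  next
    show "finite (rhs_support (K div denom))" by (rule finite_rhs_support)
    show "rhs_support (K div denom) \<subseteq> dual_lattice L" by (auto simp: rhs_support_def)
    show "character (\<lambda>x. - \<mu> x) w * genus_coeff (snd w) \<mu> $ K = 0" if "\<mu> \<in> dual_lattice L - rhs_support (K div denom)" for \<mu>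
      using that by (auto simp: genus_coeff_nth[OF v] rhs_support_def)
  qed
  from has_sum_unique[OF genus_fps_has_sum[OF r v] this] True show ?thesis by simp
next
  case False
  have "((\<lambda>\<mu>. character (\<lambda>x. - \<mu> x) w * genus_coeff (snd w) \<mu> $ K) has_sum 0) (dual_lattice L)"
    by (rule has_sum_0) (use False in \<open>simp add: genus_coeff_nth[OF v]\<close>)
  from has_sum_unique[OF genus_fps_has_sum[OF r v] this] False show ?thesis by simp
qed

section \<open>Extension to all regular points\<close>

lemma tendsto_genus_fps:
  assumes r: "\<And>I h. I \<in> \<T> \<Longrightarrow> h \<in> \<H> I \<Longrightarrow> r I h \<in> h"
    and w: "w \<in> regular"
  shows "((\<lambda>s. genus_fps r (fst w, snd w + s *\<^sub>R g) $ K) \<longlongrightarrow> genus_fps r w $ K) (at 0)"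
proof -
  have rL: "r I h \<in> L" if "I \<in> \<T>" "h \<in> \<H> I" for I h
    using normal_rep(4)[OF topD(1) _ r] that by blast
  have pt: "((\<lambda>s. point_fps I x (fst w, snd w + s *\<^sub>R g) y $ K) \<longlongrightarrow> point_fps I x w y $ K) (at 0)"
    if "I \<in> \<T>" "y \<in> L" for I x y
    unfolding point_fps_def
  proof (rule tendsto_fps_prod[OF topD(3)[OF that(1)]])
    fix i K assume "i \<in> I"
    thus "((\<lambda>s. (fps_const (twist I i x) *
        factor_fps denom (pidx I x i) (\<zeta> i) (tval I i (fst w, snd w + s *\<^sub>R g) y)) $ K) \<longlongrightarrow>
      (fps_const (twist I i x) * factor_fps denom (pidx I x i) (\<zeta> i) (tval I i w y)) $ K) (at 0)"
      unfolding fps_mult_left_const_nth using tval_neq_1[OF that(1) _ w that(2)]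
      by (intro tendsto_mult tendsto_const tendsto_factor_fps tendsto_tval that) auto
  qed
  show ?thesis
    unfolding genus_fps_nth fps_sum_nth case_prod_unfold
    by (intro tendsto_sum tendsto_mult tendsto_const pt rL) auto
qed

text \<open>
  Both sides are continuous along the line \<open>w + \<i> s g\<close>, which meets the generic points in all but finitely
  many values of \<open>s\<close>.
\<close>

lemma genus_fps_nth_regular:
  assumes r: "\<And>I h. I \<in> \<T> \<Longrightarrow> h \<in> \<H> I \<Longrightarrow> r I h \<in> h"
    and w: "w \<in> regular"
  shows "genus_fps r w $ K = (if denom dvd K then rhs_eval (K div denom) w else 0)"
proof -
  obtain g where g: "generic g" using generic_exists by blast
  have "eventually (\<lambda>s. s \<notin> {s. \<not> generic (snd w + s *\<^sub>R g)}) (at 0)"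
    by (rule finite_avoid_at[OF finite_nongeneric_line[OF g]])
  hence ev: "eventually (\<lambda>s. (if denom dvd K then rhs_eval (K div denom) (fst w, snd w + s *\<^sub>R g) else 0) =
      genus_fps r (fst w, snd w + s *\<^sub>R g) $ K) (at 0)"
    by eventually_elim (use genus_fps_nth_generic[OF r] in simp)
  have "((\<lambda>s. rhs_eval N (fst w, snd w + s *\<^sub>R g)) \<longlongrightarrow> rhs_eval N w) (at 0)" for N
    unfolding rhs_eval_def
  proof (intro tendsto_sum tendsto_mult tendsto_const tendsto_character)
    fix \<mu> assume "\<mu> \<in> rhs_support N"
    hence "linear \<mu>" by (auto simp: rhs_support_def dual_lattice_def)
    thus "linear (\<lambda>x. - \<mu> x)" by (rule linear_compose_neg)
  qed
  hence "((\<lambda>s. if denom dvd K then rhs_eval (K div denom) (fst w, snd w + s *\<^sub>R g) else 0) \<longlongrightarrow>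
      (if denom dvd K then rhs_eval (K div denom) w else 0)) (at 0)" by simp
  hence "((\<lambda>s. genus_fps r (fst w, snd w + s *\<^sub>R g) $ K) \<longlongrightarrow> (if denom dvd K then rhs_eval (K div denom) w else 0)) (at 0)"
    using ev by (rule Lim_transform_eventually)
  with tendsto_genus_fps[OF r w] show ?thesis
    by (intro tendsto_unique[of "at (0::real)"]) auto
qed

section \<open>Assembly of the series with coefficients in the character ring\<close>

lemma dual_lattice_uminus: "\<mu> \<in> dual_lattice L \<Longrightarrow> (\<lambda>x. - \<mu> x) \<in> dual_lattice L"
  by (auto simp: dual_lattice_def intro: linear_compose_neg)

text \<open>It is indexed by the character m itself, while the bracket for u belongs to the
  character -u, hence the sign. \<open>Abs_poly_mapping\<close> is faithful here because
  \<open>finite_rhs_support\<close> gives finite support.\<close>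

definition genus_series :: "(('v \<Rightarrow> real) \<Rightarrow>\<^sub>0 complex) fps" where
  "genus_series = Abs_fps (\<lambda>N. Abs_poly_mapping (\<lambda>m. if m \<in> dual_lattice L
     then fls_nth (rhs (\<lambda>x. - m x)) (int N) else 0))"

lemma lookup_genus_series:
  "Poly_Mapping.lookup (genus_series $ N) m = (if m \<in> dual_lattice L
     then fls_nth (rhs (\<lambda>x. - m x)) (int N) else 0)"
proof -
  have "{m. (if m \<in> dual_lattice L then fls_nth (rhs (\<lambda>x. - m x)) (int N) else 0) \<noteq> 0} \<subseteq>
     (\<lambda>\<mu> x. - \<mu> x) ` rhs_support N"
  proof
    fix m assume "m \<in> {m. (if m \<in> dual_lattice L then fls_nth (rhs (\<lambda>x. - m x)) (int N) else 0) \<noteq> 0}"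
    hence "(\<lambda>x. - m x) \<in> rhs_support N"
      by (auto simp: rhs_support_def dual_lattice_uminus split: if_splits)
    thus "m \<in> (\<lambda>\<mu> x. - \<mu> x) ` rhs_support N" by (rule image_eqI[rotated]) simp
  qed
  hence "finite {m. (if m \<in> dual_lattice L then fls_nth (rhs (\<lambda>x. - m x)) (int N) else 0) \<noteq> 0}"
    using finite_rhs_support by (rule finite_subset[OF _ finite_imageI])
  thus ?thesis by (simp add: genus_series_def lookup_Abs_poly_mapping)
qed

lemma character_eval_genus_series: "character_eval (genus_series $ N) w = rhs_eval N w"
  unfolding character_eval_def rhs_eval_def
proof (rule sum.reindex_bij_witness[where i = "\<lambda>\<mu> x. - \<mu> x" and j = "\<lambda>\<mu> x. - \<mu> x"])
  fix m assume "m \<in> Poly_Mapping.keys (genus_series $ N)"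
  hence nz: "Poly_Mapping.lookup (genus_series $ N) m \<noteq> 0" by (simp add: in_keys_iff)
  thus "(\<lambda>x. - m x) \<in> rhs_support N"
    by (auto simp: lookup_genus_series rhs_support_def dual_lattice_uminus split: if_splits)
  show "character (\<lambda>x. - (- m x)) w * fls_nth (rhs (\<lambda>x. - m x)) (int N) =
     Poly_Mapping.lookup (genus_series $ N) m * character m w"
    using nz by (auto simp: lookup_genus_series split: if_splits)
next
  fix \<mu> assume "\<mu> \<in> rhs_support N"
  thus "(\<lambda>x. - \<mu> x) \<in> Poly_Mapping.keys (genus_series $ N)"
    by (auto simp: in_keys_iff lookup_genus_series rhs_support_def dual_lattice_uminus)
qed auto

lemma genus_q_expansion:
  assumes r: "\<And>I h. I \<in> \<T> \<Longrightarrow> h \<in> \<H> I \<Longrightarrow> r I h \<in> h"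
  shows "q_expansion L (regular) (genus r) genus_series"
  unfolding q_expansion_def
proof (intro conjI allI ballI)
  fix N show "Poly_Mapping.keys (genus_series $ N) \<subseteq> dual_lattice L"
    by (auto simp: in_keys_iff lookup_genus_series split: if_splits)
next
  fix w assume w: "w \<in> regular"
  have "expands denom (\<lambda>\<tau>. genus r \<tau> w) (genus_fps r w)"
    by (rule genus_expands[OF _ w]) (rule r)
  note ex = this[unfolded expands_def]
  have "eventually (\<lambda>\<tau>. ereal (norm (e2pi (\<tau> / of_nat denom))) < fps_conv_radius (genus_fps r w)) cusp"
    using ex by (intro eventually_less_radius denom_pos) auto
  moreover have "eventually (\<lambda>\<tau>. genus r \<tau> w = eval_fps (genus_fps r w) (e2pi (\<tau> / of_nat denom))) cusp"
    using ex by blast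
  ultimately have "eventually (\<lambda>\<tau>. (\<lambda>N. character_eval (genus_series $ N) w * e2pi \<tau> ^ N) sums genus r \<tau> w) cusp"
  proof eventually_elim
    case (elim \<tau>)
    define Q where "Q = e2pi (\<tau> / of_nat denom)"
    have QM: "Q ^ denom = e2pi \<tau>" using denom_pos by (simp add: Q_def flip: e2pi_of_nat)
    have "(\<lambda>K. genus_fps r w $ K * Q ^ K) sums genus r \<tau> w"
      unfolding elim(2) Q_def using elim(1) by (rule sums_eval_fps)
    \<comment> \<open>Degrees that are not multiples of \<open>denom\<close> vanish, so the series
      in Q is a series in q = Q^\<open>denom\<close>.\<close>
    also have "?this \<longleftrightarrow> (\<lambda>N. genus_fps r w $ (denom * N) * Q ^ (denom * N)) sums genus r \<tau> w"
    proof (rule sums_mono_reindex[symmetric])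
      show "strict_mono (\<lambda>N. denom * N)" using denom_pos by (auto simp: strict_mono_def)
      fix K assume "K \<notin> range (\<lambda>N. denom * N)"
      hence "\<not> denom dvd K" by (auto simp: dvd_def)
      thus "genus_fps r w $ K * Q ^ K = 0" by (simp add: genus_fps_nth_regular[OF r w])
    qed
    also have "(\<lambda>N. genus_fps r w $ (denom * N) * Q ^ (denom * N)) = (\<lambda>N. character_eval (genus_series $ N) w * e2pi \<tau> ^ N)"
      using denom_pos by (simp add: genus_fps_nth_regular[OF r w] character_eval_genus_series power_mult QM)
    finally show ?case .
  qed
  thus "\<exists>\<epsilon>>0. \<forall>\<tau>. Im \<tau> > 0 \<and> norm (e2pi \<tau>) < \<epsilon> \<longrightarrow>
     (\<lambda>N. character_eval (genus_series $ N) w * e2pi \<tau> ^ N) sums genus r \<tau> w"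
    by (rule eventually_Im_imp_norm_e2pi)
qed

lemma character_coeff_genus_series:
  assumes "\<mu> \<in> dual_lattice L"
  shows "fps_to_fls (character_coeff genus_series (\<lambda>x. - \<mu> x)) = rhs \<mu>"
proof (rule fls_eqI)
  fix N :: int
  show "fls_nth (fps_to_fls (character_coeff genus_series (\<lambda>x. - \<mu> x))) N = fls_nth (rhs \<mu>) N"
    using rhs_coeff_nth_neg[OF assms, of N]
    by (auto simp: character_coeff_def lookup_genus_series dual_lattice_uminus[OF assms])
qed

end

theorem theorem5p1:
  fixes L :: "'v::real_vector set"
    and n :: nat
    and \<Delta> :: "('i, 'v) multi_fan"
    and V :: "'i \<Rightarrow> 'v"
    and d :: "'i \<Rightarrow> rat"
    and r :: "'i set \<Rightarrow> 'v set \<Rightarrow> 'v"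
    and \<sigma> :: complex
  assumes "lattice_of_rank L n"
    and "simplicial_multi_fan L n \<Delta>"
    and "complete_multi_fan n \<Delta>"
    and "edge_vectors L \<Delta> V"
    and "\<And>I h. I \<in> k_simplices \<Delta> n \<Longrightarrow> h \<in> H_group L \<Delta> V I \<Longrightarrow> r I h \<in> h"
    and "\<And>i. i \<in> vertices \<Delta> \<Longrightarrow> zeta_pow \<sigma> (of_rat (d i)) \<noteq> 1"
  shows "\<exists>E. q_expansion L (regular_points L n \<Delta> V) (elliptic_genus L n \<Delta> V d r \<sigma>) E \<and>
             (\<forall>u\<in>dual_lattice L.
                fps_to_fls (character_coeff E (\<lambda>x. - u x)) = rhs_coeff L n \<Delta> V d \<sigma> u)"
proof -
  interpret divisor_fan L n \<Delta> V d \<sigma>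
    by unfold_locales (use assms in auto)
  have "q_expansion L (regular_points L n \<Delta> V) (elliptic_genus L n \<Delta> V d r \<sigma>) genus_series"
    by (rule genus_q_expansion) (rule assms(5))
  thus ?thesis using character_coeff_genus_series by blast
qed

end
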